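(* Let $S_j$ be local potentials satisfying (A)–(E) and let $\omega\in\mathbb{R}^d\setminus\mathbb{Q}^d$. Then there exists a ghost circle $\Gamma_\omega\subset\overline{\mathcal{B}}_\omega$ for the $S_j$ that contains a global minimizer $x$, and hence contains the entire Aubry–Mather set $\mathcal{M}(x)$.
   Context: Notation: $\|i\|=\sum_{k=1}^d|i_k|$, $B_j^r=\{k:\|k-j\|\le r\}$, $(\tau_{k,l}x)_i=x_{i+k}+l$. Local potentials $S_j:\mathbb{R}^{\mathbb{Z}^d}\to\mathbb{R}$, $j\in\mathbb{Z}^d$, satisfy: (A) there is $r\in(0,\infty)$ and $C^2$ functions $s_j:\mathbb{R}^{B_j^r}\to\mathbb{R}$ with $S_j(x)=s_j(x|_{B_j^r})$; (B) $S_j(\tau_{k,l}x)=S_{j+k}(x)$; (C) each $S_j$ is bounded below and $S_j(x)\to\infty$ as $|x_k-x_j|\to\infty$ whenever $\|k-j\|=1$; (D) $\partial_{i,k}S_j\le0$ for $i\ne k$, and $\partial_{i,k}S_i<0$ when $\|i-k\|=1$; (E) $|\partial_{i,k}S_j|\le C$ uniformly. Birkhoff: $\tau_{k,l}x\ge x$ or $\tau_{k,l}x\le x$ (pointwise) for all $(k,l)$; rotation vector $\omega$: $\lim_nx_{ni}/n=\langle\omega,i\rangle$. $\overline{\mathcal{B}}_\omega$: Birkhoff configurations with rotation vector $\omega$ and $\tau_{k,l}x=x$ whenever $\langle\omega,k\rangle+l=0$. $\mathbb{X}=\{x:\sum_i2^{-\|i\|}|x_i|<\infty\}$; $(\nabla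 W(x))_i=\sum_{\|j-i\|\le r}\partial_iS_j(x)$; $\Psi_t$ the complete flow of $\dot x=-\nabla W(x)$ on $\mathbb{X}$. A ghost circle is a set $\Gamma\subset\mathbb{R}^{\mathbb{Z}^d}$ that is nonempty, closed and connected (pointwise topology), strictly ordered (for $x,y\in\Gamma$: $x\ll y$, $x=y$ or $y\ll x$), shift-invariant, and satisfies $\Psi_t(\Gamma)=\Gamma$ for all $t$. Global minimizer: $W_B(x+y)\ge W_B(x)$ for every finite $B$ and every $y$ supported in $\mathring{B}^{(r)}=\{i\in B:B_i^r\subset B\}$, $W_B=\sum_{j\in B}S_j$. For a global minimizer $x\in\overline{\mathcal{B}}_\omega$: $\widetilde{\mathcal{M}}(x)$ is the pointwise closure of $\{\tau_{k,l}x\}$, and $\mathcal{M}(x)=\{y\in\widetilde{\mathcal{M}}(x):y=\lim_n\tau_{k_n,l_n}y\text{ pointwise for some }(k_n,l_n)\text{ with }\langle\omega,k_n\rangle+l_n\ne0\}$. *)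

theory Defs
  imports "HOL-Analysis.Analysis"
begin

(* Lattice Z^d is modelled as int ^ 'd with 'd :: finite (d = CARD('d)).
   Configurations are functions (int ^ 'd) => real.
   The function type carries the product (= pointwise) topology. *)

type_synonym ('d) conf = "(int ^ ('d::finite)) \<Rightarrow> real"
type_synonym ('d) pot = "(int ^ ('d::finite)) \<Rightarrow> ('d::finite) conf \<Rightarrow> real"

definition lnorm :: "int ^ 'd \<Rightarrow> int" where
  "lnorm i = (\<Sum>m\<in>UNIV. \<bar>i $ m\<bar>)"

definition lball :: "int ^ 'd \<Rightarrow> real \<Rightarrow> (int ^ 'd) set" where
  "lball j r = {k. real_of_int (lnorm (k - j)) \<le> r}"

definition ipair :: "real ^ 'd \<Rightarrow> int ^ 'd \<Rightarrow> real" where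
  "ipair w k = (\<Sum>m\<in>UNIV. w $ m * real_of_int (k $ m))"

definition tau :: "int ^ 'd \<Rightarrow> int \<Rightarrow> ('d::finite) conf \<Rightarrow> ('d::finite) conf" where
  "tau k l x = (\<lambda>i. x (i + k) + real_of_int l)"

definition pd :: "int ^ 'd \<Rightarrow> (('d::finite) conf \<Rightarrow> real) \<Rightarrow> ('d::finite) conf \<Rightarrow> real" where
  "pd i F x = deriv (\<lambda>t. F (x(i := x i + t))) 0"

definition pdiff :: "int ^ 'd \<Rightarrow> (('d::finite) conf \<Rightarrow> real) \<Rightarrow> bool" where
  "pdiff i F \<longleftrightarrow> (\<forall>x. (\<lambda>t. F (x(i := x i + t))) differentiable (at 0))"

definition condA :: "('d::finite) pot \<Rightarrow> real \<Rightarrow> bool" where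
  "condA S r \<longleftrightarrow> 0 < r \<and>
     (\<forall>j x y. (\<forall>k\<in>lball j r. x k = y k) \<longrightarrow> S j x = S j y) \<and>
     (\<forall>j. continuous_on UNIV (S j)) \<and>
     (\<forall>j i. pdiff i (S j) \<and> continuous_on UNIV (pd i (S j))) \<and>
     (\<forall>j i k. pdiff k (pd i (S j)) \<and> continuous_on UNIV (pd k (pd i (S j))))"

definition condB :: "('d::finite) pot \<Rightarrow> bool" where
  "condB S \<longleftrightarrow> (\<forall>j k l x. S j (tau k l x) = S (j + k) x)"

definition condC :: "('d::finite) pot \<Rightarrow> bool" where
  "condC S \<longleftrightarrow> (\<forall>j. \<exists>c. \<forall>x. c \<le> S j x) \<and>
     (\<forall>j k. lnorm (k - j) = 1 \<longrightarrow>
        (\<forall>M. \<exists>R. \<forall>x. R \<le> \<bar>x k - x j\<bar> \<longrightarrow> M \<le> S j x))"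

definition condD :: "('d::finite) pot \<Rightarrow> bool" where
  "condD S \<longleftrightarrow> (\<forall>i k j x. i \<noteq> k \<longrightarrow> pd i (pd k (S j)) x \<le> 0) \<and>
     (\<forall>i k x. lnorm (i - k) = 1 \<longrightarrow> pd i (pd k (S i)) x < 0)"

definition condE :: "('d::finite) pot \<Rightarrow> bool" where
  "condE S \<longleftrightarrow> (\<exists>C. \<forall>i k j x. \<bar>pd i (pd k (S j)) x\<bar> \<le> C)"

definition conf_le :: "('d::finite) conf \<Rightarrow> ('d::finite) conf \<Rightarrow> bool" where
  "conf_le x y \<longleftrightarrow> (\<forall>i. x i \<le> y i)"

definition conf_ll :: "('d::finite) conf \<Rightarrow> ('d::finite) conf \<Rightarrow> bool" where
  "conf_ll x y \<longleftrightarrow> (\<forall>i. x i < y i)"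

definition birkhoff :: "('d::finite) conf \<Rightarrow> bool" where
  "birkhoff x \<longleftrightarrow> (\<forall>k l. conf_le x (tau k l x) \<or> conf_le (tau k l x) x)"

definition has_rotvec :: "('d::finite) conf \<Rightarrow> real ^ 'd \<Rightarrow> bool" where
  "has_rotvec x w \<longleftrightarrow>
     (\<forall>i. (\<lambda>n::nat. x (\<chi> m. int n * i $ m) / real n) \<longlonglongrightarrow> ipair w i)"

definition Bbar :: "real ^ 'd \<Rightarrow> ('d::finite) conf set" where
  "Bbar w = {x. birkhoff x \<and> has_rotvec x w \<and>
     (\<forall>k l. ipair w k + real_of_int l = 0 \<longrightarrow> tau k l x = x)}"

definition weightX :: "('d::finite) conf \<Rightarrow> (int ^ 'd) \<Rightarrow> real" where
  "weightX x i = 2 powr (- real_of_int (lnorm i)) * \<bar>x i\<bar>"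

definition inX :: "('d::finite) conf \<Rightarrow> bool" where
  "inX x \<longleftrightarrow> weightX x summable_on UNIV"

definition normX :: "('d::finite) conf \<Rightarrow> real" where
  "normX x = infsum (weightX x) UNIV"

definition gradW :: "('d::finite) pot \<Rightarrow> real \<Rightarrow> ('d::finite) conf \<Rightarrow> ('d::finite) conf" where
  "gradW S r x = (\<lambda>i. \<Sum>j\<in>lball i r. pd i (S j) x)"

definition flowline :: "('d::finite) pot \<Rightarrow> real \<Rightarrow> (real \<Rightarrow> ('d::finite) conf) \<Rightarrow> bool" where
  "flowline S r g \<longleftrightarrow> (\<forall>t. inX (g t)) \<and>
     (\<forall>t. ((\<lambda>s. normX (\<lambda>i. g s i - g t i)) \<longlongrightarrow> 0) (at t)) \<and>
     (\<forall>t i. ((\<lambda>s. g s i) has_real_derivative (- gradW S r (g t) i)) (at t))"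

definition Psi :: "('d::finite) pot \<Rightarrow> real \<Rightarrow> real \<Rightarrow> ('d::finite) conf \<Rightarrow> ('d::finite) conf" where
  "Psi S r t x = (THE g. flowline S r g \<and> g 0 = x) t"

definition ghost_circle :: "('d::finite) pot \<Rightarrow> real \<Rightarrow> ('d::finite) conf set \<Rightarrow> bool" where
  "ghost_circle S r G \<longleftrightarrow> G \<noteq> {} \<and> closed G \<and> connected G \<and>
     (\<forall>x\<in>G. \<forall>y\<in>G. conf_ll x y \<or> x = y \<or> conf_ll y x) \<and>
     (\<forall>k l. tau k l ` G = G) \<and>
     (\<forall>x\<in>G. inX x) \<and>
     (\<forall>t. Psi S r t ` G = G)"

definition WB :: "('d::finite) pot \<Rightarrow> (int ^ 'd) set \<Rightarrow> ('d::finite) conf \<Rightarrow> real" where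
  "WB S B x = (\<Sum>j\<in>B. S j x)"

definition interior_r :: "real \<Rightarrow> (int ^ 'd) set \<Rightarrow> (int ^ 'd) set" where
  "interior_r r B = {i\<in>B. lball i r \<subseteq> B}"

definition global_min :: "('d::finite) pot \<Rightarrow> real \<Rightarrow> ('d::finite) conf \<Rightarrow> bool" where
  "global_min S r x \<longleftrightarrow> (\<forall>B y. finite B \<longrightarrow> (\<forall>i. i \<notin> interior_r r B \<longrightarrow> y i = 0) \<longrightarrow>
      WB S B x \<le> WB S B (\<lambda>i. x i + y i))"

definition Mtilde :: "('d::finite) conf \<Rightarrow> ('d::finite) conf set" where
  "Mtilde x = closure {tau k l x | k l. True}"

definition AM :: "real ^ 'd \<Rightarrow> ('d::finite) conf \<Rightarrow> ('d::finite) conf set" where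
  "AM w x = {y \<in> Mtilde x. \<exists>k :: nat \<Rightarrow> int ^ 'd. \<exists>l :: nat \<Rightarrow> int.
      (\<forall>n. ipair w (k n) + real_of_int (l n) \<noteq> 0) \<and>
      (\<forall>i. (\<lambda>n. tau (k n) (l n) y i) \<longlonglongrightarrow> y i)}"

end

theory Submission
  imports Defs
begin

text \<open>Periodic minimizers are totally ordered, hence Birkhoff, by submodularity and the strong maximum
principle; a limit of them along rational approximations of \<open>w\<close>, followed by a supremum over the
resonant shifts, yields a resonant Birkhoff global minimizer \<open>x\<close>.

By Zorn's lemma the shifts of \<open>x\<close> lie in a maximal totally ordered set \<open>G\<close> that is invariant under
shifts and under the gradient flow. Maximality makes \<open>G\<close> closed, and it remains to exclude gaps,
because a closed chain without gaps is parametrized continuously by the value at the origin.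
The end points \<open>p \<le> q\<close> of a gap are stationary, and the shifts of the gap are disjoint, so that
\<open>q - p\<close> is summable modulo resonances and the energy relative to \<open>p\<close> is a finite Lyapunov function on
the order interval \<open>[p, q]\<close>. If the interval contains another stationary resonant point, then \<open>G\<close>
can be enlarged by its shifts. Otherwise the orbits of the points of the segment from \<open>p\<close> to \<open>q\<close>
accumulate at an entire orbit, which by the energy emanates from \<open>p\<close> or from \<open>q\<close>. Suprema
(respectively infima) of its past are sub- (super-) solutions close to that end point, and their
monotone orbits accumulate at a monotone entire orbit inside the gap, whose shifts enlarge \<open>G\<close>.
This replaces the Morse approximation argument by the connecting orbit argument of Dancer and Hess.\<close>

section \<open>The lattice\<close>

text \<open>Two features of the setting shape the proof. First, \<open>Psi\<close> is defined
  through uniqueness among flowlines in the weighted space, so solutions are handled in growth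
  classes: they are constructed with weight (3/2)^|i|, which dominates linear growth and is summable
  against 2^(-|i|), while an arbitrary flowline is only controlled by 2^|i|; estimates valid for
  every base between 1 and 2 join the two. Second, no strict monotonicity of the flow is proved. In
  a totally ordered set invariant for all real times the order is preserved backwards as well, so a
  contact of two members is an extremum in time of their difference; their velocities agree there
  and the maximum principle forces equality. The same two-sided invariance makes the end points of a
  gap stationary. The energy is never differentiated as an infinite sum: a one-step inequality with
  quadratic error, iterated over shrinking steps, gives its decay. The Dancer-Hess part is
  formulated for an abstract monotone flow because the reflection z -> -z then turns orbits leaving
  q into orbits leaving p.\<close>

lemma lnorm_nonneg [simp]: "0 \<le> lnorm i"
  by (simp add: lnorm_def sum_nonneg)

lemma lnorm_zero [simp]: "lnorm 0 = 0"
  by (simp add: lnorm_def)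

lemma lnorm_eq_0_iff: "lnorm i = 0 \<longleftrightarrow> i = 0"
  by (simp add: lnorm_def sum_nonneg_eq_0_iff vec_eq_iff)

lemma lnorm_minus [simp]: "lnorm (- i) = lnorm i"
  by (simp add: lnorm_def)

lemma lnorm_diff_commute: "lnorm (i - k) = lnorm (k - i)"
  by (simp add: lnorm_def abs_minus_commute)

lemma lnorm_triangle: "lnorm (i + k) \<le> lnorm i + lnorm k"
  unfolding lnorm_def sum.distrib[symmetric] vector_add_component
  by (intro sum_mono abs_triangle_ineq)

lemma lnorm_axis: "lnorm (axis m c) = \<bar>c\<bar>"
proof -
  have "lnorm (axis m c) = (\<Sum>n\<in>UNIV. if n = m then \<bar>c\<bar> else 0)"
    unfolding lnorm_def by (intro sum.cong) (auto simp: axis_def)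
  then show ?thesis by simp
qed

lemma finite_lnorm_le: "finite {k :: int ^ 'd. lnorm k \<le> N}"
proof -
  have "{k :: int ^ 'd. lnorm k \<le> N} \<subseteq> vec_lambda ` (PiE UNIV (\<lambda>_. {-N..N}))"
  proof
    fix k :: "int ^ 'd" assume k: "k \<in> {k. lnorm k \<le> N}"
    have "k $ m \<in> {-N..N}" for m
    proof -
      have "\<bar>k $ m\<bar> \<le> lnorm k"
        unfolding lnorm_def by (rule member_le_sum) auto
      then show ?thesis using k by auto
    qed
    then have "vec_nth k \<in> PiE UNIV (\<lambda>_. {-N..N})" by auto
    then show "k \<in> vec_lambda ` (PiE UNIV (\<lambda>_. {-N..N}))"
      by (intro image_eqI[of _ _ "vec_nth k"]) auto
  qed
  moreover have "finite (vec_lambda ` (PiE (UNIV :: 'd set) (\<lambda>_. {-N..N})))"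
    by (rule finite_imageI, rule finite_PiE) simp_all
  ultimately show ?thesis by (rule finite_subset)
qed

lemma lball_eq_image: "lball j r = (\<lambda>m. j + m) ` lball 0 r"
proof (intro equalityI subsetI)
  fix k assume "k \<in> lball j r"
  then show "k \<in> (\<lambda>m. j + m) ` lball 0 r"
    by (intro image_eqI[of _ _ "k - j"]) (simp_all add: lball_def)
next
  fix k assume "k \<in> (\<lambda>m. j + m) ` lball 0 r"
  then show "k \<in> lball j r" by (auto simp: lball_def)
qed

lemma finite_lball [simp]: "finite (lball (j :: int ^ 'a) r)"
proof -
  have "(lball 0 r :: (int ^ 'a) set) = {k. lnorm k \<le> \<lfloor>r\<rfloor>}" by (auto simp: lball_def le_floor_iff)
  then have "finite (lball 0 r :: (int ^ 'a) set)" by (simp add: finite_lnorm_le)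
  then show ?thesis by (subst lball_eq_image) simp
qed

lemma lball_commute: "k \<in> lball j r \<longleftrightarrow> j \<in> lball k r"
  by (simp add: lball_def lnorm_diff_commute)

lemma sum_lball: "(\<Sum>k\<in>lball j r. f k) = (\<Sum>m\<in>lball 0 r. f (j + m))"
  unfolding lball_eq_image[of j] by (subst sum.reindex) auto

lemma sum_lball_minus:
  fixes f :: "int ^ 'd \<Rightarrow> 'b::comm_monoid_add"
  shows "(\<Sum>k\<in>lball j r. f k) = (\<Sum>m\<in>lball 0 r. f (j - m))"
proof -
  have "(\<Sum>m\<in>lball 0 r. f (j - m)) = (\<Sum>m\<in>uminus ` lball 0 r. f (j + m))"
    by (subst sum.reindex) auto
  moreover have "uminus ` lball 0 r = (lball 0 r :: (int ^ 'd) set)"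
  proof (intro equalityI subsetI)
    fix k :: "int ^ 'd" assume "k \<in> lball 0 r"
    then show "k \<in> uminus ` lball 0 r"
      by (intro image_eqI[of _ _ "- k"]) (simp_all add: lball_def)
  qed (auto simp: lball_def)
  ultimately show ?thesis by (simp add: sum_lball[of _ j])
qed

text \<open>One unit step towards the origin in a nonzero coordinate lowers \<open>lnorm\<close> by
  exactly one. The induction propagates bounds (for coercivity) and contacts (for the maximum
  principle) from site to neighbouring site.\<close>

lemma lattice_induct:
  assumes "P 0" and step: "\<And>i k. P i \<Longrightarrow> lnorm (k - i) = 1 \<Longrightarrow> P k"
  shows "P (i :: int ^ 'd)"
proof (induction "nat (lnorm i)" arbitrary: i rule: less_induct)
  case less
  show ?case
  proof (cases "i = 0")
    case False
    then obtain m where m: "i $ m \<noteq> 0" by (auto simp: vec_eq_iff)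
    define e where "e = (axis m (sgn (i $ m)) :: int ^ 'd)"
    have e: "lnorm e = 1" using m by (simp add: e_def lnorm_axis)
    have em: "e $ m = sgn (i $ m)" "\<And>n. n \<noteq> m \<Longrightarrow> e $ n = 0"
      by (auto simp: e_def axis_def)
    have "lnorm (i - e) = \<bar>i $ m - sgn (i $ m)\<bar> + (\<Sum>n\<in>UNIV - {m}. \<bar>i $ n\<bar>)"
      unfolding lnorm_def by (subst sum.remove[of _ m]) (auto simp: em intro!: sum.cong)
    moreover have "lnorm i = \<bar>i $ m\<bar> + (\<Sum>n\<in>UNIV - {m}. \<bar>i $ n\<bar>)"
      unfolding lnorm_def by (subst sum.remove[of _ m]) auto
    ultimately have "lnorm (i - e) = lnorm i - 1"
      using m by (auto simp: sgn_if split: if_splits)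
    moreover have "lnorm i > 0" using False lnorm_eq_0_iff[of i] lnorm_nonneg[of i] by linarith
    ultimately have "P (i - e)" using less by simp
    then show ?thesis using step[of "i - e" i] e by simp
  qed (simp add: assms)
qed

lemma lattice_connected:
  assumes "P j" and step: "\<And>i k. P i \<Longrightarrow> lnorm (k - i) = 1 \<Longrightarrow> P k"
  shows "P (i :: int ^ 'd)"
proof -
  have "P (j + m)" for m
  proof (rule lattice_induct[of "\<lambda>m. P (j + m)"])
    show "P (j + 0)" using assms by simp
    show "P (j + k)" if "P (j + i)" "lnorm (k - i) = 1" for i k
      using step[OF that(1), of "j + k"] that(2) by simp
  qed
  from this[of "i - j"] show ?thesis by simp
qed

lemma ipair_add: "ipair w (i + k) = ipair w i + ipair w k"
  by (simp add: ipair_def algebra_simps sum.distrib)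

lemma ipair_minus: "ipair w (- k) = - ipair w k"
  by (simp add: ipair_def sum_negf)

lemma ipair_zero [simp]: "ipair w 0 = 0"
  by (simp add: ipair_def)

lemma ipair_diff: "ipair w (i - k) = ipair w i - ipair w k"
  using ipair_add[of w i "- k"] by (simp add: ipair_minus)

definition nmult :: "nat \<Rightarrow> int ^ 'd \<Rightarrow> int ^ 'd" where
  "nmult n k = (\<chi> m. int n * k $ m)"

lemma nmult_simps [simp]: "nmult 0 k = 0" "nmult (Suc n) k = nmult n k + k"
  by (auto simp: nmult_def vec_eq_iff algebra_simps)

lemma ipair_nmult: "ipair w (nmult n k) = real n * ipair w k"
  by (induction n) (auto simp: ipair_add algebra_simps)

lemma ipair_le_lnorm: "\<bar>ipair w k\<bar> \<le> (\<Sum>m\<in>UNIV. \<bar>w $ m\<bar>) * real_of_int (lnorm k)"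
proof -
  have "\<bar>ipair w k\<bar> \<le> (\<Sum>m\<in>UNIV. \<bar>w $ m\<bar> * \<bar>real_of_int (k $ m)\<bar>)"
    unfolding ipair_def by (rule order_trans[OF sum_abs]) (simp add: abs_mult)
  also have "\<dots> \<le> (\<Sum>m\<in>UNIV. \<bar>w $ m\<bar> * real_of_int (lnorm k))"
  proof (intro sum_mono mult_left_mono)
    fix m
    have "\<bar>k $ m\<bar> \<le> lnorm k" unfolding lnorm_def by (rule member_le_sum) auto
    then show "\<bar>real_of_int (k $ m)\<bar> \<le> real_of_int (lnorm k)" by linarith
  qed auto
  finally show ?thesis by (simp add: sum_distrib_right)
qed

section \<open>Shifts and the order\<close>

lemma tau_apply: "tau k l x i = x (i + k) + real_of_int l"
  by (simp add: tau_def)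

lemma tau_tau [simp]: "tau k l (tau k' l' x) = tau (k + k') (l + l') x"
  by (simp add: tau_def algebra_simps)

lemma tau_zero [simp]: "tau 0 0 x = x"
  by (simp add: tau_def)

lemma conf_le_refl [simp]: "conf_le x x" by (simp add: conf_le_def)

lemma conf_le_trans: "conf_le x y \<Longrightarrow> conf_le y z \<Longrightarrow> conf_le x z"
  unfolding conf_le_def by (meson order_trans)

lemma conf_le_antisym: "conf_le x y \<Longrightarrow> conf_le y x \<Longrightarrow> x = y"
  unfolding conf_le_def by (auto intro!: ext antisym)

lemma tau_mono: "conf_le x y \<Longrightarrow> conf_le (tau k l x) (tau k l y)"
  by (simp add: conf_le_def tau_def)

lemma tau_le_iff: "conf_le (tau k l x) y \<longleftrightarrow> conf_le x (tau (- k) (- l) y)"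
  using tau_mono[of "tau k l x" y "- k" "- l"] tau_mono[of x "tau (- k) (- l) y" k l] by auto

lemma le_tau_iff: "conf_le y (tau k l x) \<longleftrightarrow> conf_le (tau (- k) (- l) y) x"
  using tau_mono[of y "tau k l x" "- k" "- l"] tau_mono[of "tau (- k) (- l) y" x k l] by auto

lemma tau_eq_iff: "tau k l x = y \<longleftrightarrow> x = tau (- k) (- l) y"
  by auto

section \<open>Partial derivatives\<close>

text \<open>\<open>pd\<close> and \<open>pdiff\<close> refer to increments at 0 only; moving the
  base point along the coordinate line turns them into an ordinary derivative at every point of that
  line, as the mean value theorem requires.\<close>

lemma pdiff_DERIV:
  assumes "pdiff i F"
  shows "((\<lambda>s. F (x(i := s))) has_real_derivative pd i F (x(i := t))) (at t)"
proof -
  have "(\<lambda>u. F ((x(i := t))(i := (x(i := t)) i + u))) differentiable (at 0)"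
    using assms unfolding pdiff_def by blast
  then have "((\<lambda>u. F (x(i := t + u))) has_real_derivative pd i F (x(i := t))) (at 0)"
    unfolding pd_def by (simp add: DERIV_deriv_iff_real_differentiable)
  then show ?thesis
    using DERIV_shift[of "\<lambda>s. F (x(i := s))" _ 0 t] by (simp add: add.commute)
qed

lemma pd_mvt:
  assumes "a < b" "pdiff i F"
  shows "\<exists>s. a < s \<and> s < b \<and> F (x(i := b)) - F (x(i := a)) = (b - a) * pd i F (x(i := s))"
  using MVT2[OF assms(1), of "\<lambda>s. F (x(i := s))" "\<lambda>s. pd i F (x(i := s))"]
    pdiff_DERIV[OF assms(2)] by blast

lemma pd_lipschitz:
  assumes "pdiff i F" "\<And>z. \<bar>pd i F z\<bar> \<le> C"
  shows "\<bar>F (x(i := b)) - F (x(i := a))\<bar> \<le> C * \<bar>b - a\<bar>"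
proof -
  have *: "\<bar>F (x(i := b)) - F (x(i := a))\<bar> \<le> C * \<bar>b - a\<bar>" if ab: "a < b" for a b
  proof -
    obtain s where "F (x(i := b)) - F (x(i := a)) = (b - a) * pd i F (x(i := s))"
      using pd_mvt[OF ab assms(1)] by blast
    then show ?thesis using assms(2)[of "x(i := s)"] ab by (simp add: abs_mult)
  qed
  show ?thesis
    using *[of a b] *[of b a] by (cases a b rule: linorder_cases) (auto simp: abs_minus_commute)
qed

lemma pd_nonpos_antimono:
  assumes "pdiff i F" "\<And>z. pd i F z \<le> 0" "a \<le> b"
  shows "F (x(i := b)) \<le> F (x(i := a))"
proof (cases "a < b")
  case True
  then obtain s where s: "F (x(i := b)) - F (x(i := a)) = (b - a) * pd i F (x(i := s))"
    using pd_mvt[OF True assms(1)] by blast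
  have "(b - a) * pd i F (x(i := s)) \<le> 0"
    using True assms(2) by (intro mult_nonneg_nonpos) auto
  then show ?thesis using s by simp
qed (use assms in auto)

text \<open>Hybrids between x and y that change one coordinate at a time. Induction on the set of
  replaced coordinates reduces estimates in several variables to the one-variable mean value
  theorem.\<close>

definition splice_conf :: "'i set \<Rightarrow> ('i \<Rightarrow> real) \<Rightarrow> ('i \<Rightarrow> real) \<Rightarrow> 'i \<Rightarrow> real" where
  "splice_conf A x y = (\<lambda>i. if i \<in> A then y i else x i)"

lemma splice_conf_empty [simp]: "splice_conf {} x y = x"
  by (simp add: splice_conf_def)

lemma splice_conf_insert: "splice_conf (insert i A) x y = (splice_conf A x y)(i := y i)"
  by (auto simp: splice_conf_def)

lemma splice_conf_upd: "i \<notin> A \<Longrightarrow> (splice_conf A x y)(i := x i) = splice_conf A x y"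
  by (auto simp: splice_conf_def)

lemma splice_lipschitz:
  assumes "finite A" "\<And>i. i \<in> A \<Longrightarrow> pdiff i F" "\<And>i z. i \<in> A \<Longrightarrow> \<bar>pd i F z\<bar> \<le> C"
  shows "\<bar>F (splice_conf A x y) - F x\<bar> \<le> C * (\<Sum>i\<in>A. \<bar>y i - x i\<bar>)"
  using assms
proof (induction A rule: finite_induct)
  case (insert i A)
  have "\<bar>F ((splice_conf A x y)(i := y i)) - F ((splice_conf A x y)(i := x i))\<bar> \<le> C * \<bar>y i - x i\<bar>"
    by (rule pd_lipschitz) (use insert in auto)
  moreover have "\<bar>F (splice_conf A x y) - F x\<bar> \<le> C * (\<Sum>i\<in>A. \<bar>y i - x i\<bar>)"
    using insert by auto
  ultimately show ?case
    using insert(1,2) unfolding splice_conf_insert splice_conf_upd[OF insert(2)]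
    by (simp add: algebra_simps del: fun_upd_apply)
qed simp

text \<open>The alternative of equal coordinates covers the direction of differentiation itself,
  where (D) gives no sign.\<close>

lemma splice_antimono:
  assumes "finite A" "\<And>i. i \<in> A \<Longrightarrow> pdiff i F \<or> x i = y i"
    "\<And>i z. i \<in> A \<Longrightarrow> pd i F z \<le> 0 \<or> x i = y i"
    "\<And>i. i \<in> A \<Longrightarrow> x i \<le> y i"
  shows "F (splice_conf A x y) \<le> F x"
  using assms
proof (induction A rule: finite_induct)
  case (insert i A)
  have IH: "F (splice_conf A x y) \<le> F x" using insert by auto
  show ?case
  proof (cases "x i = y i")
    case True
    then have "splice_conf (insert i A) x y = splice_conf A x y"
      using insert(2) by (auto simp: splice_conf_def fun_eq_iff)
    then show ?thesis using IH by simp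
  next
    case False
    have "F ((splice_conf A x y)(i := y i)) \<le> F ((splice_conf A x y)(i := x i))"
      by (rule pd_nonpos_antimono) (use insert.prems False in blast)+
    then show ?thesis using IH unfolding splice_conf_insert splice_conf_upd[OF insert(2)]
      by (simp del: fun_upd_apply)
  qed
qed simp

section \<open>Local potentials\<close>

lemma pd_mvt_abs:
  assumes "pdiff i F"
  shows "\<exists>s. \<bar>s - a\<bar> \<le> \<bar>b - a\<bar> \<and> F (x(i := b)) - F (x(i := a)) = (b - a) * pd i F (x(i := s))"
proof (cases a b rule: linorder_cases)
  case less
  then obtain s where "a < s" "s < b" "F (x(i := b)) - F (x(i := a)) = (b - a) * pd i F (x(i := s))"
    using pd_mvt[OF _ assms] by blast
  then show ?thesis by (intro exI[of _ s]) auto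
next
  case greater
  then obtain s where "b < s" "s < a" "F (x(i := a)) - F (x(i := b)) = (a - b) * pd i F (x(i := s))"
    using pd_mvt[OF _ assms] by blast
  then show ?thesis by (intro exI[of _ s]) (auto simp: algebra_simps)
qed auto

abbreviation nl :: "int ^ 'd \<Rightarrow> nat" where "nl k \<equiv> nat (lnorm k)"

lemma nl_triangle: "nl (i + k) \<le> nl i + nl k"
  using lnorm_triangle[of i k] by (simp add: nat_add_distrib[symmetric] nat_mono)

locale lattice_potential =
  fixes S :: "'d::finite pot" and r C :: real
  assumes condA: "condA S r" and condB: "condB S" and condC: "condC S" and condD: "condD S"
    and bound: "\<And>i k j x. \<bar>pd i (pd k (S j)) x\<bar> \<le> C"
begin

lemma r_pos: "r > 0" using condA by (simp add: condA_def)

lemma S_local: "(\<And>k. k \<in> lball j r \<Longrightarrow> x k = y k) \<Longrightarrow> S j x = S j y"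
  using condA unfolding condA_def by blast

lemma continuous_S: "continuous_on UNIV (S j)"
  and pdiff1: "pdiff i (S j)"
  and pdiff2: "pdiff k (pd i (S j))"
  using condA unfolding condA_def by blast+

lemma C_nonneg: "0 \<le> C"
  using bound[of undefined undefined undefined undefined] by linarith

lemma pd_local:
  assumes "\<And>k. k \<in> lball j r \<Longrightarrow> x k = y k"
  shows "pd i (S j) x = pd i (S j) y"
proof -
  have "(\<lambda>t. S j (x(i := x i + t))) = (\<lambda>t. S j (y(i := y i + t)))"
    by (rule ext, rule S_local) (use assms in auto)
  then show ?thesis by (simp add: pd_def)
qed

lemma pd_outside: "i \<notin> lball j r \<Longrightarrow> pd i (S j) x = 0"
proof -
  assume "i \<notin> lball j r"
  then have "(\<lambda>t. S j (x(i := x i + t))) = (\<lambda>t. S j x)"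
    by (intro ext, intro S_local) auto
  then show ?thesis by (simp add: pd_def)
qed

lemma S_tau: "S j (tau k l x) = S (j + k) x"
  using condB by (simp add: condB_def)

lemma pd_tau: "pd i (S j) (tau k l x) = pd (i + k) (S (j + k)) x"
proof -
  have "(tau k l x)(i := tau k l x i + t) = tau k l (x(i + k := x (i + k) + t))" for t
    by (rule ext) (auto simp: tau_def)
  then show ?thesis by (simp add: pd_def S_tau)
qed

lemma gradW_tau: "gradW S r (tau k l x) i = gradW S r x (i + k)"
proof -
  have "(\<Sum>j\<in>lball i r. pd (i + k) (S (j + k)) x) = (\<Sum>j\<in>lball (i + k) r. pd (i + k) (S j) x)"
    by (subst (1 2) sum_lball) (simp add: algebra_simps)
  then show ?thesis by (simp add: gradW_def pd_tau)
qed

section \<open>Order and Lipschitz properties of the gradient\<close>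

definition N :: real where "N = real (card (lball (0 :: int ^ 'd) r))"

lemma card_lball: "real (card (lball (j :: int ^ 'd) r)) = N"
  using lball_eq_image[of j r] by (simp add: N_def card_image)

lemma N_nonneg: "0 \<le> N" by (simp add: N_def)

lemma pd_lip: "\<bar>pd k (S j) y - pd k (S j) x\<bar> \<le> C * (\<Sum>i\<in>lball j r. \<bar>y i - x i\<bar>)"
proof -
  have "pd k (S j) y = pd k (S j) (splice_conf (lball j r) x y)"
    by (rule pd_local) (simp add: splice_conf_def)
  then show ?thesis
    using splice_lipschitz[of "lball j r" "pd k (S j)" C x y] pdiff2 bound by simp
qed

lemma gradW_lip:
  "\<bar>gradW S r y i - gradW S r x i\<bar> \<le> C * (\<Sum>j\<in>lball i r. \<Sum>k\<in>lball j r. \<bar>y k - x k\<bar>)"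
proof -
  have "\<bar>gradW S r y i - gradW S r x i\<bar> \<le> (\<Sum>j\<in>lball i r. \<bar>pd i (S j) y - pd i (S j) x\<bar>)"
    unfolding gradW_def sum_subtractf[symmetric] by (rule sum_abs)
  also have "\<dots> \<le> (\<Sum>j\<in>lball i r. C * (\<Sum>k\<in>lball j r. \<bar>y k - x k\<bar>))"
    by (intro sum_mono pd_lip)
  finally show ?thesis by (simp add: sum_distrib_left)
qed

text \<open>Only mixed second derivatives have a sign in (D), hence the hypothesis that x and y
  agree at k: the hybrids then move only in directions other than k.\<close>

lemma pd_antimono:
  assumes "conf_le x y" "x k = y k"
  shows "pd k (S j) y \<le> pd k (S j) x"
proof -
  have "pd k (S j) y = pd k (S j) (splice_conf (lball j r) x y)"
    by (rule pd_local) (simp add: splice_conf_def)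
  also have "\<dots> \<le> pd k (S j) x"
  proof (rule splice_antimono)
    fix i :: "int ^ 'd" and z
    show "pd i (pd k (S j)) z \<le> 0 \<or> x i = y i"
      using condD assms unfolding condD_def by (cases "i = k") auto
  qed (use assms pdiff2 in \<open>auto simp: conf_le_def\<close>)
  finally show ?thesis .
qed

lemma pd_strict_antimono:
  assumes "conf_le x y" "x k = y k" "x i < y i" "lnorm (i - k) = 1"
  shows "pd k (S i) y < pd k (S i) x"
proof -
  obtain s where "pd k (S i) (x(i := y i)) - pd k (S i) (x(i := x i)) =
      (y i - x i) * pd i (pd k (S i)) (x(i := s))"
    using pd_mvt[OF assms(3) pdiff2] by blast
  moreover have "pd i (pd k (S i)) (x(i := s)) < 0"
    using condD assms(4) unfolding condD_def by blast
  ultimately have "pd k (S i) (x(i := y i)) < pd k (S i) x"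
    using assms(3) by (smt (verit) fun_upd_triv mult_pos_neg)
  moreover have "pd k (S i) y \<le> pd k (S i) (x(i := y i))"
    by (rule pd_antimono) (use assms in \<open>auto simp: conf_le_def\<close>)
  ultimately show ?thesis by simp
qed

text \<open>(A) alone does not force r to reach the neighbours; the strict inequality of (D) does,
  since a potential that does not see a neighbour has a vanishing mixed derivative there.\<close>

lemma neighbour_in_lball:
  assumes "lnorm (i - k) = 1" shows "(i :: int ^ 'd) \<in> lball k r"
proof (rule ccontr)
  assume "i \<notin> lball k r"
  then have "pd k (S i) = (\<lambda>x. 0)" by (intro ext pd_outside) (simp add: lball_commute)
  then have "pd i (pd k (S i)) (\<lambda>_. 0) = 0" by (simp add: pd_def)
  then show False using condD assms unfolding condD_def by (metis less_irrefl)
qed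

text \<open>Raising the other coordinates can only lower each summand of the gradient at k, and by
  the strict half of (D) it strictly lowers the summand of \<open>S i\<close> if x i < y i. Equal
  gradients exclude this.\<close>

lemma touching_step:
  assumes le: "conf_le x y" and k: "x k = y k" and g: "gradW S r x k = gradW S r y k"
    and i: "lnorm (i - k) = 1"
  shows "x i = y i"
proof (rule ccontr)
  assume "x i \<noteq> y i"
  then have "x i < y i" using le by (metis conf_le_def less_eq_real_def)
  then have "pd k (S i) y < pd k (S i) x" using pd_strict_antimono le k i by blast
  then have "gradW S r y k < gradW S r x k"
    unfolding gradW_def
    by (intro sum_strict_mono_ex1) (use pd_antimono[OF le k] neighbour_in_lball[OF i] in auto)
  then show False using g by simp
qed

text \<open>Strong maximum principle: by the strict inequality in (D), contact spreads to neighbours.\<close>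

lemma touching:
  assumes le: "conf_le x y" and g: "\<And>k. x k = y k \<Longrightarrow> gradW S r x k = gradW S r y k"
    and k: "x k = y k"
  shows "x = y"
proof
  fix i show "x i = y i"
    by (rule lattice_connected[of "\<lambda>i. x i = y i" k])
      (use k g touching_step[OF le] in blast)+
qed

text \<open>Raising the other coordinates lowers the gradient at i, so only the change of coordinate
  i itself counts, at most C for each of the N potentials. This is the one-sided bound behind the
  comparison of solutions.\<close>

lemma gradW_upper:
  assumes le: "conf_le x y"
  shows "gradW S r y i - gradW S r x i \<le> C * N * (y i - x i)"
proof -
  have "pd i (S j) y - pd i (S j) x \<le> C * (y i - x i)" for j
  proof -
    have "pd i (S j) y \<le> pd i (S j) (x(i := y i))"
      by (rule pd_antimono) (use le in \<open>auto simp: conf_le_def\<close>)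
    moreover have "\<bar>pd i (S j) (x(i := y i)) - pd i (S j) (x(i := x i))\<bar> \<le> C * \<bar>y i - x i\<bar>"
      by (rule pd_lipschitz) (use pdiff2 bound in auto)
    ultimately show ?thesis using le by (simp add: conf_le_def)
  qed
  then have "(\<Sum>j\<in>lball i r. pd i (S j) y - pd i (S j) x) \<le> (\<Sum>j\<in>lball i r. C * (y i - x i))"
    by (intro sum_mono)
  then show ?thesis by (simp add: gradW_def sum_subtractf card_lball algebra_simps)
qed

text \<open>Proved one coordinate at a time: if the replaced coordinates contribute a and the new
  one d, the error grows by at most C d (a + d), and C a^2 + C d (a + d) is at most C (a +
  d)^2.\<close>

lemma taylor:
  "\<bar>S j y - S j x - (\<Sum>k\<in>lball j r. pd k (S j) x * (y k - x k))\<bar>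
    \<le> C * (\<Sum>k\<in>lball j r. \<bar>y k - x k\<bar>)\<^sup>2"
proof -
  have "\<bar>S j (splice_conf A x y) - S j x - (\<Sum>k\<in>A. pd k (S j) x * (y k - x k))\<bar>
      \<le> C * (\<Sum>k\<in>A. \<bar>y k - x k\<bar>)\<^sup>2"
    if "finite A" "A \<subseteq> lball j r" for A
    using that
  proof (induction A rule: finite_induct)
    case (insert i A)
    define z where "z = splice_conf A x y"
    define a d where "a = (\<Sum>k\<in>A. \<bar>y k - x k\<bar>)" and "d = \<bar>y i - x i\<bar>"
    have zi: "z(i := x i) = z" unfolding z_def by (rule splice_conf_upd[OF insert(2)])
    obtain s where s: "\<bar>s - x i\<bar> \<le> d"
      "S j (z(i := y i)) - S j (z(i := x i)) = (y i - x i) * pd i (S j) (z(i := s))"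
      using pd_mvt_abs[OF pdiff1] unfolding d_def by blast
    have "(\<Sum>k\<in>lball j r. \<bar>(z(i := s)) k - x k\<bar>) = (\<Sum>k\<in>insert i A. \<bar>(z(i := s)) k - x k\<bar>)"
      by (rule sum.mono_neutral_right) (use insert in \<open>auto simp: z_def splice_conf_def\<close>)
    also have "\<dots> \<le> (\<Sum>k\<in>insert i A. \<bar>y k - x k\<bar>)"
      by (rule sum_mono) (use s(1) in \<open>auto simp: z_def splice_conf_def d_def\<close>)
    also have "\<dots> = a + d" using insert by (simp add: a_def d_def)
    finally have "C * (\<Sum>k\<in>lball j r. \<bar>(z(i := s)) k - x k\<bar>) \<le> C * (a + d)"
      using C_nonneg by (rule mult_left_mono)
    then have "\<bar>pd i (S j) (z(i := s)) - pd i (S j) x\<bar> \<le> C * (a + d)"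
      using pd_lip[of i j "z(i := s)" x] by linarith
    then have "d * \<bar>pd i (S j) (z(i := s)) - pd i (S j) x\<bar> \<le> d * (C * (a + d))"
      by (intro mult_left_mono) (auto simp: d_def)
    then have 1: "\<bar>(y i - x i) * (pd i (S j) (z(i := s)) - pd i (S j) x)\<bar> \<le> d * (C * (a + d))"
      by (simp add: abs_mult d_def)
    have 2: "\<bar>S j z - S j x - (\<Sum>k\<in>A. pd k (S j) x * (y k - x k))\<bar> \<le> C * a\<^sup>2"
      using insert by (simp add: z_def a_def)
    have "S j (z(i := y i)) - S j x - (\<Sum>k\<in>insert i A. pd k (S j) x * (y k - x k)) =
      (y i - x i) * (pd i (S j) (z(i := s)) - pd i (S j) x) +
      (S j z - S j x - (\<Sum>k\<in>A. pd k (S j) x * (y k - x k)))"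
      using s(2) insert(1,2) unfolding zi by (simp add: algebra_simps del: fun_upd_apply)
    then have "\<bar>S j (z(i := y i)) - S j x - (\<Sum>k\<in>insert i A. pd k (S j) x * (y k - x k))\<bar>
        \<le> d * (C * (a + d)) + C * a\<^sup>2"
      using 1 2 by linarith
    also have "\<dots> \<le> C * (a + d)\<^sup>2"
    proof -
      have "0 \<le> C * (a * d)" using C_nonneg by (simp add: a_def d_def sum_nonneg)
      then show ?thesis by (simp add: power2_eq_square algebra_simps)
    qed
    also have "a + d = (\<Sum>k\<in>insert i A. \<bar>y k - x k\<bar>)" using insert by (simp add: a_def d_def)
    finally show ?case unfolding splice_conf_insert z_def .
  qed simp
  from this[of "lball j r"] have
    "\<bar>S j (splice_conf (lball j r) x y) - S j x - (\<Sum>k\<in>lball j r. pd k (S j) x * (y k - x k))\<bar>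
      \<le> C * (\<Sum>k\<in>lball j r. \<bar>y k - x k\<bar>)\<^sup>2" by simp
  moreover have "S j y = S j (splice_conf (lball j r) x y)"
    by (rule S_local) (simp add: splice_conf_def)
  ultimately show ?thesis by simp
qed

text \<open>The increments from x to the maximum and from the minimum to y are compared coordinate
  by coordinate. Both paths make the same move at k, upwards or not at all, but the first one starts
  from the higher configuration, where \<open>pd_antimono\<close> makes the gain smaller.\<close>

lemma submodular:
  "S j (\<lambda>i. min (x i) (y i)) + S j (\<lambda>i. max (x i) (y i)) \<le> S j x + S j y"
proof -
  define m M where "m = (\<lambda>i. min (x i) (y i))" and "M = (\<lambda>i. max (x i) (y i))"
  have "S j (splice_conf A x M) - S j x \<le> S j (splice_conf A m y) - S j m" if "finite A" for A
    using that
  proof (induction A rule: finite_induct)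
    case (insert k A)
    define X Y where "X = splice_conf A x M" and "Y = splice_conf A m y"
    have XY: "conf_le Y X"
      by (auto simp: X_def Y_def conf_le_def splice_conf_def m_def M_def)
    have X: "X(k := x k) = X" and Y: "Y(k := m k) = Y"
      unfolding X_def Y_def by (rule splice_conf_upd[OF insert(2)])+
    have IH: "S j X - S j x \<le> S j Y - S j m" using insert by (simp add: X_def Y_def)
    have "S j (X(k := M k)) - S j X \<le> S j (Y(k := y k)) - S j Y"
    proof (cases "y k \<le> x k")
      case True
      then have "M k = x k" "y k = m k" by (auto simp: M_def m_def)
      then show ?thesis using X Y by (simp del: fun_upd_apply)
    next
      case False
      then have k: "M k = y k" "m k = x k" by (auto simp: M_def m_def)
      have "S j (X(k := y k)) - S j (Y(k := y k)) \<le> S j (X(k := x k)) - S j (Y(k := x k))"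
      proof (rule DERIV_nonpos_imp_nonincreasing[of "x k" "y k" "\<lambda>s. S j (X(k := s)) - S j (Y(k := s))"])
        fix s
        have "((\<lambda>s. S j (X(k := s)) - S j (Y(k := s))) has_real_derivative
            (pd k (S j) (X(k := s)) - pd k (S j) (Y(k := s)))) (at s)"
          by (intro derivative_intros pdiff_DERIV pdiff1)
        moreover have "pd k (S j) (X(k := s)) \<le> pd k (S j) (Y(k := s))"
          by (rule pd_antimono) (use XY in \<open>auto simp: conf_le_def\<close>)
        ultimately show "\<exists>D. ((\<lambda>s. S j (X(k := s)) - S j (Y(k := s))) has_real_derivative D) (at s) \<and> D \<le> 0"
          by (intro exI conjI) auto
      qed (use False in simp)
      then show ?thesis using X Y k by (simp del: fun_upd_apply)
    qed
    then show ?case using IH unfolding splice_conf_insert X_def Y_def by linarith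
  qed simp
  from this[of "lball j r"] have
    "S j (splice_conf (lball j r) x M) - S j x \<le> S j (splice_conf (lball j r) m y) - S j m" by simp
  moreover have "S j M = S j (splice_conf (lball j r) x M)" "S j y = S j (splice_conf (lball j r) m y)"
    by (rule S_local; simp add: splice_conf_def)+
  ultimately show ?thesis by (simp add: m_def M_def)
qed

definition rad :: nat where "rad = nat \<lceil>r\<rceil>"

lemma nl_lball: "k \<in> lball j r \<Longrightarrow> nl k \<le> nl j + rad"
proof -
  assume "k \<in> lball j r"
  then have "lnorm (k - j) \<le> \<lceil>r\<rceil>" by (simp add: lball_def) linarith
  then have "nl (k - j) \<le> rad" by (simp add: rad_def nat_mono)
  then show ?thesis using nl_triangle[of j "k - j"] by simp
qed

definition Lw :: real where "Lw = C * N\<^sup>2 * 4 ^ rad"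

lemma Lw_nonneg: "0 \<le> Lw" using C_nonneg by (simp add: Lw_def)

text \<open>The gradient at i sees only sites k with \<open>nl k\<close> at most \<open>nl i\<close>
  + 2 \<open>rad\<close>, where the weight exceeds that at i by a factor of at most
  4^\<open>rad\<close>. Hence one constant serves all \<rho> in [1, 2].\<close>

lemma gradW_weighted_lip:
  assumes \<rho>: "1 \<le> \<rho>" "\<rho> \<le> 2" and B: "\<And>k. \<bar>y k - x k\<bar> \<le> B * \<rho> ^ nl k"
  shows "\<bar>gradW S r y i - gradW S r x i\<bar> \<le> Lw * B * \<rho> ^ nl i"
proof -
  have B0: "0 \<le> B" using B[of 0] by (simp add: order_trans[OF abs_ge_zero])
  have "\<bar>y k - x k\<bar> \<le> B * (\<rho> ^ nl i * 4 ^ rad)" if "j \<in> lball i r" "k \<in> lball j r" for j k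
  proof -
    have "nl k \<le> nl i + 2 * rad" using nl_lball[OF that(1)] nl_lball[OF that(2)] by simp
    then have "\<rho> ^ nl k \<le> \<rho> ^ nl i * \<rho> ^ (2 * rad)"
      using \<rho> by (subst power_add[symmetric]) (rule power_increasing)
    also have "\<dots> \<le> \<rho> ^ nl i * 2 ^ (2 * rad)"
      using \<rho> by (intro mult_left_mono power_mono) auto
    finally show ?thesis
      using B[of k] mult_left_mono[OF _ B0] by (fastforce simp: power_mult)
  qed
  then have "(\<Sum>j\<in>lball i r. \<Sum>k\<in>lball j r. \<bar>y k - x k\<bar>) \<le>
      (\<Sum>j\<in>lball i r. \<Sum>k\<in>lball j r. B * (\<rho> ^ nl i * 4 ^ rad))"
    by (intro sum_mono)
  also have "\<dots> = N\<^sup>2 * 4 ^ rad * B * \<rho> ^ nl i"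
    by (simp add: card_lball power2_eq_square)
  finally show ?thesis
    using order_trans[OF gradW_lip[of y i x] mult_left_mono[OF _ C_nonneg]]
    by (fastforce simp: Lw_def mult.assoc)
qed

end

section \<open>The topology of pointwise convergence\<close>

lemma tendsto_conf_iff:
  fixes f :: "'a \<Rightarrow> 'b \<Rightarrow> 'c::topological_space"
  shows "(f \<longlongrightarrow> l) F \<longleftrightarrow> (\<forall>i. ((\<lambda>n. f n i) \<longlongrightarrow> l i) F)"
proof -
  have "(f \<longlongrightarrow> l) F \<longleftrightarrow> limitin (product_topology (\<lambda>i. euclidean) UNIV) f l F"
    by (simp add: euclidean_product_topology)
  also have "\<dots> \<longleftrightarrow> (\<forall>i. ((\<lambda>n. f n i) \<longlongrightarrow> l i) F)"
    unfolding limitin_componentwise by simp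
  finally show ?thesis .
qed

lemma compact_conf_box: "compact {x :: 'b \<Rightarrow> real. \<forall>i. a i \<le> x i \<and> x i \<le> b i}"
proof -
  have "compactin (product_topology (\<lambda>i. euclidean) UNIV) (PiE UNIV (\<lambda>i. {a i..b i}))"
    by (simp add: compactin_PiE)
  moreover have "PiE UNIV (\<lambda>i. {a i..b i}) = {x. \<forall>i. a i \<le> x i \<and> x i \<le> b i}"
    by (auto simp: PiE_def Pi_def)
  ultimately show ?thesis by (simp add: euclidean_product_topology)
qed

lemma bounded_conf_subseq:
  fixes f :: "nat \<Rightarrow> ('d::finite) conf"
  assumes "\<And>n i. a i \<le> f n i" "\<And>n i. f n i \<le> b i"
  obtains l \<sigma> where "strict_mono (\<sigma> :: nat \<Rightarrow> nat)" "(f \<circ> \<sigma>) \<longlonglongrightarrow> l"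
proof -
  have "seq_compact {x :: 'd conf. \<forall>i. a i \<le> x i \<and> x i \<le> b i}"
    using compact_conf_box compact_eq_seq_compact_metric by blast
  moreover have "\<forall>n. f n \<in> {x. \<forall>i. a i \<le> x i \<and> x i \<le> b i}" using assms by simp
  ultimately obtain l \<sigma> where "strict_mono (\<sigma> :: nat \<Rightarrow> nat)" "(f \<circ> \<sigma>) \<longlonglongrightarrow> l"
    by (rule seq_compactE)
  then show thesis by (rule that)
qed

text \<open>In a chain, members that are nearly maximal at finitely many sites can be replaced by
  the largest of them, so one member approximates the supremum at all these sites. Exhausting the
  lattice by an enumeration gives the sequence, and closed conditions pass to the supremum.\<close>

lemma chain_sup_seq:
  fixes A :: "('d::finite) conf set"
  assumes ne: "A \<noteq> {}" and chain: "\<And>a b. a \<in> A \<Longrightarrow> b \<in> A \<Longrightarrow> conf_le a b \<or> conf_le b a"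
    and bdd: "\<And>i. bdd_above ((\<lambda>a. a i) ` A)"
  obtains f where "\<And>n. f n \<in> A" "f \<longlonglongrightarrow> (\<lambda>i. SUP a\<in>A. a i)"
proof -
  define s where "s = (\<lambda>i. SUP a\<in>A. a i)"
  have up: "a i \<le> s i" if "a \<in> A" for a i
    unfolding s_def by (rule cSUP_upper[OF that bdd])
  have ex: "\<exists>a\<in>A. \<forall>i\<in>F. s i - e < a i" if "finite F" "e > 0" for F e
    using that
  proof (induction F rule: finite_induct)
    case (insert i F)
    then obtain a where a: "a \<in> A" "\<forall>i\<in>F. s i - e < a i" by blast
    have "\<exists>b\<in>A. s i - e < b i"
      using less_cSUP_iff[OF ne bdd, of "s i - e" i] insert.prems by (simp add: s_def)
    then obtain b where b: "b \<in> A" "s i - e < b i" by blast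
    show ?case
    proof (cases "conf_le a b")
      case True
      then show ?thesis using a b by (intro bexI[of _ b]) (auto simp: conf_le_def intro: less_le_trans)
    next
      case False
      then have "conf_le b a" using chain a b by blast
      then show ?thesis using a b by (intro bexI[of _ a]) (auto simp: conf_le_def intro: less_le_trans)
    qed
  qed (use ne in auto)
  have "\<exists>a\<in>A. \<forall>i\<in>from_nat ` {..<n}. s i - 1 / real (Suc n) < a i" for n
    by (rule ex) auto
  then obtain f where f: "\<And>n. f n \<in> A" "\<And>n i. i \<in> from_nat ` {..<n} \<Longrightarrow> s i - 1 / real (Suc n) < f n i"
    by metis
  have "f \<longlonglongrightarrow> s"
  proof (subst tendsto_conf_iff, intro allI)
    fix i :: "int ^ 'd"
    show "(\<lambda>n. f n i) \<longlonglongrightarrow> s i"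
    proof (rule tendsto_sandwich[of "\<lambda>n. s i - 1 / real (Suc n)" _ _ "\<lambda>n. s i"])
      show "\<forall>\<^sub>F n in sequentially. s i - 1 / real (Suc n) \<le> f n i"
        using eventually_gt_at_top[of "to_nat i"]
      proof eventually_elim
        case (elim n)
        then have "i \<in> from_nat ` {..<n}" by (intro image_eqI[of _ _ "to_nat i"]) auto
        then show ?case using f(2) by (simp add: less_imp_le)
      qed
      have "(\<lambda>n. s i - 1 / real (Suc n)) \<longlonglongrightarrow> s i - 0"
        by (intro tendsto_intros LIMSEQ_Suc[OF lim_1_over_n])
      then show "(\<lambda>n. s i - 1 / real (Suc n)) \<longlonglongrightarrow> s i" by simp
    qed (use up f in auto)
  qed
  then show thesis using that[of f] f(1) unfolding s_def by blast
qed

lemma closed_conf_le: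
  fixes f g :: "'a::topological_space \<Rightarrow> ('d::finite) conf"
  assumes "continuous_on UNIV f" "continuous_on UNIV g"
  shows "closed {x. conf_le (f x) (g x)}"
  unfolding conf_le_def
  by (intro closed_Collect_all closed_Collect_le)
    (use assms in \<open>simp_all add: continuous_on_product_then_coordinatewise\<close>)

lemma continuous_on_tau: "continuous_on A (tau k l)"
  unfolding tau_def
  by (intro continuous_on_coordinatewise_then_product continuous_intros
      continuous_on_subset[OF continuous_on_product_coordinates]) auto

lemma closed_birkhoff: "closed {x :: 'd::finite conf. birkhoff x}"
proof -
  have "closed ({x :: 'd conf. conf_le x (tau k l x)} \<union> {x. conf_le (tau k l x) x})" for k l
    by (intro closed_Un closed_conf_le continuous_on_tau continuous_on_id)
  then show ?thesis
    unfolding birkhoff_def by (intro closed_Collect_all) (simp add: Collect_disj_eq)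
qed

lemma birkhoff_tau: assumes "birkhoff x" shows "birkhoff (tau a b x)"
proof -
  have *: "tau k l (tau a b x) = tau a b (tau k l x)" for k l
    by (simp add: add.commute)
  show ?thesis using assms tau_mono unfolding birkhoff_def * by metis
qed

section \<open>Periodic minimizers\<close>

definition cell :: "nat \<Rightarrow> (int ^ 'd) set" where
  "cell n = {j. \<forall>m. 0 \<le> j $ m \<and> j $ m < int n}"

definition rmod :: "nat \<Rightarrow> int ^ 'd \<Rightarrow> int ^ 'd" where
  "rmod n j = (\<chi> m. j $ m mod int n)"

lemma rmod_eq: "rmod n j = j - nmult n (\<chi> m. j $ m div int n)"
  by (simp add: rmod_def nmult_def vec_eq_iff minus_mult_div_eq_mod[symmetric])

lemma rmod_in_cell: "n > 0 \<Longrightarrow> rmod n j \<in> cell n"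
  by (simp add: rmod_def cell_def)

lemma rmod_eqD: assumes "rmod n a = rmod n b" obtains k where "a = b + nmult n k"
proof -
  define k where "k = (\<chi> m. a $ m div int n - b $ m div int n)"
  have "a - nmult n (\<chi> m. a $ m div int n) = b - nmult n (\<chi> m. b $ m div int n)"
    using assms by (simp only: rmod_eq)
  then have "a = b + nmult n k"
    by (simp add: vec_eq_iff nmult_def k_def algebra_simps)
  then show thesis by (rule that)
qed

lemma rmod_add: "rmod n (a + nmult n k) = rmod n a"
  by (simp add: rmod_def nmult_def vec_eq_iff)

lemma finite_cell: "finite (cell n :: (int ^ 'd) set)"
proof (rule finite_subset[OF _ finite_lnorm_le[of "int CARD('d) * int n"]], rule subsetI)
  fix j :: "int ^ 'd" assume "j \<in> cell n"
  then have "lnorm j \<le> (\<Sum>m\<in>(UNIV :: 'd set). int n)"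
    unfolding lnorm_def by (intro sum_mono) (simp add: cell_def less_imp_le)
  then show "j \<in> {k. lnorm k \<le> int CARD('d) * int n}" by simp
qed

lemma lnorm_nmult: "lnorm (nmult n k) = int n * lnorm k"
  by (simp add: lnorm_def nmult_def abs_mult sum_distrib_left)

text \<open>Translation followed by reduction mod n permutes the cell.\<close>

lemma sum_cell_shift:
  fixes f :: "int ^ 'd \<Rightarrow> real"
  assumes n: "n > 0" and per: "\<And>j k. f (j + nmult n k) = f j"
  shows "(\<Sum>j\<in>cell n. f (j + a)) = (\<Sum>j\<in>cell n. f j)"
proof -
  have per': "f (rmod n j) = f j" for j
    using per[of "rmod n j" "\<chi> m. j $ m div int n"] by (simp add: rmod_eq)
  have "inj_on (\<lambda>j. rmod n (j + a)) (cell n)"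
  proof (rule inj_onI)
    fix i j :: "int ^ 'd" assume ij: "i \<in> cell n" "j \<in> cell n" and eq: "rmod n (i + a) = rmod n (j + a)"
    show "i = j"
    proof (subst vec_eq_iff, rule allI)
      fix m
      have "(i $ m + a $ m) mod int n = (j $ m + a $ m) mod int n"
        using eq by (simp add: rmod_def vec_eq_iff)
      then have "(i $ m + a $ m - a $ m) mod int n = (j $ m + a $ m - a $ m) mod int n"
        by (rule mod_diff_cong) simp
      then show "i $ m = j $ m" using ij by (simp add: cell_def)
    qed
  qed
  moreover have "(\<lambda>j. rmod n (j + a)) ` cell n \<subseteq> cell n" using rmod_in_cell[OF n] by auto
  ultimately have img: "(\<lambda>j. rmod n (j + a)) ` cell n = cell n" 
    using endo_inj_surj[OF finite_cell] by blast
  have "(\<Sum>j\<in>cell n. f j) = (\<Sum>j\<in>(\<lambda>j. rmod n (j + a)) ` cell n. f j)" by (simp add: img)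
  also have "\<dots> = (\<Sum>j\<in>cell n. f (rmod n (j + a)))"
    by (subst sum.reindex) (use \<open>inj_on _ _\<close> in auto)
  finally show ?thesis by (simp add: per')
qed

definition pint :: "int ^ 'd \<Rightarrow> int ^ 'd \<Rightarrow> int" where
  "pint p k = (\<Sum>m\<in>UNIV. p $ m * k $ m)"

text \<open>Periodicity up to vertical shifts, that is, rotation vector p / n; \<open>pint\<close>
  is the exact integer value of n times the pairing with p / n.\<close>

definition perX :: "nat \<Rightarrow> int ^ 'd \<Rightarrow> 'd conf set" where
  "perX n p = {x. \<forall>i k. x (i + nmult n k) = x i + real_of_int (pint p k)}"

abbreviation rat_vec :: "nat \<Rightarrow> int ^ 'd \<Rightarrow> real ^ 'd" where
  "rat_vec n p \<equiv> (\<chi> m. real_of_int (p $ m) / real n)"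

lemma ipair_rat_vec: "n > 0 \<Longrightarrow> real n * ipair (rat_vec n p) k = real_of_int (pint p k)"
  by (simp add: ipair_def pint_def sum_distrib_left)

lemma linear_in_perX: "n > 0 \<Longrightarrow> ipair (rat_vec n p) \<in> perX n p"
  by (simp add: perX_def ipair_add ipair_nmult ipair_rat_vec)

lemma tau_in_perX: "x \<in> perX n p \<Longrightarrow> tau k l x \<in> perX n p"
proof -
  assume x: "x \<in> perX n p"
  have "x (i + nmult n k' + k) = x (i + k) + real_of_int (pint p k')" for i k'
  proof -
    have "i + nmult n k' + k = i + k + nmult n k'" by simp
    then show ?thesis using x unfolding perX_def by (metis (mono_tags, lifting) mem_Collect_eq)
  qed
  then show ?thesis by (simp add: perX_def tau_def)
qed

lemma perX_tau_eq: "x \<in> perX n p \<Longrightarrow> tau (nmult n k) (- pint p k) x = x"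
  by (rule ext) (simp add: perX_def tau_def)

lemma closed_perX: "closed (perX n p)"
  unfolding perX_def
  by (intro closed_Collect_all closed_Collect_eq continuous_intros continuous_on_product_coordinates)

text \<open>Iterating an inequality between x and a shift n times and using the periodicity forces
  the sign of <p/n, k> + l. By the Birkhoff property the order of x and its shift is therefore known
  as soon as this number is nonzero.\<close>

lemma perX_birkhoff_bound:
  assumes x: "x \<in> perX n p" "birkhoff x" and n: "n > 0"
  shows "\<bar>x (i + k) - x i - ipair (rat_vec n p) k\<bar> \<le> 1"
proof -
  let ?w = "rat_vec n p"
  have iter: "tau (nmult m k) (int m * l) x = ((tau k l) ^^ m) x" for m l
    by (induction m) (auto simp: algebra_simps simp flip: tau_tau)
  have up: "0 \<le> ipair ?w k + l" if "conf_le x (tau k l x)" for l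
  proof -
    have "conf_le x (((tau k l) ^^ m) x)" for m
      by (induction m) (use that tau_mono conf_le_trans in \<open>auto, blast\<close>)
    then have "conf_le x (tau (nmult n k) (int n * l) x)" by (simp add: iter)
    then have "x 0 \<le> x (0 + nmult n k) + real n * l" unfolding conf_le_def tau_def by (metis of_int_mult of_int_of_nat_eq)
    moreover have "x (0 + nmult n k) = x 0 + real_of_int (pint p k)"
      using x(1) unfolding perX_def by blast
    ultimately have "0 \<le> real n * (ipair ?w k + l)"
      using ipair_rat_vec[OF n, of p k] by (simp add: algebra_simps)
    then show ?thesis using n by (simp add: zero_le_mult_iff)
  qed
  have down: "ipair ?w k + l \<le> 0" if "conf_le (tau k l x) x" for l
  proof -
    have "conf_le (((tau k l) ^^ m) x) x" for m
      by (induction m) (use that tau_mono conf_le_trans in \<open>auto, blast\<close>)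
    then have "conf_le (tau (nmult n k) (int n * l) x) x" by (simp add: iter)
    then have "x (0 + nmult n k) + real n * l \<le> x 0" unfolding conf_le_def tau_def by (metis of_int_mult of_int_of_nat_eq)
    moreover have "x (0 + nmult n k) = x 0 + real_of_int (pint p k)"
      using x(1) unfolding perX_def by blast
    ultimately have "real n * (ipair ?w k + l) \<le> 0"
      using ipair_rat_vec[OF n, of p k] by (simp add: algebra_simps)
    then show ?thesis using n by (simp add: mult_le_0_iff)
  qed
  \<comment> \<open>The least integer that makes <p/n, k> + l strictly positive; strictness excludes
    the order opposite to the one claimed. \<open>l'\<close> is the mirror choice.\<close>
  define l where "l = \<lfloor>- ipair ?w k\<rfloor> + 1"
  have "conf_le x (tau k l x)"
    using x(2) down[of l] unfolding birkhoff_def l_def by (smt (verit) of_int_1 of_int_add real_of_int_floor_add_one_gt)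
  then have 1: "x i \<le> x (i + k) + l" by (simp add: conf_le_def tau_def)
  define l' where "l' = \<lceil>- ipair ?w k\<rceil> - 1"
  have "conf_le (tau k l' x) x"
    using x(2) up[of l'] unfolding birkhoff_def l'_def by (smt (verit) ceiling_correct of_int_1 of_int_diff)
  then have 2: "x (i + k) + l' \<le> x i" by (simp add: conf_le_def tau_def)
  show ?thesis using 1 2 unfolding l_def l'_def by linarith
qed

context lattice_potential
begin

definition En :: "nat \<Rightarrow> 'd conf \<Rightarrow> real" where "En n x = (\<Sum>j\<in>cell n. S j x)"

definition pmin :: "nat \<Rightarrow> int ^ 'd \<Rightarrow> 'd conf \<Rightarrow> bool" where
  "pmin n p x \<longleftrightarrow> x \<in> perX n p \<and> (\<forall>y\<in>perX n p. En n x \<le> En n y)"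

lemma S_per: "x \<in> perX n p \<Longrightarrow> S (j + nmult n k) x = S j x"
  using S_tau[of j "nmult n k" "- pint p k" x] by (simp add: perX_tau_eq)

lemma S_rmod: "x \<in> perX n p \<Longrightarrow> S (rmod n j) x = S j x"
  using S_per[of x n p "rmod n j" "\<chi> m. j $ m div int n"] by (simp add: rmod_eq)

lemma En_tau: "x \<in> perX n p \<Longrightarrow> n > 0 \<Longrightarrow> En n (tau k l x) = En n x"
  unfolding En_def S_tau using sum_cell_shift[of n "\<lambda>j. S j x" k] S_per by blast

lemma continuous_on_S: "continuous_on A (S j)"
  using continuous_S continuous_on_subset by blast

lemma S_bounded_below: "\<exists>c. \<forall>j x. c \<le> S j x"
proof -
  obtain c where "\<forall>x. c \<le> S 0 x" using condC unfolding condC_def by blast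
  then show ?thesis using S_tau[of 0 _ 0] by (metis add_0)
qed

text \<open>(C) gives a threshold for each unit vector at site 0; there are finitely many unit
  vectors, and (B) carries the bound to every site.\<close>

lemma coercive: "\<exists>R. \<forall>j k x. lnorm (k - j) = 1 \<longrightarrow> S j x \<le> M \<longrightarrow> \<bar>x k - x j\<bar> \<le> R"
proof -
  have "\<forall>e. \<exists>R. lnorm e = 1 \<longrightarrow> (\<forall>x. R \<le> \<bar>x e - x 0\<bar> \<longrightarrow> M + 1 \<le> S 0 x)"
    using condC unfolding condC_def by (metis diff_zero)
  then obtain R where R: "\<And>e x. lnorm e = 1 \<Longrightarrow> R e \<le> \<bar>x e - x 0\<bar> \<Longrightarrow> M + 1 \<le> S 0 x"
    by metis
  have fin: "finite {e :: int ^ 'd. lnorm e = 1}"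
    by (rule finite_subset[OF _ finite_lnorm_le[of 1]]) auto
  have "\<bar>x k - x j\<bar> \<le> (\<Sum>e | lnorm e = 1. \<bar>R e\<bar>)" if "lnorm (k - j) = 1" "S j x \<le> M" for j k x
  proof -
    have "S 0 (tau j 0 x) \<le> M" using that by (simp add: S_tau)
    then have "\<bar>tau j 0 x (k - j) - tau j 0 x 0\<bar> < R (k - j)"
      using R[OF that(1), of "tau j 0 x"] by linarith
    moreover have "\<bar>R (k - j)\<bar> \<le> (\<Sum>e | lnorm e = 1. \<bar>R e\<bar>)"
      by (rule member_le_sum[OF _ _ fin, of _ "\<lambda>e. \<bar>R e\<bar>"]) (use that in auto)
    ultimately show ?thesis by (simp add: tau_def)
  qed
  then show ?thesis by blast
qed

text \<open>The energy is invariant under integer vertical shifts, so x 0 may be put in [0, 1]. On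
  the sublevel set of the linear configuration every single \<open>S j\<close> is bounded, (C) then
  bounds the differences of neighbours, and a path to the origin bounds every coordinate: the set is
  compact.\<close>

lemma exists_pmin:
  assumes n: "n > 0" shows "\<exists>x. pmin n p x"
proof -
  let ?lin = "ipair (rat_vec n p)"
  obtain c where c: "\<And>j x. c \<le> S j x" using S_bounded_below by blast
  \<comment> \<open>What remains for one site of the cell when every other site contributes at least
    c.\<close>
  define M where "M = En n ?lin - (real (card (cell n :: (int ^ 'd) set)) - 1) * c"
  obtain R where R: "\<And>j k x. lnorm (k - j) = 1 \<Longrightarrow> S j x \<le> M \<Longrightarrow> \<bar>x k - x j\<bar> \<le> R"
    using coercive by blast
  define A where "A = {x \<in> perX n p. (0 \<le> x 0 \<and> x 0 \<le> 1) \<and> En n x \<le> En n ?lin}"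
  have SM: "S j x \<le> M" if "x \<in> A" for j x
  proof -
    have x: "x \<in> perX n p" using that by (simp add: A_def)
    have "(\<Sum>i\<in>cell n - {rmod n j}. c) \<le> (\<Sum>i\<in>cell n - {rmod n j}. S i x)"
      by (intro sum_mono c)
    moreover have "En n x = S (rmod n j) x + (\<Sum>i\<in>cell n - {rmod n j}. S i x)"
      unfolding En_def by (rule sum.remove[OF finite_cell rmod_in_cell[OF n]])
    moreover have "card (cell n - {rmod n j}) = card (cell n :: (int ^ 'd) set) - 1"
      using rmod_in_cell[OF n, of j] finite_cell by (subst card_Diff_singleton) auto
    moreover have "card (cell n :: (int ^ 'd) set) > 0"
      using rmod_in_cell[OF n, of j] finite_cell by (auto simp: card_gt_0_iff)
    ultimately have "S (rmod n j) x \<le> M"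
      using that by (simp add: M_def A_def of_nat_diff Suc_leI)
    then show ?thesis by (simp add: S_rmod[OF x])
  qed
  have "\<exists>B. \<forall>x\<in>A. \<bar>x i - x 0\<bar> \<le> B" for i
  proof (induction rule: lattice_induct)
    case (2 i k)
    then obtain B where B: "\<forall>x\<in>A. \<bar>x i - x 0\<bar> \<le> B" by blast
    have "\<bar>x k - x 0\<bar> \<le> B + R" if "x \<in> A" for x
      using bspec[OF B that] R[OF 2(2) SM[OF that]] by linarith
    then show ?case by blast
  qed (auto intro: exI[of _ 0])
  then obtain B where B: "\<And>i x. x \<in> A \<Longrightarrow> \<bar>x i - x 0\<bar> \<le> B i" by metis
  have "A \<subseteq> {x. \<forall>i. - B i \<le> x i \<and> x i \<le> 1 + B i}"
  proof
    fix x assume xA: "x \<in> A"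
    then have "0 \<le> x 0" "x 0 \<le> 1" by (auto simp: A_def)
    then have "- B i \<le> x i \<and> x i \<le> 1 + B i" for i using B[OF xA, of i] by linarith
    then show "x \<in> {x. \<forall>i. - B i \<le> x i \<and> x i \<le> 1 + B i}" by simp
  qed
  moreover have cE: "continuous_on A (En n)" for A
    unfolding En_def by (intro continuous_on_sum continuous_on_S)
  have "closed A"
    unfolding A_def Collect_conj_eq Collect_mem_eq
    by (intro closed_Int closed_perX closed_Collect_le cE continuous_intros continuous_on_product_coordinates)
  ultimately have "compact A"
    using compact_Int_closed[OF compact_conf_box, of A "\<lambda>i. - B i" "\<lambda>i. 1 + B i"]
    by (simp add: inf.absorb2)
  moreover have "?lin \<in> A" using linear_in_perX[OF n] by (simp add: A_def)
  then have "A \<noteq> {}" by blast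
  ultimately obtain x where x: "x \<in> A" "\<And>y. y \<in> A \<Longrightarrow> En n x \<le> En n y"
    using continuous_attains_inf[of A "En n"] cE[of A] by metis
  have "En n x \<le> En n y" if y: "y \<in> perX n p" for y
  proof -
    define y' where "y' = tau 0 (- \<lfloor>y 0\<rfloor>) y"
    have "y' \<in> perX n p" "En n y' = En n y"
      using y n by (auto simp: y'_def tau_in_perX En_tau)
    moreover have "y' 0 = y 0 - of_int \<lfloor>y 0\<rfloor>" by (simp add: y'_def tau_def)
    then have "0 \<le> y' 0" "y' 0 \<le> 1" by linarith+
    ultimately show ?thesis using x(1) x(2)[of y'] by (cases "En n y' \<le> En n ?lin") (auto simp: A_def)
  qed
  then show ?thesis using x(1) by (auto simp: pmin_def A_def)
qed

lemma pmin_tau: "pmin n p x \<Longrightarrow> n > 0 \<Longrightarrow> pmin n p (tau k l x)"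
  using En_tau tau_in_perX unfolding pmin_def by metis

lemma stationary_of_min:
  assumes "\<And>t. (\<Sum>j\<in>lball i r. S j x) \<le> (\<Sum>j\<in>lball i r. S j (x(i := t)))"
  shows "gradW S r x i = 0"
proof -
  have "((\<lambda>t. \<Sum>j\<in>lball i r. S j (x(i := t))) has_real_derivative
      (\<Sum>j\<in>lball i r. pd i (S j) (x(i := x i)))) (at (x i))"
    by (intro derivative_intros pdiff_DERIV pdiff1)
  from DERIV_local_min[OF this, of 1] show ?thesis
    using assms by (simp add: gradW_def)
qed

end

lemma rmod_cell: "j \<in> cell n \<Longrightarrow> rmod n j = j"
  by (simp add: cell_def rmod_def vec_eq_iff)

context lattice_potential
begin

text \<open>For n larger than the diameter of the r-neighbourhood \<open>B'\<close> of B, reduction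
  mod n is injective on \<open>B'\<close>. A perturbation supported in the interior of B can then be
  repeated periodically without overlap, and periodic minimality compares exactly the energies of
  B.\<close>

lemma pmin_local_min:
  assumes B: "finite B"
  shows "\<exists>n0>0. \<forall>n\<ge>n0. \<forall>p x y. pmin n p x \<longrightarrow> (\<forall>i. i \<notin> interior_r r B \<longrightarrow> y i = 0) \<longrightarrow>
    WB S B x \<le> WB S B (\<lambda>i. x i + y i)"
proof -
  define B' where "B' = B \<union> (\<Union>j\<in>B. lball j r)"
  have B': "finite B'" using B by (simp add: B'_def)
  define D where "D = (\<Sum>a\<in>B'. \<Sum>b\<in>B'. lnorm (a - b))"
  have D: "lnorm (a - b) \<le> D" if "a \<in> B'" "b \<in> B'" for a b
  proof -
    have "lnorm (a - b) \<le> (\<Sum>b\<in>B'. lnorm (a - b))"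
      by (rule member_le_sum[OF that(2) _ B', of "\<lambda>b. lnorm (a - b)"]) simp
    also have "\<dots> \<le> D" unfolding D_def
      by (rule member_le_sum[OF that(1) _ B', of "\<lambda>a. \<Sum>b\<in>B'. lnorm (a - b)"]) (simp add: sum_nonneg)
    finally show ?thesis .
  qed
  define n0 where "n0 = nat D + 1"
  have "WB S B x \<le> WB S B (\<lambda>i. x i + y i)"
    if n: "n \<ge> n0" and x: "pmin n p x" and y: "\<forall>i. i \<notin> interior_r r B \<longrightarrow> y i = 0" for n p x y
  proof -
    have xX: "x \<in> perX n p" using x by (simp add: pmin_def)
    have inj: "a = b" if "a \<in> B'" "b \<in> B'" "rmod n a = rmod n b" for a b
    proof -
      obtain k where k: "a = b + nmult n k" using rmod_eqD[OF \<open>rmod n a = rmod n b\<close>] .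
      then have "int n * lnorm k \<le> D" using D[OF that(1,2)] by (simp add: lnorm_nmult)
      moreover have "D < int n" using n by (simp add: n0_def)
      moreover have "int n * 1 \<le> int n * lnorm k" if "lnorm k \<noteq> 0"
        by (rule mult_left_mono) (use that lnorm_nonneg[of k] in linarith, simp)
      ultimately have "k = 0" using lnorm_eq_0_iff by fastforce
      then show ?thesis using k by (simp add: nmult_def vec_eq_iff)
    qed
    \<comment> \<open>The n-periodic repetition of y, as a sum over the finite set B: at most one
      summand is nonzero.\<close>
    define yp where "yp = (\<lambda>i. \<Sum>b\<in>B. if rmod n b = rmod n i then y b else 0)"
    have yB': "yp a = y a" if "a \<in> B'" for a
    proof -
      have "yp a = (\<Sum>b\<in>B. if b = a then y b else 0)"
        unfolding yp_def by (rule sum.cong) (use inj that in \<open>auto simp: B'_def\<close>)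
      also have "\<dots> = y a" using y B by (auto simp: interior_r_def)
      finally show ?thesis .
    qed
    define z where "z = (\<lambda>i. x i + yp i)"
    have zX: "z \<in> perX n p"
      using xX by (simp add: perX_def z_def yp_def rmod_add)
    have split: "En n u = (\<Sum>j\<in>B. S j u) + (\<Sum>j\<in>cell n - rmod n ` B. S j u)" if "u \<in> perX n p" for u
    proof -
      have "(\<Sum>j\<in>rmod n ` B. S j u) = (\<Sum>j\<in>B. S j u)"
        by (subst sum.reindex) (use inj in \<open>auto simp: B'_def inj_on_def S_rmod[OF that]\<close>)
      moreover have "rmod n ` B \<subseteq> cell n" using rmod_in_cell[of n] n by (auto simp: n0_def)
      ultimately show ?thesis unfolding En_def
        using sum.subset_diff[OF _ finite_cell, of "rmod n ` B" n "\<lambda>j. S j u"] by simp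
    qed
    \<comment> \<open>A site j outside the residues of B sees no perturbed site: y lives on points
      whose r-ball is contained in B, so j would otherwise be congruent to a point of B.\<close>
    have "S j z = S j x" if j: "j \<in> cell n - rmod n ` B" for j
    proof (rule S_local)
      fix k assume k: "k \<in> lball j r"
      have "y b = 0" if b: "b \<in> B" "rmod n b = rmod n k" for b
      proof (rule ccontr)
        assume "y b \<noteq> 0"
        then have "lball b r \<subseteq> B" using y by (auto simp: interior_r_def)
        moreover obtain c where c: "k = b + nmult n c" using rmod_eqD[OF b(2)[symmetric]] .
        have "j - nmult n c \<in> lball b r"
          using k by (simp add: c lball_def) (simp add: lnorm_diff_commute algebra_simps)
        ultimately have "j - nmult n c \<in> B" by blast
        moreover have "rmod n (j - nmult n c) = j"
          using rmod_add[of n "j - nmult n c" c] rmod_cell[of j n] j by simp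
        ultimately show False using j by force
      qed
      then have "yp k = 0" unfolding yp_def by (intro sum.neutral) auto
      then show "z k = x k" by (simp add: z_def)
    qed
    then have "(\<Sum>j\<in>cell n - rmod n ` B. S j z) = (\<Sum>j\<in>cell n - rmod n ` B. S j x)" by simp
    moreover have "En n x \<le> En n z" using x zX by (simp add: pmin_def)
    moreover have "(\<Sum>j\<in>B. S j z) = (\<Sum>j\<in>B. S j (\<lambda>i. x i + y i))"
      by (intro sum.cong refl S_local) (use yB' in \<open>auto simp: z_def B'_def\<close>)
    ultimately show ?thesis unfolding WB_def using split[OF xX] split[OF zX] by linarith
  qed
  then show ?thesis by (intro exI[of _ n0]) (simp add: n0_def)
qed

lemma self_in_lball: "i \<in> lball i r"
  using r_pos by (simp add: lball_def)

lemma stationary_of_local_min: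
  assumes "\<And>y. (\<forall>k. k \<notin> interior_r r (lball i r) \<longrightarrow> y k = 0) \<Longrightarrow>
    WB S (lball i r) x \<le> WB S (lball i r) (\<lambda>k. x k + y k)"
  shows "gradW S r x i = 0"
proof (rule stationary_of_min)
  fix t
  have "(\<lambda>k. x k + (if k = i then t - x i else 0)) = x(i := t)" by auto
  moreover have "i \<in> interior_r r (lball i r)" using self_in_lball by (simp add: interior_r_def)
  ultimately show "(\<Sum>j\<in>lball i r. S j x) \<le> (\<Sum>j\<in>lball i r. S j (x(i := t)))"
    using assms[of "\<lambda>k. if k = i then t - x i else 0"] by (auto simp: WB_def)
qed

lemma pmin_stationary: "\<exists>n0>0. \<forall>n\<ge>n0. \<forall>p x i. pmin n p x \<longrightarrow> gradW S r x i = 0"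
proof -
  obtain n0 where n0: "n0 > 0" and min: "\<And>n p x y. n \<ge> n0 \<Longrightarrow> pmin n p x \<Longrightarrow>
      (\<forall>i. i \<notin> interior_r r (lball 0 r) \<longrightarrow> y i = 0) \<Longrightarrow>
    WB S (lball 0 r) x \<le> WB S (lball 0 r) (\<lambda>i. x i + y i)"
    using pmin_local_min[OF finite_lball[of 0 r]] by blast
  have "gradW S r x i = 0" if "n \<ge> n0" "pmin n p x" for n p x i
  proof -
    have "pmin n p (tau i 0 x)" using pmin_tau that n0 by simp
    then have "gradW S r (tau i 0 x) 0 = 0"
      using min[OF that(1)] by (intro stationary_of_local_min) blast
    then show ?thesis by (simp add: gradW_tau)
  qed
  then show ?thesis using n0 by blast
qed

text \<open>Submodularity makes the pointwise minimum of x and y another minimizer. At every site it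
  touches x or y, and since all three are stationary the maximum principle makes it equal to one of
  them.\<close>

lemma pmin_ordered:
  assumes stat: "\<And>x i. pmin n p x \<Longrightarrow> gradW S r x i = 0" and x: "pmin n p x" and y: "pmin n p y"
  shows "conf_le x y \<or> conf_le y x"
proof -
  define m M where "m = (\<lambda>i. min (x i) (y i))" and "M = (\<lambda>i. max (x i) (y i))"
  have mX: "m \<in> perX n p" and MX: "M \<in> perX n p"
    using x y by (auto simp: pmin_def perX_def m_def M_def)
  have "En n m + En n M \<le> En n x + En n y"
    unfolding En_def m_def M_def sum.distrib[symmetric] by (intro sum_mono submodular)
  moreover have "En n y \<le> En n M" using y MX by (simp add: pmin_def)
  ultimately have "En n m \<le> En n x" by simp
  then have m: "pmin n p m" using x mX unfolding pmin_def by (blast intro: order_trans)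
  have le: "conf_le m x" "conf_le m y" by (auto simp: m_def conf_le_def)
  have "m 0 = x 0 \<or> m 0 = y 0" by (auto simp: m_def)
  then have "m = x \<or> m = y" using touching[OF le(1)] touching[OF le(2)] stat m x y by metis
  then show ?thesis using le by auto
qed

section \<open>Global minimizers as limits of periodic minimizers\<close>

lemma closed_global_min: "closed {x. global_min S r x}"
proof -
  have "continuous_on UNIV (\<lambda>x. S j (\<lambda>i. x i + y i))" for j y
    by (rule continuous_on_compose2[OF continuous_S])
      (auto intro!: continuous_on_coordinatewise_then_product continuous_intros continuous_on_product_coordinates)
  then have "closed {x. WB S B x \<le> WB S B (\<lambda>i. x i + y i)}" for B y
    unfolding WB_def by (intro closed_Collect_le continuous_on_sum continuous_on_S) auto
  then show ?thesis unfolding global_min_def imp_conv_disj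
    by (intro closed_Collect_all closed_Collect_disj closed_Collect_const)
qed

lemma global_min_tau:
  assumes "global_min S r x" shows "global_min S r (tau k l x)"
  unfolding global_min_def
proof (intro allI impI)
  fix B :: "(int ^ 'd) set" and y :: "'d conf"
  assume B: "finite B" and y: "\<forall>i. i \<notin> interior_r r B \<longrightarrow> y i = 0"
  define B' where "B' = (\<lambda>i. i + k) ` B"
  define y' where "y' = (\<lambda>i. y (i - k))"
  have WB: "WB S B (tau k l u) = WB S B' u" for u
    unfolding WB_def B'_def S_tau by (subst sum.reindex) auto
  have "y' i = 0" if "i \<notin> interior_r r B'" for i
  proof -
    have "i - k \<notin> interior_r r B"
    proof
      assume *: "i - k \<in> interior_r r B"
      have "lball i r \<subseteq> B'"
      proof
        fix m assume "m \<in> lball i r"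
        then have "m - k \<in> lball (i - k) r" by (simp add: lball_def)
        then have "m - k \<in> B" using * by (auto simp: interior_r_def)
        then show "m \<in> B'" unfolding B'_def by (intro image_eqI[of _ _ "m - k"]) auto
      qed
      moreover have "i \<in> B'"
        using * unfolding B'_def by (intro image_eqI[of _ _ "i - k"]) (auto simp: interior_r_def)
      ultimately show False using that by (simp add: interior_r_def)
    qed
    then show ?thesis using y by (simp add: y'_def)
  qed
  then have "WB S B' x \<le> WB S B' (\<lambda>i. x i + y' i)"
    using assms B unfolding global_min_def B'_def by blast
  moreover have "tau k l (\<lambda>i. x i + y' i) = (\<lambda>i. tau k l x i + y i)"
    by (rule ext) (simp add: tau_def y'_def)
  ultimately show "WB S B (tau k l x) \<le> WB S B (\<lambda>i. tau k l x i + y i)"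
    using WB[of x] WB[of "\<lambda>i. x i + y' i"] by simp
qed

lemma global_min_stationary: "global_min S r x \<Longrightarrow> gradW S r x i = 0"
  by (rule stationary_of_local_min) (simp add: global_min_def)

lemma exists_birkhoff_minimizer:
  "\<exists>x. global_min S r x \<and> birkhoff x \<and> (\<forall>i k. \<bar>x (i + k) - x i - ipair w k\<bar> \<le> 1)"
proof -
  obtain n0 where n0_pos: "n0 > 0" and stat: "\<forall>n\<ge>n0. \<forall>p x i. pmin n p x \<longrightarrow> gradW S r x i = 0"
    using pmin_stationary by (elim exE conjE)
  have n0: "n0 > 0" "\<And>n p x i. n \<ge> n0 \<Longrightarrow> pmin n p x \<Longrightarrow> gradW S r x i = 0"
    by (rule n0_pos, use stat in simp)
  \<comment> \<open>Rounded multiples of w, so that p n / n tends to w. The periods start at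
    \<open>n0\<close>, from which on periodic minimizers are known to be stationary, as their
    ordering requires.\<close>
  define p where "p n = (\<chi> m. \<lfloor>real n * w $ m\<rfloor>)" for n
  have "\<exists>x. pmin (n0 + n) (p (n0 + n)) x \<and> 0 \<le> x 0 \<and> x 0 \<le> 1" for n
  proof -
    obtain x where x: "pmin (n0 + n) (p (n0 + n)) x" using exists_pmin[of "n0 + n"] n0(1) by auto
    have "tau 0 (- \<lfloor>x 0\<rfloor>) x 0 = x 0 - of_int \<lfloor>x 0\<rfloor>" by (simp add: tau_def)
    then have "0 \<le> tau 0 (- \<lfloor>x 0\<rfloor>) x 0" "tau 0 (- \<lfloor>x 0\<rfloor>) x 0 \<le> 1" by linarith+
    then show ?thesis using pmin_tau[OF x, of 0 "- \<lfloor>x 0\<rfloor>"] n0(1) by auto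
  qed
  then obtain X where X: "\<And>n. pmin (n0 + n) (p (n0 + n)) (X n)" "\<And>n. 0 \<le> X n 0" "\<And>n. X n 0 \<le> 1"
    by metis
  define v where "v n = rat_vec (n0 + n) (p (n0 + n))" for n
  have birk: "birkhoff (X n)" for n
    unfolding birkhoff_def
  proof (intro allI)
    fix k l
    show "conf_le (X n) (tau k l (X n)) \<or> conf_le (tau k l (X n)) (X n)"
      by (rule pmin_ordered[OF n0(2) X(1) pmin_tau[OF X(1)]]) (use n0(1) in simp_all)
  qed
  have bnd: "\<bar>X n (i + k) - X n i - ipair (v n) k\<bar> \<le> 1" for n i k
    unfolding v_def by (rule perX_birkhoff_bound) (use X(1) birk n0(1) in \<open>auto simp: pmin_def\<close>)
  have "(\<lambda>n. real_of_int \<lfloor>real (n0 + n) * w $ m\<rfloor> / real (n0 + n)) \<longlonglongrightarrow> w $ m" for m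
  proof (rule tendsto_sandwich[of "\<lambda>n. w $ m - 1 / real (n0 + n)" _ _ "\<lambda>n. w $ m"])
    have "(\<lambda>n. 1 / real (n + n0)) \<longlonglongrightarrow> 0" by (rule LIMSEQ_ignore_initial_segment[OF lim_1_over_n])
    then have "(\<lambda>n. w $ m - 1 / real (n0 + n)) \<longlonglongrightarrow> w $ m - 0"
      by (intro tendsto_intros) (simp add: add.commute)
    then show "(\<lambda>n. w $ m - 1 / real (n0 + n)) \<longlonglongrightarrow> w $ m" by simp
    have "w $ m - 1 / real (n0 + n) \<le> of_int \<lfloor>real (n0 + n) * w $ m\<rfloor> / real (n0 + n)" for n
    proof -
      have "(real (n0 + n) * w $ m - 1) / real (n0 + n) \<le> of_int \<lfloor>real (n0 + n) * w $ m\<rfloor> / real (n0 + n)"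
        by (rule divide_right_mono) (linarith, simp)
      then show ?thesis using n0(1) by (simp add: diff_divide_distrib)
    qed
    then show "\<forall>\<^sub>F n in sequentially. w $ m - 1 / real (n0 + n) \<le> of_int \<lfloor>real (n0 + n) * w $ m\<rfloor> / real (n0 + n)"
      by simp
    have "of_int \<lfloor>real (n0 + n) * w $ m\<rfloor> / real (n0 + n) \<le> w $ m" for n
      using n0(1) by (simp add: divide_le_eq mult.commute)
    then show "\<forall>\<^sub>F n in sequentially. of_int \<lfloor>real (n0 + n) * w $ m\<rfloor> / real (n0 + n) \<le> w $ m"
      by simp
  qed simp
  then have "v \<longlonglongrightarrow> w" unfolding v_def p_def by (intro vec_tendstoI) simp
  then have lim_v: "(\<lambda>n. ipair (v n) k) \<longlonglongrightarrow> ipair w k" for k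
    unfolding ipair_def by (intro tendsto_intros)
  have "\<exists>b. \<forall>n. \<bar>X n i\<bar> \<le> b" for i
  proof -
    have "Bseq (\<lambda>n. ipair (v n) i)" using lim_v convergent_imp_Bseq convergentI by blast
    then obtain K where "\<And>n. \<bar>ipair (v n) i\<bar> \<le> K" unfolding Bseq_def by auto
    then have "\<bar>X n i\<bar> \<le> 2 + K" for n using bnd[of n 0 i] X(2,3)[of n] by (smt (verit) add_0)
    then show ?thesis by blast
  qed
  then obtain b where b: "\<And>n i. \<bar>X n i\<bar> \<le> b i" by metis
  have lo: "- b i \<le> X n i" and hi: "X n i \<le> b i" for n i using b[of n i] by linarith+
  obtain x \<sigma> where \<sigma>: "strict_mono (\<sigma> :: nat \<Rightarrow> nat)" and lim: "(X \<circ> \<sigma>) \<longlonglongrightarrow> x"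
    by (rule bounded_conf_subseq[of "\<lambda>i. - b i" X b, OF lo hi])
  have limi: "(\<lambda>n. X (\<sigma> n) i) \<longlonglongrightarrow> x i" for i
    using lim by (simp add: tendsto_conf_iff)
  have limv: "(\<lambda>n. ipair (v (\<sigma> n)) k) \<longlonglongrightarrow> ipair w k" for k
    using LIMSEQ_subseq_LIMSEQ[OF lim_v \<sigma>] by (simp add: o_def)
  have "birkhoff x"
    using closed_sequentially[OF closed_birkhoff _ lim] birk by simp
  moreover have "\<bar>x (i + k) - x i - ipair w k\<bar> \<le> 1" for i k
    by (rule LIMSEQ_le_const2[of "\<lambda>n. \<bar>X (\<sigma> n) (i + k) - X (\<sigma> n) i - ipair (v (\<sigma> n)) k\<bar>"])
      (use bnd in \<open>auto intro!: tendsto_intros limi limv\<close>)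
  moreover have "global_min S r x"
    unfolding global_min_def
  proof (intro allI impI)
    fix B :: "(int ^ 'd) set" and y :: "'d conf" assume B: "finite B" and y: "\<forall>i. i \<notin> interior_r r B \<longrightarrow> y i = 0"
    \<comment> \<open>For a fixed B the comparison holds once the period is large enough; continuity
      of the finitely many potentials carries it to the limit.\<close>
    obtain n1 where n1: "\<And>n p x. n \<ge> n1 \<Longrightarrow> pmin n p x \<Longrightarrow> WB S B x \<le> WB S B (\<lambda>i. x i + y i)"
      using pmin_local_min[OF B] y by blast
    have S: "(\<lambda>n. S j (f n)) \<longlonglongrightarrow> S j u" if "f \<longlonglongrightarrow> u" for j f u
      using continuous_on_tendsto_compose[OF continuous_S that] by simp
    have "(\<lambda>n. WB S B (X (\<sigma> n))) \<longlonglongrightarrow> WB S B x"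
      unfolding WB_def by (intro tendsto_intros S) (use lim in \<open>simp add: o_def\<close>)
    moreover have "(\<lambda>n. WB S B (\<lambda>i. X (\<sigma> n) i + y i)) \<longlonglongrightarrow> WB S B (\<lambda>i. x i + y i)"
      unfolding WB_def by (intro tendsto_intros S) (auto simp: tendsto_conf_iff intro!: tendsto_intros limi)
    moreover have "WB S B (X (\<sigma> n)) \<le> WB S B (\<lambda>i. X (\<sigma> n) i + y i)" if "n \<ge> n1" for n
      by (rule n1[OF _ X(1)]) (use that seq_suble[OF \<sigma>, of n] in linarith)
    ultimately show "WB S B x \<le> WB S B (\<lambda>i. x i + y i)" by (intro LIMSEQ_le) auto
  qed
  ultimately show ?thesis by blast
qed

definition resonant :: "real ^ 'd \<Rightarrow> 'd conf \<Rightarrow> bool" where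
  "resonant w x \<longleftrightarrow> (\<forall>k l. ipair w k + real_of_int l = 0 \<longrightarrow> tau k l x = x)"

text \<open>Periodicity along the resonances of \<open>w\<close> is obtained from an arbitrary Birkhoff minimizer
  by taking the supremum over the corresponding (bounded, totally ordered) family of its shifts.\<close>

lemma exists_resonant_minimizer:
  "\<exists>x. global_min S r x \<and> (\<forall>i k. \<bar>x (i + k) - x i - ipair w k\<bar> \<le> 1) \<and> birkhoff x \<and> resonant w x"
proof -
  obtain x where x: "global_min S r x" "birkhoff x" "\<And>i k. \<bar>x (i + k) - x i - ipair w k\<bar> \<le> 1"
    using exists_birkhoff_minimizer by blast
  define A where "A = {tau k l x | k l. ipair w k + real_of_int l = 0}"
  define s where "s = (\<lambda>i. SUP a\<in>A. a i)"
  have A0: "A \<noteq> {}" unfolding A_def by (auto intro: exI[of _ 0])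
  have chain: "conf_le a b \<or> conf_le b a" if ab: "a \<in> A" "b \<in> A" for a b
  proof -
    obtain k l k' l' where "a = tau k l x" "b = tau k' l' x" using ab by (auto simp: A_def)
    then show ?thesis
      using x(2) tau_le_iff[of k l x b] le_tau_iff[of b k l x] unfolding birkhoff_def by (metis tau_tau)
  qed
  have "a i \<le> x i + 1" if "a \<in> A" for a i
  proof -
    obtain k l where kl: "a = tau k l x" "ipair w k + real_of_int l = 0" using \<open>a \<in> A\<close> by (auto simp: A_def)
    then show ?thesis using x(3)[of i k] by (simp add: tau_def)
  qed
  then have bdd: "bdd_above ((\<lambda>a. a i) ` A)" for i by (auto simp: bdd_above_def)
  obtain f where f: "\<And>n. f n \<in> A" "f \<longlonglongrightarrow> s"
    using chain_sup_seq[OF A0 chain bdd] unfolding s_def by blast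
  have up: "conf_le a s" if "a \<in> A" for a
    unfolding conf_le_def s_def using cSUP_upper[OF that bdd] by blast
  have f': "\<exists>k l. f n = tau k l x" for n using f(1)[of n] by (auto simp: A_def)
  have "global_min S r s"
    using closed_sequentially[OF closed_global_min _ f(2)] f' global_min_tau[OF x(1)] by (metis mem_Collect_eq)
  moreover have "birkhoff s"
    using closed_sequentially[OF closed_birkhoff _ f(2)] f' birkhoff_tau[OF x(2)] by (metis mem_Collect_eq)
  moreover have "\<bar>s (i + k) - s i - ipair w k\<bar> \<le> 1" for i k
  proof (rule LIMSEQ_le_const2[of "\<lambda>n. \<bar>f n (i + k) - f n i - ipair w k\<bar>"])
    show "(\<lambda>n. \<bar>f n (i + k) - f n i - ipair w k\<bar>) \<longlonglongrightarrow> \<bar>s (i + k) - s i - ipair w k\<bar>"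
      by (intro tendsto_intros) (use f(2) in \<open>auto simp: tendsto_conf_iff\<close>)
    have "\<bar>f n (i + k) - f n i - ipair w k\<bar> \<le> 1" for n
    proof -
      obtain k' l' where "f n = tau k' l' x" using f' by blast
      then show ?thesis using x(3)[of "i + k'" k] by (simp add: tau_def algebra_simps)
    qed
    then show "\<exists>N. \<forall>n\<ge>N. \<bar>f n (i + k) - f n i - ipair w k\<bar> \<le> 1" by blast
  qed
  moreover have "resonant w s"
  proof -
    \<comment> \<open>The family is invariant under resonant shifts, which gives one inequality for
      each resonance; the opposite resonance gives the other.\<close>
    have le: "conf_le s (tau k l s)" if kl: "ipair w k + real_of_int l = 0" for k l
    proof -
      have "conf_le a (tau k l s)" if "a \<in> A" for a
      proof -
        obtain k' l' where a: "a = tau k' l' x" "ipair w k' + real_of_int l' = 0" using \<open>a \<in> A\<close> by (auto simp: A_def)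
        have "ipair w (- k + k') + real_of_int (- l + l') = 0"
          using kl a(2) by (simp add: ipair_diff)
        then have "tau (- k) (- l) a \<in> A" unfolding a(1) A_def tau_tau by blast
        then show ?thesis using up tau_le_iff[of "- k" "- l" a s] by simp
      qed
      then show ?thesis unfolding conf_le_def s_def by (intro allI cSUP_least A0) (simp add: s_def)
    qed
    have "tau k l s = s" if "ipair w k + real_of_int l = 0" for k l
    proof (rule conf_le_antisym)
      have "ipair w (- k) + real_of_int (- l) = 0" using that by (simp add: ipair_minus)
      from le[OF this] show "conf_le (tau k l s) s" by (simp add: tau_le_iff)
    qed (rule le[OF that])
    then show ?thesis by (simp add: resonant_def)
  qed
  ultimately show ?thesis by blast
qed

end

section \<open>Global solutions of Lipschitz differential equations\<close>

text \<open>The integral from 0 to t for t of either sign: the integral over an empty interval is 0,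
  so at most one term is nonzero.\<close>

definition primitive :: "(real \<Rightarrow> 'a::banach) \<Rightarrow> real \<Rightarrow> 'a" where
  "primitive f t = integral {0..t} f - integral {t..0} f"

lemma primitive_0 [simp]: "primitive f 0 = 0"
  by (simp add: primitive_def)

lemma primitive_deriv:
  fixes f :: "real \<Rightarrow> 'a::banach"
  assumes f: "continuous_on UNIV f"
  shows "(primitive f has_vector_derivative f t) (at t)"
proof -
  define R where "R = \<bar>t\<bar> + 1"
  have int: "f integrable_on {a..b}" for a b
    by (rule integrable_continuous_real) (rule continuous_on_subset[OF f], simp)
  have eq: "primitive f s = integral {-R..s} f - integral {-R..0} f" if "s \<in> {-R<..<R}" for s
  proof (cases "0 \<le> s")
    case True
    then have "integral {-R..0} f + integral {0..s} f = integral {-R..s} f"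
      using that by (intro Henstock_Kurzweil_Integration.integral_combine int) auto
    moreover have "integral {s..0} f = 0" using True by (cases "s = 0") auto
    ultimately show ?thesis by (simp add: primitive_def algebra_simps)
  next
    case False
    then have "integral {-R..s} f + integral {s..0} f = integral {-R..0} f"
      using that by (intro Henstock_Kurzweil_Integration.integral_combine int) auto
    then show ?thesis using False by (simp add: primitive_def algebra_simps)
  qed
  have t: "t \<in> {-R<..<R}" unfolding R_def by auto
  have "continuous_on {-R..R} f" by (rule continuous_on_subset[OF f]) simp
  then have "((\<lambda>s. integral {-R..s} f) has_vector_derivative f t) (at t within {-R..R})"
    using t by (intro integral_has_vector_derivative) simp_all
  then have "((\<lambda>s. integral {-R..s} f) has_vector_derivative f t) (at t)"
    using t by (simp add: at_within_Icc_at)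
  then have "((\<lambda>s. integral {-R..s} f - integral {-R..0} f) has_vector_derivative f t) (at t)"
    using has_vector_derivative_diff[OF _ has_vector_derivative_const] by fastforce
  then show ?thesis
    by (rule has_vector_derivative_transform_within_open[of _ _ _ "{-R<..<R}"])
      (use t eq in auto)
qed

lemma primitive_continuous: "continuous_on UNIV f \<Longrightarrow> continuous_on UNIV (primitive f)"
  for f :: "real \<Rightarrow> 'a::banach"
  by (intro continuous_at_imp_continuous_on ballI has_vector_derivative_continuous)
    (rule primitive_deriv)

text \<open>Integration divides a bound with exponential rate K by K. The contraction factor of the
  Picard map below comes from this.\<close>

lemma primitive_norm_bound:
  fixes f :: "real \<Rightarrow> 'a::banach"
  assumes f: "continuous_on UNIV f" and K: "K > 0"
    and bound: "\<And>s. norm (f s) \<le> B * exp (K * \<bar>s\<bar>)"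
  shows "norm (primitive f t) \<le> B / K * exp (K * \<bar>t\<bar>)"
proof -
  have B: "B \<ge> 0" using order_trans[OF norm_ge_zero bound[of 0]] by simp
  have *: "norm (g t - g 0) \<le> B / K * exp (K * t)"
    if "t > 0" "continuous_on UNIV g" "\<And>s. s > 0 \<Longrightarrow> (g has_vector_derivative g' s) (at s)"
      "\<And>s. s > 0 \<Longrightarrow> norm (g' s) \<le> B * exp (K * s)"
    for t and g g' :: "real \<Rightarrow> 'a"
  proof -
    have "norm (g t - g 0) \<le> B / K * exp (K * t) - B / K * exp (K * 0)"
    proof (rule differentiable_bound_general[OF that(1), of _ _ g' "\<lambda>s. B * exp (K * s)"])
      fix s :: real
      show "((\<lambda>s. B / K * exp (K * s)) has_vector_derivative B * exp (K * s)) (at s)"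
        using K by (auto intro!: derivative_eq_intros simp: has_real_derivative_iff_has_vector_derivative[symmetric])
      show "continuous_on {0..t} g" by (rule continuous_on_subset[OF that(2)]) simp
      show "continuous_on {0..t} (\<lambda>s. B / K * exp (K * s))"
        using K by (intro continuous_intros) auto
    qed (use that in auto)
    then show ?thesis using B K by (smt (verit) divide_nonneg_pos exp_ge_zero mult_nonneg_nonneg)
  qed
  consider "t > 0" | "t = 0" | "t < 0" by linarith
  then show ?thesis
  proof cases
    case 1
    have "norm (f s) \<le> B * exp (K * s)" if "s > 0" for s using bound[of s] that by simp
    then show ?thesis
      using *[OF 1 primitive_continuous[OF f], of f] primitive_deriv[OF f] 1 by simp
  next
    case 2
    then show ?thesis using B K by simp
  next
    case 3
    have "((\<lambda>s. primitive f (- s)) has_vector_derivative - f (- s)) (at s)" for s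
    proof -
      have "(uminus has_vector_derivative - 1) (at s)"
        by (auto simp: has_real_derivative_iff_has_vector_derivative[symmetric] intro!: derivative_eq_intros)
      from vector_diff_chain_at[OF this primitive_deriv[OF f]] show ?thesis by (simp add: o_def)
    qed
    moreover have "continuous_on UNIV (\<lambda>s. primitive f (- s))"
      by (rule continuous_on_compose2[OF primitive_continuous[OF f]]) (auto intro!: continuous_intros)
    moreover have "norm (- f (- s)) \<le> B * exp (K * s)" if "s > 0" for s
      using bound[of "- s"] that by simp
    ultimately show ?thesis
      using *[of "- t" "\<lambda>s. primitive f (- s)" "\<lambda>s. - f (- s)"] 3 by simp
  qed
qed

text \<open>Picard iteration in an exponentially weighted norm: the unknown is x0 + exp(K |s|) h(s)
  with h bounded, and K twice a positive Lipschitz constant makes the map a contraction with factor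
  1/2 on the whole time axis, so no local solutions have to be continued.\<close>

lemma lipschitz_ode_solution:
  fixes F :: "'a::banach \<Rightarrow> 'a"
  assumes L: "\<And>x y. norm (F x - F y) \<le> L * norm (x - y)"
  obtains g where "g 0 = x0" "\<And>t. (g has_vector_derivative F (g t)) (at t)"
proof -
  define L' where "L' = \<bar>L\<bar> + 1"
  have L'pos: "L' > 0" by (simp add: L'_def)
  have L': "norm (F x - F y) \<le> L' * norm (x - y)" for x y
  proof -
    have "L * norm (x - y) \<le> L' * norm (x - y)"
      by (rule mult_right_mono) (auto simp: L'_def)
    then show ?thesis using L[of x y] by linarith
  qed
  define K where "K = 2 * L'"
  have K: "K > 0" using L'pos by (simp add: K_def)
  have F_cont: "continuous_on UNIV F"
    by (rule lipschitz_on_continuous_on[of L'], rule lipschitz_onI)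
      (use L' L'pos in \<open>auto simp: dist_norm\<close>)
  define u where "u h = (\<lambda>s. x0 + exp (K * \<bar>s\<bar>) *\<^sub>R apply_bcontfun h s)" for h :: "real \<Rightarrow>\<^sub>C 'a"
  have u_cont: "continuous_on UNIV (u h)" for h
    unfolding u_def by (intro continuous_intros) auto
  have Fu_cont: "continuous_on UNIV (\<lambda>s. F (u h s))" for h
    using continuous_on_compose2[OF F_cont u_cont] by simp
  define P where "P h = (\<lambda>t. exp (- K * \<bar>t\<bar>) *\<^sub>R primitive (\<lambda>s. F (u h s)) t)" for h
  have bnd: "norm (P h t - P h' t) \<le> norm (h - h') / 2" for h h' t
  proof -
    have "norm (F (u h s) - F (u h' s)) \<le> (L' * norm (h - h')) * exp (K * \<bar>s\<bar>)" for s
    proof -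
      have "norm (F (u h s) - F (u h' s)) \<le> L' * norm (exp (K * \<bar>s\<bar>) *\<^sub>R (apply_bcontfun h s - apply_bcontfun h' s))"
        using L'[of "u h s" "u h' s"] by (simp add: u_def scaleR_diff_right)
      also have "\<dots> \<le> L' * (exp (K * \<bar>s\<bar>) * norm (h - h'))"
        using L'pos dist_bounded[of h s h'] by (intro mult_left_mono) (auto simp: dist_norm)
      finally show ?thesis by (simp add: mult_ac)
    qed
    then have "norm (primitive (\<lambda>s. F (u h s) - F (u h' s)) t) \<le> (L' * norm (h - h')) / K * exp (K * \<bar>t\<bar>)"
      by (intro primitive_norm_bound K continuous_on_diff Fu_cont)
    moreover have "primitive (\<lambda>s. F (u h s) - F (u h' s)) t = primitive (\<lambda>s. F (u h s)) t - primitive (\<lambda>s. F (u h' s)) t"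
    proof -
      have "(\<lambda>s. F (u h s)) integrable_on {a..b}" for h and a b :: real
        by (rule integrable_continuous_real) (rule continuous_on_subset[OF Fu_cont], simp)
      then show ?thesis by (simp add: primitive_def Henstock_Kurzweil_Integration.integral_diff)
    qed
    ultimately have "exp (- K * \<bar>t\<bar>) * norm (primitive (\<lambda>s. F (u h s)) t - primitive (\<lambda>s. F (u h' s)) t)
        \<le> exp (- K * \<bar>t\<bar>) * ((L' * norm (h - h')) / K * exp (K * \<bar>t\<bar>))"
      by (intro mult_left_mono) auto
    also have "\<dots> = norm (h - h') / 2"
      using L'pos by (simp add: K_def exp_minus field_simps)
    finally show ?thesis by (simp add: P_def scaleR_diff_right[symmetric])
  qed
  have Pcont: "continuous_on UNIV (P h)" for h
    unfolding P_def by (intro continuous_intros primitive_continuous Fu_cont)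
  have "P h \<in> bcontfun" for h
  proof -
    \<comment> \<open>At h = 0 the integrand is the constant F x0; \<open>bnd\<close> carries the
      bound to every h.\<close>
    have "norm (P h t) \<le> norm (F x0) / K + norm h / 2" for t
    proof -
      have "norm (primitive (\<lambda>s. F (u 0 s)) t) \<le> norm (F x0) / K * exp (K * \<bar>t\<bar>)"
      proof (rule primitive_norm_bound[OF Fu_cont K])
        fix s
        have "norm (F x0) * 1 \<le> norm (F x0) * exp (K * \<bar>s\<bar>)"
          using K by (intro mult_left_mono) auto
        then show "norm (F (u 0 s)) \<le> norm (F x0) * exp (K * \<bar>s\<bar>)" by (simp add: u_def)
      qed
      then have "exp (- K * \<bar>t\<bar>) * norm (primitive (\<lambda>s. F (u 0 s)) t) \<le> exp (- K * \<bar>t\<bar>) * (norm (F x0) / K * exp (K * \<bar>t\<bar>))"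
        by (intro mult_left_mono) auto
      then have "norm (P 0 t) \<le> norm (F x0) / K"
        by (simp add: P_def exp_minus field_simps)
      then show ?thesis using bnd[of h t 0] norm_triangle_ineq2[of "P h t" "P 0 t"] by simp
    qed
    then have "bounded (range (P h))" unfolding bounded_iff by blast
    then show ?thesis using Pcont by (simp add: bcontfun_def)
  qed
  then have app: "apply_bcontfun (Bcontfun (P h)) = P h" for h
    by (simp add: Bcontfun_inverse)
  have "\<exists>!h. Bcontfun (P h) = h"
  proof (rule banach_fix_type[of "1/2"])
    show "\<forall>x y. dist (Bcontfun (P x)) (Bcontfun (P y)) \<le> 1 / 2 * dist x y"
      by (intro allI dist_bound) (use bnd in \<open>simp add: app dist_norm\<close>)
  qed auto
  then obtain h where h: "Bcontfun (P h) = h" by blast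
  have uh: "u h t = x0 + primitive (\<lambda>s. F (u h s)) t" for t
  proof -
    have "apply_bcontfun h t = P h t" using app[of h] h by simp
    then have "exp (K * \<bar>t\<bar>) *\<^sub>R apply_bcontfun h t = (exp (K * \<bar>t\<bar>) * exp (- K * \<bar>t\<bar>)) *\<^sub>R primitive (\<lambda>s. F (u h s)) t"
      by (simp add: P_def)
    then show ?thesis by (simp add: u_def exp_minus)
  qed
  have "(u h has_vector_derivative F (u h t)) (at t)" for t
  proof -
    have "((\<lambda>t. x0 + primitive (\<lambda>s. F (u h s)) t) has_vector_derivative 0 + F (u h t)) (at t)"
      by (intro has_vector_derivative_add has_vector_derivative_const primitive_deriv Fu_cont)
    then show ?thesis unfolding uh[symmetric] by simp
  qed
  moreover have "u h 0 = x0" using uh[of 0] by simp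
  ultimately show thesis by (intro that)
qed

section \<open>Weighted summability on the lattice\<close>

lemma sum_geometric_int_le:
  assumes q: "0 \<le> q" "q < (1::real)"
  shows "(\<Sum>j\<in>{-M..M}. q ^ nat \<bar>j\<bar>) \<le> 2 / (1 - q)"
proof -
  have fin: "finite (int ` {..nat M} \<union> (\<lambda>n. - int n) ` {..nat M})" by simp
  have "{-M..M} \<subseteq> int ` {..nat M} \<union> (\<lambda>n. - int n) ` {..nat M}"
  proof
    fix j assume j: "j \<in> {-M..M}"
    show "j \<in> int ` {..nat M} \<union> (\<lambda>n. - int n) ` {..nat M}"
    proof (cases "0 \<le> j")
      case True then show ?thesis using j by (intro UnI1 image_eqI[of _ _ "nat j"]) auto
    next
      case False then show ?thesis using j by (intro UnI2 image_eqI[of _ _ "nat (- j)"]) auto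
    qed
  qed
  then have "(\<Sum>j\<in>{-M..M}. q ^ nat \<bar>j\<bar>) \<le> (\<Sum>j\<in>int ` {..nat M} \<union> (\<lambda>n. - int n) ` {..nat M}. q ^ nat \<bar>j\<bar>)"
    by (intro sum_mono2 fin) (use q in auto)
  also have "\<dots> \<le> (\<Sum>j\<in>int ` {..nat M}. q ^ nat \<bar>j\<bar>) + (\<Sum>j\<in>(\<lambda>n. - int n) ` {..nat M}. q ^ nat \<bar>j\<bar>)"
    using q by (subst sum_Un) (auto intro!: sum_nonneg)
  also have "\<dots> = 2 * (\<Sum>n\<le>nat M. q ^ n)"
    by (subst (1 2) sum.reindex) (auto simp: inj_on_def)
  also have "(\<Sum>n\<le>nat M. q ^ n) \<le> (\<Sum>n. q ^ n)"
    using q by (intro sum_le_suminf summable_geometric) auto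
  also have "(\<Sum>n. q ^ n) = 1 / (1 - q)" using q by (intro suminf_geometric) simp
  finally show ?thesis by simp
qed

text \<open>The weight q^\<open>nl i\<close> is a product over the coordinates, so a sum over a box
  is a product of sums over intervals, each at most 2 / (1 - q) whatever the size of the
  box.\<close>

lemma summable_geometric_lattice:
  assumes q: "0 \<le> q" "q < (1::real)"
  shows "(\<lambda>i :: int ^ 'd. q ^ nl i) summable_on UNIV"
proof (rule nonneg_bdd_above_summable_on)
  show "bdd_above (sum (\<lambda>i :: int ^ 'd. q ^ nl i) ` {F. F \<subseteq> UNIV \<and> finite F})"
  proof (rule bdd_aboveI2)
    fix F :: "(int ^ 'd) set" assume F: "F \<in> {F. F \<subseteq> UNIV \<and> finite F}"
    define M where "M = Max (insert 0 (lnorm ` F))"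
    define G where "G = PiE (UNIV :: 'd set) (\<lambda>_. {-M..M})"
    have pow: "q ^ nl i = (\<Prod>m\<in>UNIV. q ^ nat \<bar>i $ m\<bar>)" for i :: "int ^ 'd"
    proof -
      have "lnorm i = int (\<Sum>m\<in>UNIV. nat \<bar>i $ m\<bar>)" unfolding lnorm_def by simp
      then show ?thesis by (simp add: power_sum del: of_nat_sum)
    qed
    have "F \<subseteq> vec_lambda ` G"
    proof
      fix i assume i: "i \<in> F"
      have "lnorm i \<le> M" unfolding M_def using F i by (intro Max_ge) auto
      moreover have "\<bar>i $ m\<bar> \<le> lnorm i" for m
        unfolding lnorm_def by (rule member_le_sum) auto
      ultimately have "\<bar>i $ m\<bar> \<le> M" for m using order_trans by blast
      then have "i $ m \<in> {-M..M}" for m using abs_le_iff[of "i $ m" M] by simp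
      then show "i \<in> vec_lambda ` G" unfolding G_def by (intro image_eqI[of _ _ "vec_nth i"]) auto
    qed
    moreover have finG: "finite G" unfolding G_def by (rule finite_PiE) auto
    ultimately have "(\<Sum>i\<in>F. q ^ nl i) \<le> (\<Sum>i\<in>vec_lambda ` G. q ^ nl i)"
      by (intro sum_mono2) (use q in auto)
    also have "\<dots> = (\<Sum>g\<in>G. \<Prod>m\<in>UNIV. q ^ nat \<bar>g m\<bar>)"
      by (subst sum.reindex) (auto simp: pow vec_lambda_inject inj_on_def)
    also have "\<dots> = (\<Prod>m\<in>(UNIV :: 'd set). \<Sum>j\<in>{-M..M}. q ^ nat \<bar>j\<bar>)"
      unfolding G_def by (rule prod_sum_PiE[symmetric]) auto
    also have "\<dots> \<le> (\<Prod>m\<in>(UNIV :: 'd set). 2 / (1 - q))"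
      using q by (intro prod_mono conjI sum_nonneg sum_geometric_int_le) auto
    finally show "sum (\<lambda>i. q ^ nl i) F \<le> (\<Prod>m\<in>(UNIV :: 'd set). 2 / (1 - q))" .
  qed
qed (use q in auto)

lemma weightX_eq: "weightX x i = \<bar>x i\<bar> / 2 ^ nl i"
proof -
  have "2 powr (- real_of_int (lnorm i)) = 1 / 2 ^ nl i"
    by (simp add: powr_minus_divide powr_realpow[symmetric])
  then show ?thesis by (simp add: weightX_def)
qed

lemma weightX_nonneg: "0 \<le> weightX x i" by (simp add: weightX_eq)

text \<open>The base lies strictly between 1 and 2 because it has to dominate linear growth and be
  summable against the weights of \<open>normX\<close>, which halve at each step. With 3/2 the
  resulting ratio is 3/4.\<close>

definition tame :: "('d::finite) conf \<Rightarrow> bool" where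
  "tame x \<longleftrightarrow> (\<exists>c. \<forall>i. \<bar>x i\<bar> \<le> c * (3/2) ^ nl i)"

definition geosum :: "'d::finite itself \<Rightarrow> real" where
  "geosum _ = infsum (\<lambda>i :: int ^ 'd. (3/4) ^ nl i) UNIV"

lemma normX_bound:
  fixes x :: "'d::finite conf"
  assumes "\<And>i. \<bar>x i\<bar> \<le> c * (3/2) ^ nl i"
  shows "inX x" "normX x \<le> c * geosum TYPE('d)" "0 \<le> normX x"
proof -
  have le: "weightX x i \<le> c * (3/4) ^ nl i" for i
  proof -
    have "weightX x i \<le> c * (3/2) ^ nl i / 2 ^ nl i"
      unfolding weightX_eq using assms by (intro divide_right_mono) auto
    also have "(3/2 :: real) ^ nl i = (3/4) ^ nl i * 2 ^ nl i" by (simp flip: power_mult_distrib)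
    finally show ?thesis by simp
  qed
  have s: "(\<lambda>i :: int ^ 'd. c * (3/4) ^ nl i) summable_on UNIV"
    by (intro summable_on_cmult_right summable_geometric_lattice) auto
  show in_X: "inX x" unfolding inX_def
    by (rule summable_on_comparison_test[OF s]) (use le weightX_nonneg in auto)
  have "normX x \<le> infsum (\<lambda>i :: int ^ 'd. c * (3/4) ^ nl i) UNIV"
    unfolding normX_def by (rule infsum_mono) (use in_X s le in \<open>auto simp: inX_def\<close>)
  also have "\<dots> = c * geosum TYPE('d)"
    unfolding geosum_def by (rule infsum_cmult_right) (use summable_geometric_lattice[of "3/4"] in simp)
  finally show "normX x \<le> c * geosum TYPE('d)" .
  show "0 \<le> normX x" unfolding normX_def by (rule infsum_nonneg) (rule weightX_nonneg)
qed

lemma le_normX: "inX x \<Longrightarrow> \<bar>x i\<bar> \<le> normX x * 2 ^ nl i"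
proof -
  assume "inX x"
  then have "sum (weightX x) {i} \<le> normX x"
    unfolding normX_def inX_def by (rule finite_sum_le_infsum) (auto simp: weightX_nonneg)
  then show ?thesis by (simp add: weightX_eq divide_le_eq)
qed

lemma inX_diff: "inX x \<Longrightarrow> inX y \<Longrightarrow> inX (\<lambda>i. x i - y i)"
proof -
  assume "inX x" "inX y"
  then have "(\<lambda>i. weightX x i + weightX y i) summable_on UNIV"
    unfolding inX_def by (rule summable_on_add)
  then show ?thesis unfolding inX_def
    by (rule summable_on_comparison_test)
      (auto simp: weightX_nonneg weightX_eq add_divide_distrib[symmetric] intro!: divide_right_mono)
qed

lemma normX_triangle: "inX x \<Longrightarrow> inX y \<Longrightarrow> normX x \<le> normX y + normX (\<lambda>i. x i - y i)"
proof -
  assume xy: "inX x" "inX y"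
  note d = inX_diff[OF xy]
  have "(\<lambda>i. weightX y i + weightX (\<lambda>i. x i - y i) i) summable_on UNIV"
    using xy d unfolding inX_def by (intro summable_on_add)
  then have "normX x \<le> infsum (\<lambda>i. weightX y i + weightX (\<lambda>i. x i - y i) i) UNIV"
    using xy unfolding normX_def inX_def
    by (intro infsum_mono) (auto simp: weightX_eq add_divide_distrib[symmetric] intro!: divide_right_mono)
  also have "\<dots> = normX y + normX (\<lambda>i. x i - y i)"
    unfolding normX_def by (rule infsum_add) (use xy d in \<open>auto simp: inX_def\<close>)
  finally show ?thesis .
qed

lemma normX_commute: "normX (\<lambda>i. x i - y i) = normX (\<lambda>i. y i - x i)"
  unfolding normX_def by (rule infsum_cong) (simp add: weightX_eq abs_minus_commute)

section \<open>The gradient flow\<close>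

text \<open>The space of bounded functions on the lattice is only known to be complete over a metric
  domain.\<close>

instantiation int :: metric_space
begin

definition dist_int :: "int \<Rightarrow> int \<Rightarrow> real" where
  "dist_int m n = \<bar>real_of_int m - real_of_int n\<bar>"

definition uniformity_int :: "(int \<times> int) filter" where
  "uniformity_int = (INF e\<in>{0<..}. principal {(x, y). dist x y < e})"

instance
proof
  show "uniformity = (INF e\<in>{0<..}. principal {(x :: int, y). dist x y < e})"
    by (rule uniformity_int_def)
  show "open U = (\<forall>x\<in>U. \<forall>\<^sub>F (x', y) in uniformity. x' = x \<longrightarrow> y \<in> U)" for U :: "int set"
  proof -
    have "\<forall>\<^sub>F (x', y) in uniformity. x' = x \<longrightarrow> y \<in> U" if "x \<in> U" for x
      unfolding uniformity_int_def
      by (rule eventually_INF1[of 1]) (use that in \<open>auto simp: eventually_principal dist_int_def simp flip: of_int_diff of_int_abs\<close>)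
    then show ?thesis by (simp add: open_discrete)
  qed
qed (auto simp: dist_int_def)

end

instance bcontfun :: (metric_space, banach) banach ..

text \<open>The lattice is discrete, so \<open>bcontfun\<close> consists of all bounded functions on
  it; this is the Banach space in which the flow is constructed.\<close>

lemma continuous_on_lattice: "continuous_on A (f :: int ^ 'd \<Rightarrow> 'b::metric_space)"
  unfolding continuous_on_iff
proof (intro ballI allI impI)
  fix x :: "int ^ 'd" and e :: real assume "0 < e"
  have "y = x" if "dist y x < 1" for y
  proof (subst vec_eq_iff, rule allI)
    fix m
    have "dist (y $ m) (x $ m) < 1" using dist_vec_nth_le[of y m x] that by linarith
    then show "y $ m = x $ m" by (auto simp: dist_int_def)
  qed
  then show "\<exists>d>0. \<forall>y\<in>A. dist y x < d \<longrightarrow> dist (f y) (f x) < e"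
    using \<open>0 < e\<close> by (metis dist_self zero_less_one)
qed

section \<open>Growth classes, uniqueness and dependence on the initial data\<close>

context lattice_potential
begin

text \<open>The weight \<rho> is a parameter because solutions are constructed with \<rho> = 3/2,
  whereas an arbitrary flowline is only shown to satisfy the bound with \<rho> = 2. The comparison
  estimates below hold for every \<rho> in [1, 2].\<close>

definition sol :: "real \<Rightarrow> (real \<Rightarrow> 'd conf) \<Rightarrow> bool" where
  "sol \<rho> g \<longleftrightarrow> (\<forall>t i. ((\<lambda>s. g s i) has_real_derivative - gradW S r (g t) i) (at t)) \<and>
     (\<forall>T. \<exists>c. \<forall>t i. \<bar>t\<bar> \<le> T \<longrightarrow> \<bar>g t i\<bar> \<le> c * \<rho> ^ nl i)"

lemma solD: "sol \<rho> g \<Longrightarrow> ((\<lambda>s. g s i) has_real_derivative - gradW S r (g t) i) (at t)"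
  by (simp add: sol_def)

lemma sol_bound: "sol \<rho> g \<Longrightarrow> \<exists>c. \<forall>t i. \<bar>t\<bar> \<le> T \<longrightarrow> \<bar>g t i\<bar> \<le> c * \<rho> ^ nl i"
  by (simp add: sol_def)

lemma sol_shift:
  assumes "sol \<rho> g" shows "sol \<rho> (\<lambda>t. g (t + a))"
  unfolding sol_def
proof (intro conjI allI)
  fix t i
  show "((\<lambda>s. g (s + a) i) has_real_derivative - gradW S r (g (t + a)) i) (at t)"
    using solD[OF assms, of i "t + a"] DERIV_shift[of "\<lambda>s. g s i" _ t a] by simp
next
  fix T
  obtain c where c: "\<And>t i. \<bar>t\<bar> \<le> T + \<bar>a\<bar> \<Longrightarrow> \<bar>g t i\<bar> \<le> c * \<rho> ^ nl i"
    using sol_bound[OF assms] by blast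
  have "\<bar>g (t + a) i\<bar> \<le> c * \<rho> ^ nl i" if "\<bar>t\<bar> \<le> T" for t i
    by (rule c) (use that in linarith)
  then show "\<exists>c. \<forall>t i. \<bar>t\<bar> \<le> T \<longrightarrow> \<bar>g (t + a) i\<bar> \<le> c * \<rho> ^ nl i" by blast
qed

lemma tame_shift_bound: "1 \<le> \<rho> \<Longrightarrow> \<rho> ^ nl (i + k) \<le> \<rho> ^ nl k * \<rho> ^ nl i" for \<rho> :: real
  using power_increasing[OF nl_triangle[of i k], of \<rho>] by (simp add: power_add mult.commute)

lemma sol_tau:
  assumes "sol \<rho> g" and \<rho>: "1 \<le> \<rho>" shows "sol \<rho> (\<lambda>t. tau k l (g t))"
  unfolding sol_def
proof (intro conjI allI)
  fix t i
  show "((\<lambda>s. tau k l (g s) i) has_real_derivative - gradW S r (tau k l (g t)) i) (at t)"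
    using DERIV_add[OF solD[OF assms(1), of "i + k" t] DERIV_const[of "real_of_int l"]]
    by (simp add: tau_def[of k l] gradW_tau[unfolded tau_def])
next
  fix T
  obtain c where c: "\<And>t i. \<bar>t\<bar> \<le> T \<Longrightarrow> \<bar>g t i\<bar> \<le> c * \<rho> ^ nl i"
    using sol_bound[OF assms(1)] by blast
  have "\<bar>tau k l (g t) i\<bar> \<le> (\<bar>c\<bar> * \<rho> ^ nl k + \<bar>real_of_int l\<bar>) * \<rho> ^ nl i" if "\<bar>t\<bar> \<le> T" for t i
  proof -
    have "\<bar>g t (i + k)\<bar> \<le> \<bar>c\<bar> * \<rho> ^ nl (i + k)"
      by (rule order_trans[OF c[OF that]], rule mult_right_mono) (use \<rho> in auto)
    also have "\<dots> \<le> \<bar>c\<bar> * (\<rho> ^ nl k * \<rho> ^ nl i)"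
      using tame_shift_bound[OF \<rho>] by (intro mult_left_mono) auto
    finally have 1: "\<bar>g t (i + k)\<bar> \<le> \<bar>c\<bar> * \<rho> ^ nl k * \<rho> ^ nl i" by simp
    have "\<bar>real_of_int l\<bar> * 1 \<le> \<bar>real_of_int l\<bar> * \<rho> ^ nl i"
      using one_le_power[OF \<rho>] by (intro mult_left_mono) auto
    then show ?thesis using 1 unfolding tau_def distrib_right by linarith
  qed
  then show "\<exists>c. \<forall>t i. \<bar>t\<bar> \<le> T \<longrightarrow> \<bar>tau k l (g t) i\<bar> \<le> c * \<rho> ^ nl i" by blast
qed

definition T0 :: real where "T0 = 1 / (2 * (Lw + 1))"

lemma T0_pos: "T0 > 0" and T0_Lw: "T0 * Lw \<le> 1 / 2"
  using Lw_nonneg by (simp_all add: T0_def divide_simps)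

text \<open>Within time \<open>T0\<close> a bound B for the weighted difference improves to A + B /
  2. Starting from the a priori bound c + d of the growth class and iterating, the bound tends to 2
  A.\<close>

lemma sol_close_short:
  assumes \<rho>: "1 \<le> \<rho>" "\<rho> \<le> 2" and g: "sol \<rho> g" and h: "sol \<rho> h"
    and A: "\<And>i. \<bar>g 0 i - h 0 i\<bar> \<le> A * \<rho> ^ nl i" and t: "\<bar>t\<bar> \<le> T0"
  shows "\<bar>g t i - h t i\<bar> \<le> 2 * A * \<rho> ^ nl i"
proof -
  have step: "\<bar>g t i - h t i\<bar> \<le> (A + B / 2) * \<rho> ^ nl i"
    if B: "\<And>t i. \<bar>t\<bar> \<le> T0 \<Longrightarrow> \<bar>g t i - h t i\<bar> \<le> B * \<rho> ^ nl i" and t: "\<bar>t\<bar> \<le> T0" for B t i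
  proof -
    have B0: "0 \<le> B" using B[of 0 0] T0_pos by simp
    have "norm ((\<lambda>s. g s i - h s i) t - (\<lambda>s. g s i - h s i) 0) \<le> (Lw * B * \<rho> ^ nl i) * norm (t - 0)"
    proof (rule field_differentiable_bound[of "{-T0..T0}"])
      fix s assume s: "s \<in> {-T0..T0}"
      show "((\<lambda>s. g s i - h s i) has_field_derivative (- gradW S r (g s) i - - gradW S r (h s) i)) (at s within {-T0..T0})"
        by (intro derivative_intros DERIV_subset[OF solD[OF g]] DERIV_subset[OF solD[OF h]]) auto
      show "norm (- gradW S r (g s) i - - gradW S r (h s) i) \<le> Lw * B * \<rho> ^ nl i"
        using gradW_weighted_lip[OF \<rho>, of "h s" "g s" B i] B[of s] s
        by (simp add: abs_minus_commute abs_le_iff)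
    qed (use t T0_pos in \<open>auto simp: abs_le_iff\<close>)
    then have "\<bar>g t i - h t i\<bar> \<le> A * \<rho> ^ nl i + (\<bar>t\<bar> * Lw) * (B * \<rho> ^ nl i)"
      using A[of i] by (simp add: algebra_simps)
    also have "(\<bar>t\<bar> * Lw) * (B * \<rho> ^ nl i) \<le> 1 / 2 * (B * \<rho> ^ nl i)"
      using order_trans[OF mult_right_mono[OF t Lw_nonneg] T0_Lw] B0 \<rho> by (intro mult_right_mono) auto
    finally show ?thesis by (simp add: algebra_simps)
  qed
  obtain c d where c: "\<And>t i. \<bar>t\<bar> \<le> T0 \<Longrightarrow> \<bar>g t i\<bar> \<le> c * \<rho> ^ nl i"
    and d: "\<And>t i. \<bar>t\<bar> \<le> T0 \<Longrightarrow> \<bar>h t i\<bar> \<le> d * \<rho> ^ nl i"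
    using sol_bound[OF g, of T0] sol_bound[OF h, of T0] by metis
  have A0: "0 \<le> A" using A[of 0] by simp
  have "\<bar>g t i - h t i\<bar> \<le> (2 * A + (c + d) / 2 ^ n) * \<rho> ^ nl i" if "\<bar>t\<bar> \<le> T0" for n t i
    using that
  proof (induction n arbitrary: t i)
    case 0
    have "0 \<le> A * \<rho> ^ nl i" using A0 \<rho> by simp
    then show ?case using c[OF 0, of i] d[OF 0, of i] by (simp add: algebra_simps)
  next
    case (Suc n)
    show ?case using step[OF Suc.IH Suc.prems] by (simp add: field_simps)
  qed
  then have "\<bar>g t i - h t i\<bar> \<le> (2 * A + (c + d) / 2 ^ n) * \<rho> ^ nl i" for n using t by blast
  moreover have "(\<lambda>n. (2 * A + (c + d) / 2 ^ n) * \<rho> ^ nl i) \<longlonglongrightarrow> (2 * A + 0) * \<rho> ^ nl i"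
    by (intro tendsto_intros LIMSEQ_divide_realpow_zero) auto
  ultimately show ?thesis by (intro LIMSEQ_le_const[of "\<lambda>n. (2 * A + (c + d) / 2 ^ n) * \<rho> ^ nl i"]) auto
qed

text \<open>The time is split into m equal pieces of length at most \<open>T0\<close>; each doubles
  the constant.\<close>

lemma sol_close:
  assumes \<rho>: "1 \<le> \<rho>" "\<rho> \<le> 2" and "sol \<rho> g" "sol \<rho> h"
    and "\<And>i. \<bar>g 0 i - h 0 i\<bar> \<le> A * \<rho> ^ nl i" and "\<bar>t\<bar> \<le> real m * T0"
  shows "\<bar>g t i - h t i\<bar> \<le> 2 ^ m * A * \<rho> ^ nl i"
  using assms(3-6)
proof (induction m arbitrary: g h t A i)
  case (Suc m)
  define a where "a = t / real (Suc m)"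
  have a: "\<bar>a\<bar> \<le> T0" using Suc.prems(4) by (simp add: a_def divide_le_eq algebra_simps)
  have ta: "\<bar>t - a\<bar> \<le> real m * T0"
  proof -
    have "t - a = real m * a" by (simp add: a_def field_simps)
    then show ?thesis using a by (simp add: abs_mult mult_left_mono)
  qed
  have "\<bar>g (0 + a) i - h (0 + a) i\<bar> \<le> 2 * A * \<rho> ^ nl i" for i
    using sol_close_short[OF \<rho> Suc.prems(1,2,3) a] by simp
  from Suc.IH[OF sol_shift[OF Suc.prems(1)] sol_shift[OF Suc.prems(2)] this ta]
  show ?case by (simp add: mult_ac)
qed simp

lemma sol_unique:
  assumes \<rho>: "1 \<le> \<rho>" "\<rho> \<le> 2" and "sol \<rho> g" "sol \<rho> h" "g 0 = h 0"
  shows "g = h"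
proof (intro ext)
  fix t i
  obtain m where "\<bar>t\<bar> \<le> real m * T0"
    using reals_Archimedean3[OF T0_pos] less_imp_le by blast
  from sol_close[OF \<rho> assms(3,4) _ this, of 0 i] show "g t i = h t i" using assms(5) by simp
qed

end

section \<open>Order preservation, existence of solutions and the flow\<close>

context lattice_potential
begin

definition T1 :: real where "T1 = 1 / (2 * (C * N + Lw + 1) * exp (C * N))"

lemma CN_nonneg: "0 \<le> C * N" using C_nonneg N_nonneg by simp

lemma T1_pos: "T1 > 0" and T1_le: "T1 * (exp (C * N) * (C * N + Lw)) \<le> 1 / 2" and T1_le_1: "T1 \<le> 1"
proof -
  let ?e = "exp (C * N)" and ?K = "C * N + Lw"
  have K: "0 \<le> ?K" using CN_nonneg Lw_nonneg by simp
  have e: "1 \<le> ?e" using CN_nonneg by simp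
  have e0: "?e > 0" by simp
  show "T1 > 0" using K e by (simp add: T1_def)
  show "T1 * (?e * ?K) \<le> 1 / 2" using K by (simp add: T1_def divide_simps)
  have "1 * 1 \<le> (2 * (?K + 1)) * ?e" using K e by (intro mult_mono) auto
  then show "T1 \<le> 1" using K e0 by (simp add: T1_def divide_le_eq)
qed

text \<open>Since \<open>x \<mapsto> C N x - \<nabla>W(x)\<close> is order preserving and Lipschitz for the weighted norm,
  a bound \<open>B\<close> for the negative part of the difference of two solutions with ordered initial data
  improves to \<open>B/2\<close> on a short time interval.\<close>

lemma sol_mono_short:
  assumes \<rho>: "1 \<le> \<rho>" "\<rho> \<le> 2" and g: "sol \<rho> g" and h: "sol \<rho> h"
    and le: "conf_le (g 0) (h 0)" and t: "0 \<le> t" "t \<le> T1"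
  shows "conf_le (g t) (h t)"
proof -
  let ?l = "C * N"
  have step: "g t i - B / 2 * \<rho> ^ nl i \<le> h t i"
    if B0: "0 \<le> B" and B: "\<And>t i. 0 \<le> t \<Longrightarrow> t \<le> T1 \<Longrightarrow> g t i - B * \<rho> ^ nl i \<le> h t i"
      and t: "0 \<le> t" "t \<le> T1" for B t i
  proof (cases "t = 0")
    case True
    have "0 \<le> B / 2 * \<rho> ^ nl i" using B0 \<rho> by simp
    moreover have "g 0 i \<le> h 0 i" using le by (simp add: conf_le_def)
    ultimately show ?thesis using True by simp
  next
    case False
    \<comment> \<open>The integrating factor supplies the diagonal term C N (h - g). With it the
      derivative of v is nonnegative up to an error controlled by B.\<close>
    define v where "v s = exp (?l * s) * (h s i - g s i)" for s
    define v' where "v' s = exp (?l * s) * (?l * (h s i - g s i) - gradW S r (h s) i + gradW S r (g s) i)" for s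
    have "(v has_real_derivative v' s) (at s)" for s
      unfolding v_def v'_def
      by (rule derivative_eq_intros solD[OF g] solD[OF h] refl | simp add: algebra_simps)+
    then obtain s where s: "0 < s" "s < t" "v t - v 0 = (t - 0) * v' s"
      using MVT2[of 0 t v v'] t False by auto
    \<comment> \<open>A configuration below h s that is within B of g s in the weighted sense:
      between m and h s the one-sided bound \<open>gradW_upper\<close> applies, between m and g s
      the Lipschitz bound.\<close>
    define m where "m = (\<lambda>k. min (g s k) (h s k))"
    have le_m: "conf_le m (h s)" by (simp add: m_def conf_le_def)
    have Bs: "g s k - B * \<rho> ^ nl k \<le> h s k" for k using B[of s k] s t by simp
    have B\<rho>: "0 \<le> B * \<rho> ^ nl k" for k using B0 \<rho> by simp
    have mk: "\<bar>m k - g s k\<bar> \<le> B * \<rho> ^ nl k" for k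
      using Bs[of k] B\<rho>[of k] by (auto simp: m_def min_def abs_if)
    have "\<bar>gradW S r m i - gradW S r (g s) i\<bar> \<le> Lw * B * \<rho> ^ nl i"
      by (rule gradW_weighted_lip[OF \<rho> mk])
    moreover have "gradW S r (h s) i - gradW S r m i \<le> ?l * (h s i - m i)"
      by (rule gradW_upper[OF le_m])
    moreover have "?l * (g s i - m i) \<le> ?l * (B * \<rho> ^ nl i)"
      using mk[of i] CN_nonneg by (intro mult_left_mono) auto
    ultimately have "- ((?l + Lw) * (B * \<rho> ^ nl i)) \<le> ?l * (h s i - g s i) - gradW S r (h s) i + gradW S r (g s) i"
      by (simp add: algebra_simps abs_le_iff)
    then have "exp (?l * s) * - ((?l + Lw) * (B * \<rho> ^ nl i)) \<le> v' s"
      unfolding v'_def by (intro mult_left_mono) auto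
    moreover have "exp (?l * s) * ((?l + Lw) * (B * \<rho> ^ nl i)) \<le> exp ?l * ((?l + Lw) * (B * \<rho> ^ nl i))"
    proof (intro mult_right_mono)
      have "?l * s \<le> ?l * 1" using s t T1_le_1 CN_nonneg by (intro mult_left_mono) auto
      then show "exp (?l * s) \<le> exp ?l" by simp
      show "0 \<le> (?l + Lw) * (B * \<rho> ^ nl i)" using CN_nonneg Lw_nonneg B\<rho>[of i] by simp
    qed
    ultimately have v's: "- (exp ?l * ((?l + Lw) * (B * \<rho> ^ nl i))) \<le> v' s" by simp
    define E where "E = exp ?l * ((?l + Lw) * (B * \<rho> ^ nl i))"
    have E0: "0 \<le> E" unfolding E_def using CN_nonneg Lw_nonneg B\<rho>[of i] by simp
    have "t * - E \<le> t * v' s" using v's t unfolding E_def by (intro mult_left_mono) auto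
    moreover have "t * E \<le> T1 * E" using t E0 by (intro mult_right_mono) auto
    moreover have "T1 * E = (T1 * (exp ?l * (?l + Lw))) * (B * \<rho> ^ nl i)" by (simp add: E_def)
    moreover have "\<dots> \<le> 1 / 2 * (B * \<rho> ^ nl i)" by (rule mult_right_mono[OF T1_le B\<rho>])
    moreover have "0 \<le> v 0" using le by (simp add: v_def conf_le_def)
    ultimately have vt: "- (B / 2 * \<rho> ^ nl i) \<le> v t" using s(3) by simp
    show ?thesis
    proof (rule ccontr)
      assume "\<not> ?thesis"
      then have neg: "h t i - g t i < - (B / 2 * \<rho> ^ nl i)" by simp
      have "1 \<le> exp (?l * t)" using CN_nonneg t by simp
      then have "exp (?l * t) * (h t i - g t i) \<le> 1 * (h t i - g t i)"
        by (rule mult_right_mono_neg) (use neg B\<rho>[of i] in simp)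
      then show False using neg vt by (simp add: v_def)
    qed
  qed
  obtain c d where c: "\<And>t i. \<bar>t\<bar> \<le> T1 \<Longrightarrow> \<bar>g t i\<bar> \<le> c * \<rho> ^ nl i"
    and d: "\<And>t i. \<bar>t\<bar> \<le> T1 \<Longrightarrow> \<bar>h t i\<bar> \<le> d * \<rho> ^ nl i"
    using sol_bound[OF g, of T1] sol_bound[OF h, of T1] by metis
  have cd: "0 \<le> c + d" using c[of 0 0] d[of 0 0] T1_pos by simp
  have "g t i - ((c + d) / 2 ^ n) * \<rho> ^ nl i \<le> h t i" if "0 \<le> t" "t \<le> T1" for n t i
    using that
  proof (induction n arbitrary: t i)
    case 0
    then show ?case using c[of t i] d[of t i] by (simp add: algebra_simps)
  next
    case (Suc n)
    show ?case using step[OF _ Suc.IH Suc.prems] cd by (simp add: field_simps)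
  qed
  then have *: "g t i - ((c + d) / 2 ^ n) * \<rho> ^ nl i \<le> h t i" for n i using t by blast
  show ?thesis unfolding conf_le_def
  proof
    fix i
    have "(\<lambda>n. g t i - ((c + d) / 2 ^ n) * \<rho> ^ nl i) \<longlonglongrightarrow> g t i - 0 * \<rho> ^ nl i"
      by (intro tendsto_intros LIMSEQ_divide_realpow_zero) auto
    then show "g t i \<le> h t i"
      using * by (intro LIMSEQ_le_const2[of "\<lambda>n. g t i - ((c + d) / 2 ^ n) * \<rho> ^ nl i"]) auto
  qed
qed

lemma sol_mono:
  assumes \<rho>: "1 \<le> \<rho>" "\<rho> \<le> 2" and "sol \<rho> g" "sol \<rho> h" "conf_le (g 0) (h 0)" "0 \<le> t"
  shows "conf_le (g t) (h t)"
proof -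
  have *: "conf_le (g t) (h t)" if "0 \<le> t" "t \<le> real m * T1" "sol \<rho> g" "sol \<rho> h" "conf_le (g 0) (h 0)" for g h t m
    using that
  proof (induction m arbitrary: g h t)
    case (Suc m)
    define a where "a = t / real (Suc m)"
    have a: "0 \<le> a" "a \<le> T1" using Suc.prems(1,2) by (simp_all add: a_def divide_le_eq algebra_simps)
    have ta: "t - a = real m * a" by (simp add: a_def field_simps)
    have "conf_le (g (0 + a)) (h (0 + a))"
      using sol_mono_short[OF \<rho> Suc.prems(3-5) a] by simp
    moreover have "0 \<le> t - a" "t - a \<le> real m * T1"
      unfolding ta using a by (simp_all add: mult_left_mono)
    ultimately show ?case
      using Suc.IH[OF _ _ sol_shift[OF Suc.prems(3)] sol_shift[OF Suc.prems(4)], of "t - a" a a] by simp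
  qed simp
  obtain m where "t \<le> real m * T1"
    using reals_Archimedean3[OF T1_pos] less_imp_le by blast
  then show ?thesis using * assms by blast
qed

lemma gradW_zero: "gradW S r (\<lambda>_. 0) i = gradW S r (\<lambda>_. 0) 0"
  using gradW_tau[of i 0 "\<lambda>_. 0" 0] by (simp add: tau_def)

lemma gradW_growth:
  assumes \<rho>: "1 \<le> \<rho>" "\<rho> \<le> 2" and "\<And>k. \<bar>x k\<bar> \<le> B * \<rho> ^ nl k"
  shows "\<bar>gradW S r x i\<bar> \<le> (\<bar>gradW S r (\<lambda>_. 0) 0\<bar> + Lw * B) * \<rho> ^ nl i"
proof -
  have "\<bar>gradW S r x i - gradW S r (\<lambda>_. 0) i\<bar> \<le> Lw * B * \<rho> ^ nl i"
    by (rule gradW_weighted_lip[OF \<rho>]) (use assms(3) in simp)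
  moreover have "\<bar>gradW S r (\<lambda>_. 0) 0\<bar> * 1 \<le> \<bar>gradW S r (\<lambda>_. 0) 0\<bar> * \<rho> ^ nl i"
    using one_le_power[OF \<rho>(1)] by (intro mult_left_mono) auto
  ultimately show ?thesis using gradW_zero[of i] by (simp add: algebra_simps)
qed

text \<open>Division by (3/2)^\<open>nl i\<close> identifies the tame configurations with the
  bounded functions on the lattice, where the gradient becomes a globally Lipschitz vector field
  with constant \<open>Lw\<close>.\<close>

lemma sol_exists:
  assumes "tame x" obtains g where "sol (3/2) g" "g 0 = x"
proof -
  let ?\<rho> = "3/2 :: real"
  have \<rho>: "1 \<le> ?\<rho>" "?\<rho> \<le> 2" by auto
  obtain c where c: "\<And>i. \<bar>x i\<bar> \<le> c * ?\<rho> ^ nl i" using assms by (auto simp: tame_def)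
  have bc: "f \<in> bcontfun" if "\<And>i. \<bar>f i\<bar> \<le> B" for f :: "int ^ 'd \<Rightarrow> real" and B
    using that by (auto simp: bcontfun_def continuous_on_lattice bounded_iff)
  define up where "up h = (\<lambda>i. ?\<rho> ^ nl i * apply_bcontfun h i)" for h :: "(int ^ 'd) \<Rightarrow>\<^sub>C real"
  define V where "V h = (\<lambda>i. - gradW S r (up h) i / ?\<rho> ^ nl i)" for h
  have up_diff: "\<bar>up h i - up h' i\<bar> \<le> norm (h - h') * ?\<rho> ^ nl i" for h h' i
  proof -
    have "\<bar>up h i - up h' i\<bar> = ?\<rho> ^ nl i * \<bar>h i - h' i\<bar>"
      by (simp add: up_def abs_mult flip: right_diff_distrib)
    also have "\<dots> \<le> ?\<rho> ^ nl i * norm (h - h')"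
      using dist_bounded[of h i h'] by (intro mult_left_mono) (auto simp: dist_norm)
    finally show ?thesis by (simp add: mult.commute)
  qed
  have Vbc: "V h \<in> bcontfun" for h
  proof (rule bc)
    fix i
    have "\<bar>gradW S r (up h) i\<bar> \<le> (\<bar>gradW S r (\<lambda>_. 0) 0\<bar> + Lw * norm h) * ?\<rho> ^ nl i"
      by (rule gradW_growth[OF \<rho>]) (use up_diff[of h _ 0] in \<open>simp add: up_def\<close>)
    then show "\<bar>V h i\<bar> \<le> \<bar>gradW S r (\<lambda>_. 0) 0\<bar> + Lw * norm h"
      by (simp add: V_def abs_divide divide_le_eq)
  qed
  define F where "F h = Bcontfun (V h)" for h
  have F: "apply_bcontfun (F h) = V h" for h
    unfolding F_def by (rule Bcontfun_inverse[OF Vbc])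
  have "norm (F h - F h') \<le> Lw * norm (h - h')" for h h'
  proof -
    have "dist (F h) (F h') \<le> Lw * norm (h - h')"
    proof (rule dist_bound)
      fix i
      have "\<bar>gradW S r (up h') i - gradW S r (up h) i\<bar> \<le> Lw * norm (h - h') * ?\<rho> ^ nl i"
        by (rule gradW_weighted_lip[OF \<rho>]) (use up_diff[of h _ h'] in \<open>simp add: abs_minus_commute\<close>)
      then show "dist (F h i) (F h' i) \<le> Lw * norm (h - h')"
        by (simp add: F V_def dist_real_def abs_divide divide_le_eq flip: diff_divide_distrib)
    qed
    then show ?thesis by (simp add: dist_norm)
  qed
  then obtain G where G: "G 0 = Bcontfun (\<lambda>i. x i / ?\<rho> ^ nl i)" "\<And>t. (G has_vector_derivative F (G t)) (at t)"
    using lipschitz_ode_solution[of F Lw] by blast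
  define g where "g t = up (G t)" for t
  have "(\<lambda>i. x i / ?\<rho> ^ nl i) \<in> bcontfun"
    by (rule bc[of _ c]) (use c in \<open>simp add: abs_divide divide_le_eq\<close>)
  then have "g 0 = x" by (auto simp: g_def up_def G(1) Bcontfun_inverse)
  moreover have "sol ?\<rho> g"
    unfolding sol_def
  proof (intro conjI allI)
    fix t i
    have "bounded_linear (\<lambda>h :: (int ^ 'd) \<Rightarrow>\<^sub>C real. ?\<rho> ^ nl i * h i)"
    proof (rule bounded_linear_intro[of _ "?\<rho> ^ nl i"])
      fix h :: "(int ^ 'd) \<Rightarrow>\<^sub>C real"
      show "norm (?\<rho> ^ nl i * h i) \<le> norm h * ?\<rho> ^ nl i"
        using norm_bounded[of h i] by (simp add: abs_mult)
    qed (auto simp: algebra_simps)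
    from bounded_linear.has_vector_derivative[OF this G(2)[of t]]
    have "((\<lambda>s. g s i) has_vector_derivative ?\<rho> ^ nl i * V (G t) i) (at t)"
      by (simp add: g_def up_def F)
    moreover have "?\<rho> ^ nl i * V (G t) i = - gradW S r (g t) i" by (simp add: V_def g_def)
    ultimately show "((\<lambda>s. g s i) has_real_derivative - gradW S r (g t) i) (at t)"
      by (simp add: has_real_derivative_iff_has_vector_derivative)
  next
    fix T
    have "continuous_on {-T..T} G"
      using G(2) has_vector_derivative_continuous by (blast intro: continuous_at_imp_continuous_on)
    then have "bounded (G ` {-T..T})" by (intro compact_imp_bounded compact_continuous_image) auto
    then obtain B where B: "\<And>t. t \<in> {-T..T} \<Longrightarrow> norm (G t) \<le> B" unfolding bounded_iff by blast
    have "\<bar>g t i\<bar> \<le> B * ?\<rho> ^ nl i" if "\<bar>t\<bar> \<le> T" for t i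
    proof -
      have "\<bar>g t i\<bar> \<le> norm (G t) * ?\<rho> ^ nl i"
        using up_diff[of "G t" i 0] by (simp add: up_def g_def)
      moreover have "t \<in> {-T..T}" using that by auto
      then have "norm (G t) * ?\<rho> ^ nl i \<le> B * ?\<rho> ^ nl i" by (intro mult_right_mono B) auto
      ultimately show ?thesis by linarith
    qed
    then show "\<exists>c. \<forall>t i. \<bar>t\<bar> \<le> T \<longrightarrow> \<bar>g t i\<bar> \<le> c * ?\<rho> ^ nl i" by blast
  qed
  ultimately show thesis by (intro that)
qed

text \<open>On bounded time intervals coordinate i is Lipschitz in t with constant D
  (3/2)^\<open>nl i\<close>. These constants are summable against the weights of
  \<open>normX\<close>, which gives continuity in that norm.\<close>

lemma flowline_of_sol:
  assumes g: "sol (3/2) g" shows "flowline S r g"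
  unfolding flowline_def
proof (intro conjI allI)
  let ?\<rho> = "3/2 :: real"
  have \<rho>: "1 \<le> ?\<rho>" "?\<rho> \<le> 2" by auto
  fix t
  obtain c where c: "\<And>s i. \<bar>s\<bar> \<le> \<bar>t\<bar> + 1 \<Longrightarrow> \<bar>g s i\<bar> \<le> c * ?\<rho> ^ nl i"
    using sol_bound[OF g] by blast
  show "inX (g t)" by (rule normX_bound(1)[of _ c]) (rule c, simp)
  define D where "D = \<bar>gradW S r (\<lambda>_. 0) 0\<bar> + Lw * c"
  have bnd: "\<bar>g s i - g t i\<bar> \<le> (D * \<bar>s - t\<bar>) * ?\<rho> ^ nl i" if s: "\<bar>s - t\<bar> \<le> 1" for s i
  proof -
    have "norm (g s i - g t i) \<le> (D * ?\<rho> ^ nl i) * norm (s - t)"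
    proof (rule field_differentiable_bound[of "{t - 1..t + 1}" "\<lambda>s. g s i"])
      fix u assume u: "u \<in> {t - 1..t + 1}"
      show "((\<lambda>s. g s i) has_field_derivative - gradW S r (g u) i) (at u within {t - 1..t + 1})"
        by (rule DERIV_subset[OF solD[OF g]]) simp
      have "\<bar>gradW S r (g u) i\<bar> \<le> D * ?\<rho> ^ nl i"
        unfolding D_def by (rule gradW_growth[OF \<rho> c]) (use u in \<open>auto simp: abs_le_iff abs_if\<close>)
      then show "norm (- gradW S r (g u) i) \<le> D * ?\<rho> ^ nl i" by simp
    qed (use s in \<open>auto simp: abs_le_iff\<close>)
    then show ?thesis by (simp add: mult_ac)
  qed
  show "((\<lambda>s. normX (\<lambda>i. g s i - g t i)) \<longlongrightarrow> 0) (at t)"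
  proof (rule tendsto_sandwich[of "\<lambda>_. 0" _ _ "\<lambda>s. (D * \<bar>s - t\<bar>) * geosum TYPE('d)"])
    have ev: "\<forall>\<^sub>F s in at t. \<bar>s - t\<bar> \<le> 1"
      unfolding eventually_at by (rule exI[of _ 1]) (auto simp: dist_real_def)
    show "\<forall>\<^sub>F s in at t. 0 \<le> normX (\<lambda>i. g s i - g t i)"
      using ev by eventually_elim (rule normX_bound(3), rule bnd)
    show "\<forall>\<^sub>F s in at t. normX (\<lambda>i. g s i - g t i) \<le> (D * \<bar>s - t\<bar>) * geosum TYPE('d)"
      using ev by eventually_elim (rule normX_bound(2), rule bnd)
    have "((\<lambda>s. (D * \<bar>s - t\<bar>) * geosum TYPE('d)) \<longlongrightarrow> (D * \<bar>t - t\<bar>) * geosum TYPE('d)) (at t)"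
      by (intro tendsto_intros)
    then show "((\<lambda>s. (D * \<bar>s - t\<bar>) * geosum TYPE('d)) \<longlongrightarrow> 0) (at t)" by simp
  qed simp
qed (rule solD[OF g])

text \<open>Continuity in \<open>normX\<close> bounds the norm on compact time intervals, and a
  single coordinate is at most 2^\<open>nl i\<close> times the norm. This is where the weight 2
  comes from.\<close>

lemma sol_of_flowline:
  assumes g: "flowline S r g" shows "sol 2 g"
  unfolding sol_def
proof (intro conjI allI)
  fix T
  have X: "inX (g t)" for t using g by (simp add: flowline_def)
  have "isCont (\<lambda>t. normX (g t)) t" for t
    unfolding isCont_def
  proof (rule Lim_null[THEN iffD2], rule tendsto_rabs_zero_cancel, rule tendsto_sandwich)
    show "\<forall>\<^sub>F s in at t. 0 \<le> \<bar>normX (g s) - normX (g t)\<bar>" by simp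
    show "\<forall>\<^sub>F s in at t. \<bar>normX (g s) - normX (g t)\<bar> \<le> normX (\<lambda>i. g s i - g t i)"
    proof (rule always_eventually, rule allI)
      fix s
      show "\<bar>normX (g s) - normX (g t)\<bar> \<le> normX (\<lambda>i. g s i - g t i)"
        using normX_triangle[OF X[of s] X[of t]] normX_triangle[OF X[of t] X[of s]]
          normX_commute[of "g s" "g t"] by linarith
    qed
    show "((\<lambda>s. normX (\<lambda>i. g s i - g t i)) \<longlongrightarrow> 0) (at t)" using g by (simp add: flowline_def)
  qed simp
  then have "continuous_on {-T..T} (\<lambda>t. normX (g t))"
    by (intro continuous_at_imp_continuous_on) auto
  then have "bounded ((\<lambda>t. normX (g t)) ` {-T..T})"
    by (intro compact_imp_bounded compact_continuous_image) auto
  then obtain B where "\<forall>u\<in>(\<lambda>t. normX (g t)) ` {-T..T}. norm u \<le> B" unfolding bounded_iff by blast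
  then have B: "\<bar>normX (g t)\<bar> \<le> B" if "t \<in> {-T..T}" for t using that by auto
  have "\<bar>g t i\<bar> \<le> B * 2 ^ nl i" if "\<bar>t\<bar> \<le> T" for t i
  proof -
    have "\<bar>g t i\<bar> \<le> normX (g t) * 2 ^ nl i" by (rule le_normX[OF X])
    also have "\<dots> \<le> B * 2 ^ nl i" using B[of t] that by (intro mult_right_mono) (auto simp: abs_le_iff)
    finally show ?thesis .
  qed
  then show "\<exists>c. \<forall>t i. \<bar>t\<bar> \<le> T \<longrightarrow> \<bar>g t i\<bar> \<le> c * 2 ^ nl i" by blast
qed (use g in \<open>simp add: flowline_def\<close>)

section \<open>The flow on tame configurations\<close>

abbreviation \<Phi> :: "real \<Rightarrow> 'd conf \<Rightarrow> 'd conf" where "\<Phi> \<equiv> Psi S r"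

text \<open>The description operator in \<open>Psi\<close> ranges over all flowlines, so uniqueness
  has to be used in the larger class with \<rho> = 2.\<close>

lemma Psi_eq:
  assumes "sol (3/2) g" shows "\<Phi> t (g 0) = g t"
proof -
  have "(THE h. flowline S r h \<and> h 0 = g 0) = g"
  proof (rule the_equality)
    show "flowline S r g \<and> g 0 = g 0" using flowline_of_sol[OF assms] by simp
    show "h = g" if "flowline S r h \<and> h 0 = g 0" for h
      by (rule sol_unique[of 2]) (use that sol_of_flowline flowline_of_sol[OF assms] in auto)
  qed
  then show ?thesis by (simp add: Psi_def)
qed

lemma
  assumes "tame x"
  shows Psi_sol: "sol (3/2) (\<lambda>t. \<Phi> t x)" and Psi_0: "\<Phi> 0 x = x"
proof -
  obtain g where g: "sol (3/2) g" "g 0 = x" using sol_exists[OF assms] .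
  then have *: "(\<lambda>t. \<Phi> t x) = g" using Psi_eq[OF g(1)] by auto
  show "sol (3/2) (\<lambda>t. \<Phi> t x)" unfolding * by (rule g(1))
  show "\<Phi> 0 x = x" using Psi_eq[OF g(1), of 0] g(2) by simp
qed

lemma Psi_deriv: "tame x \<Longrightarrow> ((\<lambda>t. \<Phi> t x i) has_real_derivative - gradW S r (\<Phi> t x) i) (at t)"
  by (rule solD[OF Psi_sol])

lemma Psi_continuous: "tame x \<Longrightarrow> isCont (\<lambda>t. \<Phi> t x i) t"
  using Psi_deriv DERIV_isCont by blast

lemma tame_Psi: "tame x \<Longrightarrow> tame (\<Phi> t x)"
  unfolding tame_def using sol_bound[OF Psi_sol, of x "\<bar>t\<bar>"] by (auto simp: tame_def)

lemma Psi_add: "tame x \<Longrightarrow> \<Phi> s (\<Phi> t x) = \<Phi> (s + t) x"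
  using Psi_eq[OF sol_shift[OF Psi_sol], of x s t] by simp

lemma Psi_tau: "tame x \<Longrightarrow> \<Phi> t (tau k l x) = tau k l (\<Phi> t x)"
  using Psi_eq[OF sol_tau[OF Psi_sol], of x t k l] by (simp add: Psi_0)

lemma Psi_mono: "tame x \<Longrightarrow> tame y \<Longrightarrow> conf_le x y \<Longrightarrow> 0 \<le> t \<Longrightarrow> conf_le (\<Phi> t x) (\<Phi> t y)"
  by (rule sol_mono[of "3/2" "\<lambda>t. \<Phi> t x" "\<lambda>t. \<Phi> t y"]) (auto intro: Psi_sol simp: Psi_0)

lemma Psi_stationary:
  assumes "tame x" "\<And>i. gradW S r x i = 0" shows "\<Phi> t x = x"
proof -
  have "sol (3/2) (\<lambda>t. x)" using assms by (simp add: sol_def tame_def)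
  then show ?thesis using Psi_eq by blast
qed

lemma stationary_of_Psi:
  assumes x: "tame x" and eq: "\<And>t. 0 \<le> t \<Longrightarrow> t < e \<Longrightarrow> \<Phi> t x = x" and e: "e > 0"
  shows "gradW S r x i = 0"
proof -
  have "((\<lambda>t. \<Phi> t x i) has_real_derivative - gradW S r x i) (at 0 within {0..<e})"
    using DERIV_subset[OF Psi_deriv[OF x, of i 0]] Psi_0[OF x] by simp
  moreover have "((\<lambda>t. \<Phi> t x i) has_real_derivative 0) (at 0 within {0..<e})"
  proof (rule has_field_derivative_transform_within[of "\<lambda>t. x i" 0 0 "{0..<e}" e])
    show "x i = \<Phi> t x i" if "t \<in> {0..<e}" for t using eq[of t] that by simp
  qed (use e in auto)
  moreover have "at (0 :: real) within {0..<e} \<noteq> bot"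
  proof -
    have "(0 :: real) islimpt {0<..<e}" by (rule islimpt_greaterThanLessThan1[OF e])
    then have "(0 :: real) islimpt {0..<e}" by (rule islimpt_subset) auto
    then show ?thesis by (simp add: trivial_limit_within)
  qed
  ultimately have "- gradW S r x i = 0"
    unfolding has_real_derivative_iff_has_vector_derivative by (intro vector_derivative_unique_within)
  then show ?thesis by simp
qed

text \<open>If the order holds at negative and positive times, a contact at time 0 is a minimum in t
  of the difference of the orbits. Hence the velocities agree at each point of contact, which is
  what \<open>touching\<close> asks for.\<close>

lemma ordered_orbits:
  assumes x: "tame x" and y: "tame y" and le: "\<And>t. conf_le (\<Phi> t x) (\<Phi> t y)" and k: "x k = y k"
  shows "x = y"
proof (rule touching)
  show "conf_le x y" using le[of 0] by (simp add: Psi_0 x y)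
  fix i assume i: "x i = y i"
  have "((\<lambda>t. \<Phi> t y i - \<Phi> t x i) has_real_derivative (- gradW S r y i - - gradW S r x i)) (at 0)"
    using DERIV_diff[OF Psi_deriv[OF y, of i 0] Psi_deriv[OF x, of i 0]] by (simp add: Psi_0 x y)
  from DERIV_local_min[OF this, of 1] show "gradW S r x i = gradW S r y i"
    using le i by (simp add: Psi_0 x y conf_le_def)
qed (rule k)

lemma tame_of_linear_growth:
  assumes u: "\<And>i. \<bar>u i\<bar> \<le> c * (1 + real (nl i))" shows "tame (u :: 'd conf)"
proof -
  have c0: "0 \<le> c" using order_trans[OF abs_ge_zero u[of 0]] by simp
  have "1 + real n \<le> 2 * (3/2) ^ n" for n
    using Bernoulli_inequality[of "1 / 2 :: real" n] by simp
  then have "c * (1 + real (nl i)) \<le> 2 * c * (3/2) ^ nl i" for i :: "int ^ 'd"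
    using mult_left_mono[OF _ c0, of "1 + real (nl i)" "2 * (3/2) ^ nl i"] by (simp only: mult_ac)
  then show ?thesis unfolding tame_def using order_trans[OF u] by blast
qed

text \<open>A common linear growth bound turns pointwise convergence into convergence in the norm
  with weight (3/2)^\<open>nl i\<close>: far sites are small by the bound, and only finitely many
  remain. In that norm \<open>sol_close\<close> gives continuity.\<close>

lemma Psi_tendsto:
  assumes bnd: "\<And>n i. \<bar>z n i\<bar> \<le> c * (1 + real (nl i))" and lim: "z \<longlonglongrightarrow> x"
  shows "(\<lambda>n. \<Phi> t (z n)) \<longlonglongrightarrow> \<Phi> t x"
proof -
  let ?\<rho> = "3/2 :: real"
  have \<rho>: "1 \<le> ?\<rho>" "?\<rho> \<le> 2" by auto
  have limi: "(\<lambda>n. z n i) \<longlonglongrightarrow> x i" for i using lim by (simp add: tendsto_conf_iff)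
  have bx: "\<bar>x i\<bar> \<le> c * (1 + real (nl i))" for i
    by (rule LIMSEQ_le_const2[OF tendsto_rabs[OF limi]]) (use bnd in blast)
  have c0: "0 \<le> c" using bx[of 0] by simp
  note tame = tame_of_linear_growth[where c = c]
  obtain m where m: "\<bar>t\<bar> \<le> real m * T0"
    using reals_Archimedean3[OF T0_pos] less_imp_le by blast
  have zeros: "(\<lambda>n. 2 * c * (1 + real n) / ?\<rho> ^ n) \<longlonglongrightarrow> 0"
  proof -
    have "(\<lambda>n. 2 * c * ((1 / ?\<rho>) ^ n + real n * (1 / ?\<rho>) ^ n)) \<longlonglongrightarrow> 2 * c * (0 + 0)"
      by (intro tendsto_intros LIMSEQ_realpow_zero) (use powser_times_n_limit_0[of "1 / ?\<rho>"] in auto)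
    then show ?thesis by (simp add: power_divide field_simps)
  qed
  have close: "\<forall>\<^sub>F n in sequentially. \<forall>i. \<bar>z n i - x i\<bar> \<le> e * ?\<rho> ^ nl i" if e: "e > 0" for e
  proof -
    obtain K where K: "\<And>k. k \<ge> K \<Longrightarrow> 2 * c * (1 + real k) / ?\<rho> ^ k < e"
      using order_tendstoD(2)[OF zeros e] unfolding eventually_sequentially by blast
    have "finite {i :: int ^ 'd. nl i < K}"
      by (rule finite_subset[OF _ finite_lnorm_le[of "int K"]]) auto
    moreover have "\<forall>\<^sub>F n in sequentially. \<bar>z n i - x i\<bar> < e" for i
      using tendstoD[OF limi e] by (simp add: dist_real_def)
    ultimately have "\<forall>\<^sub>F n in sequentially. \<forall>i\<in>{i. nl i < K}. \<bar>z n i - x i\<bar> < e"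
      by (intro eventually_ball_finite) auto
    then show ?thesis
    proof eventually_elim
      case (elim n)
      show ?case
      proof
        fix i
        show "\<bar>z n i - x i\<bar> \<le> e * ?\<rho> ^ nl i"
        proof (cases "nl i < K")
          case True
          then have "\<bar>z n i - x i\<bar> < e" using elim by simp
          moreover have "e * 1 \<le> e * ?\<rho> ^ nl i" using e by (intro mult_left_mono) auto
          ultimately show ?thesis by simp
        next
          case False
          then have "2 * c * (1 + real (nl i)) / ?\<rho> ^ nl i < e" by (intro K) simp
          then have "2 * c * (1 + real (nl i)) \<le> e * ?\<rho> ^ nl i"
            by (simp add: divide_less_eq)
          then show ?thesis using bnd[of n i] bx[of i] by linarith
        qed
      qed
    qed
  qed
  show ?thesis
  proof (subst tendsto_conf_iff, rule allI, rule tendstoI)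
    fix i :: "int ^ 'd" and e :: real assume e: "e > 0"
    define e' where "e' = e / (2 * 2 ^ m * ?\<rho> ^ nl i)"
    have "e' > 0" using e by (simp add: e'_def)
    from close[OF this] show "\<forall>\<^sub>F n in sequentially. dist (\<Phi> t (z n) i) (\<Phi> t x i) < e"
    proof eventually_elim
      case (elim n)
      have "\<bar>\<Phi> t (z n) i - \<Phi> t x i\<bar> \<le> 2 ^ m * e' * ?\<rho> ^ nl i"
        by (rule sol_close[OF \<rho> Psi_sol Psi_sol _ m])
          (use elim tame[OF bnd] tame[OF bx] in \<open>simp_all add: Psi_0\<close>)
      also have "\<dots> = e / 2" by (simp add: e'_def)
      finally show ?case using e by (simp add: dist_real_def)
    qed
  qed
qed

end

section \<open>Sums modulo the resonance lattice\<close>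

definition resonant_shift :: "real ^ 'd \<Rightarrow> int ^ 'd \<Rightarrow> bool" where
  "resonant_shift w k \<longleftrightarrow> (\<exists>l. ipair w k + real_of_int l = 0)"

text \<open>A choice of one representative per coset of the resonance lattice: the predicate depends
  on i only through its coset, so \<open>rep w\<close> is constant on cosets.\<close>

definition rep :: "real ^ 'd \<Rightarrow> int ^ 'd \<Rightarrow> int ^ 'd" where
  "rep w i = (SOME k. resonant_shift w (k - i))"

lemma resonant_shift_0 [simp]: "resonant_shift w 0"
  unfolding resonant_shift_def by (rule exI[of _ 0]) simp

lemma resonant_shift_minus: "resonant_shift w k \<Longrightarrow> resonant_shift w (- k)"
  unfolding resonant_shift_def ipair_minus by (metis add.inverse_inverse add.inverse_neutral minus_add_distrib of_int_minus)

lemma resonant_shift_add: "resonant_shift w k \<Longrightarrow> resonant_shift w k' \<Longrightarrow> resonant_shift w (k + k')"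
proof -
  assume "resonant_shift w k" "resonant_shift w k'"
  then obtain l l' where "ipair w k + real_of_int l = 0" "ipair w k' + real_of_int l' = 0"
    by (auto simp: resonant_shift_def)
  then have "ipair w (k + k') + real_of_int (l + l') = 0" by (simp add: ipair_add)
  then show ?thesis unfolding resonant_shift_def by blast
qed

lemma rep_resonant: "resonant_shift w (rep w i - i)"
  unfolding rep_def by (rule someI[of _ i]) simp

lemma rep_eq_iff: "rep w i = rep w j \<longleftrightarrow> resonant_shift w (i - j)"
proof
  assume "rep w i = rep w j"
  then show "resonant_shift w (i - j)"
    using resonant_shift_add[OF rep_resonant[of w j] resonant_shift_minus[OF rep_resonant[of w i]]] by simp
next
  assume *: "resonant_shift w (i - j)"
  have "resonant_shift w (k - i) = resonant_shift w (k - j)" for k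
    using resonant_shift_add[OF _ *, of "k - i"] resonant_shift_add[OF _ resonant_shift_minus[OF *], of "k - j"]
    by auto
  then show "rep w i = rep w j" by (simp add: rep_def)
qed

lemma rep_rep [simp]: "rep w (rep w i) = rep w i"
  by (simp add: rep_eq_iff rep_resonant)

text \<open>Translation permutes the cosets of the resonance lattice. Sums of invariant functions
  over \<open>Dom w\<close> are therefore translation invariant, as sums of periodic functions over
  a cell are.\<close>

lemma bij_rep_shift: "bij_betw (\<lambda>i. rep w (i + m)) (range (rep w)) (range (rep w))"
proof (rule bij_betwI[of _ _ _ "\<lambda>i. rep w (i - m)"])
  fix i assume "i \<in> range (rep w)"
  then have i: "rep w i = i" by auto
  have "rep w (rep w (i + m) - m) = rep w i" "rep w (rep w (i - m) + m) = rep w i"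
    using rep_resonant[of w "i + m"] rep_resonant[of w "i - m"] by (simp_all add: rep_eq_iff algebra_simps)
  then show "rep w (rep w (i + m) - m) = i" "rep w (rep w (i - m) + m) = i" using i by auto
qed auto

definition invariant :: "real ^ 'd \<Rightarrow> (int ^ 'd \<Rightarrow> 'b) \<Rightarrow> bool" where
  "invariant w f \<longleftrightarrow> (\<forall>j k. resonant_shift w k \<longrightarrow> f (j + k) = f j)"

lemma invariant_rep: "invariant w f \<Longrightarrow> f (rep w i) = f i"
  using rep_resonant[of w i] unfolding invariant_def by (metis add.commute diff_add_cancel)

lemma invariant_shift: "invariant w f \<Longrightarrow> invariant w (\<lambda>j. f (j + m))"
  unfolding invariant_def by (metis add.commute add.left_commute)

abbreviation Dom :: "real ^ 'd \<Rightarrow> (int ^ 'd) set" where "Dom w \<equiv> range (rep w)"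

lemma
  fixes f :: "int ^ 'd \<Rightarrow> real"
  assumes f: "invariant w f"
  shows summable_shift: "f summable_on Dom w \<Longrightarrow> (\<lambda>i. f (i + m)) summable_on Dom w"
    and infsum_shift: "infsum (\<lambda>i. f (i + m)) (Dom w) = infsum f (Dom w)"
proof -
  have *: "(\<lambda>i. f (i + m)) = (\<lambda>i. f (rep w (i + m)))" using invariant_rep[OF f] by simp
  show "f summable_on Dom w \<Longrightarrow> (\<lambda>i. f (i + m)) summable_on Dom w"
    unfolding * using summable_on_reindex_bij_betw[OF bij_rep_shift, of f w m] by simp
  show "infsum (\<lambda>i. f (i + m)) (Dom w) = infsum f (Dom w)"
    unfolding * using infsum_reindex_bij_betw[OF bij_rep_shift, of f w m] by simp
qed

lemma summable_bound:
  fixes f g :: "'a \<Rightarrow> real"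
  assumes "g summable_on A" "\<And>x. x \<in> A \<Longrightarrow> \<bar>f x\<bar> \<le> g x"
  shows "f summable_on A"
proof (rule abs_summable_summable)
  show "(\<lambda>x. norm (f x)) summable_on A"
    by (rule summable_on_comparison_test[OF assms(1)]) (use assms(2) in auto)
qed

lemma infsum_abs_le:
  fixes f g :: "'a \<Rightarrow> real"
  assumes "g summable_on A" "\<And>x. x \<in> A \<Longrightarrow> \<bar>f x\<bar> \<le> g x"
  shows "\<bar>infsum f A\<bar> \<le> infsum g A"
proof -
  have f: "f summable_on A" by (rule summable_bound[OF assms])
  have "infsum f A \<le> infsum g A"
    by (rule infsum_mono[OF f assms(1)]) (use assms(2) in \<open>auto simp: abs_le_iff\<close>)
  moreover have "- infsum f A \<le> infsum g A"
    unfolding infsum_uminus[symmetric]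
    by (rule infsum_mono[OF _ assms(1)]) (use f assms(2) in \<open>auto simp: abs_le_iff summable_on_uminus\<close>)
  ultimately show ?thesis by linarith
qed

lemma infsum_sum_real:
  fixes f :: "'b \<Rightarrow> 'a \<Rightarrow> real"
  assumes "finite I" "\<And>i. i \<in> I \<Longrightarrow> f i summable_on A"
  shows "infsum (\<lambda>x. \<Sum>i\<in>I. f i x) A = (\<Sum>i\<in>I. infsum (f i) A)"
    and "(\<lambda>x. \<Sum>i\<in>I. f i x) summable_on A"
proof -
  have "((\<lambda>x. \<Sum>i\<in>I. f i x) has_sum (\<Sum>i\<in>I. infsum (f i) A)) A"
    using assms
  proof (induction I rule: finite_induct)
    case (insert i I)
    then show ?case by (simp add: has_sum_add)
  qed simp
  then show "infsum (\<lambda>x. \<Sum>i\<in>I. f i x) A = (\<Sum>i\<in>I. infsum (f i) A)"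
    and "(\<lambda>x. \<Sum>i\<in>I. f i x) summable_on A"
    by (auto simp: infsumI has_sum_imp_summable)
qed

lemma infsum_tendsto_dominated:
  fixes f :: "nat \<Rightarrow> 'a \<Rightarrow> real"
  assumes g: "g summable_on A" and bnd: "\<And>n x. x \<in> A \<Longrightarrow> \<bar>f n x\<bar> \<le> g x"
    and lim: "\<And>x. x \<in> A \<Longrightarrow> (\<lambda>n. f n x) \<longlonglongrightarrow> h x"
  shows "(\<lambda>n. infsum (f n) A) \<longlonglongrightarrow> infsum h A"
proof (rule tendstoI)
  fix e :: real assume e: "e > 0"
  have bh: "\<bar>h x\<bar> \<le> g x" if "x \<in> A" for x
    by (rule LIMSEQ_le_const2[OF tendsto_rabs[OF lim[OF that]]]) (use bnd[OF that] in blast)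
  have "((\<lambda>F. sum g F) \<longlongrightarrow> infsum g A) (finite_subsets_at_top A)"
    using g by (rule infsum_tendsto)
  from tendstoD[OF this, of "e / 4"] e obtain F where F: "finite F" "F \<subseteq> A" "dist (sum g F) (infsum g A) < e / 4"
    unfolding eventually_finite_subsets_at_top by auto
  have tail: "\<bar>infsum u A - sum u F\<bar> \<le> e / 4" if u: "\<And>x. x \<in> A \<Longrightarrow> \<bar>u x\<bar> \<le> g x" for u
  proof -
    have us: "u summable_on A" by (rule summable_bound[OF g u])
    have sub: "v summable_on A - F" if "v summable_on A" for v :: "'a \<Rightarrow> real"
      by (rule summable_on_subset_banach[OF that]) auto
    have split: "infsum v A = sum v F + infsum v (A - F)" if "v summable_on A" for v :: "'a \<Rightarrow> real"
    proof -
      have "infsum v (F \<union> (A - F)) = infsum v F + infsum v (A - F)"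
        by (rule infsum_Un_disjoint) (use F sub[OF that] in auto)
      then show ?thesis using F by (simp add: Un_absorb1)
    qed
    have "\<bar>infsum u (A - F)\<bar> \<le> infsum g (A - F)"
      by (rule infsum_abs_le[OF sub[OF g]]) (use u in auto)
    also have "\<dots> \<le> e / 4" using split[OF g] F(3) by (simp add: dist_real_def abs_if split: if_splits)
    finally show ?thesis using split[OF us] by simp
  qed
  have "(\<lambda>n. sum (f n) F) \<longlonglongrightarrow> sum h F"
    using F(2) by (intro tendsto_sum lim) auto
  from tendstoD[OF this, of "e / 4"] e have "\<forall>\<^sub>F n in sequentially. dist (sum (f n) F) (sum h F) < e / 4" by simp
  then show "\<forall>\<^sub>F n in sequentially. dist (infsum (f n) A) (infsum h A) < e"
  proof eventually_elim
    case (elim n)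
    have "\<bar>infsum (f n) A - sum (f n) F\<bar> \<le> e / 4" by (rule tail) (rule bnd)
    moreover have "\<bar>infsum h A - sum h F\<bar> \<le> e / 4" by (rule tail) (rule bh)
    ultimately show ?case using elim e unfolding dist_real_def by linarith
  qed
qed

text \<open>The constant 3 is what membership in a chain yields: members stay within 1 of an integer
  translate of x, whose own bound is 1.\<close>

definition slope_bound :: "real ^ 'd \<Rightarrow> 'd conf \<Rightarrow> bool" where
  "slope_bound w a \<longleftrightarrow> (\<forall>i k. \<bar>a (i + k) - a i - ipair w k\<bar> \<le> 3)"

lemma slope_bound_growth:
  assumes "slope_bound w a"
  shows "\<bar>a i\<bar> \<le> (\<bar>a 0\<bar> + 3 + (\<Sum>m\<in>UNIV. \<bar>w $ m\<bar>)) * (1 + real (nl i))"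
proof -
  define W where "W = (\<Sum>m\<in>UNIV. \<bar>w $ m\<bar>)"
  have W0: "0 \<le> W" unfolding W_def by (intro sum_nonneg) auto
  have "\<bar>a (0 + i) - a 0 - ipair w i\<bar> \<le> 3" using assms unfolding slope_bound_def by blast
  moreover have "\<bar>ipair w i\<bar> \<le> W * real (nl i)" using ipair_le_lnorm[of w i] by (simp add: W_def)
  ultimately have "\<bar>a i\<bar> \<le> \<bar>a 0\<bar> + 3 + W * real (nl i)" by simp
  also have "\<dots> \<le> (\<bar>a 0\<bar> + 3 + W) * (1 + real (nl i))"
  proof -
    have "0 \<le> (\<bar>a 0\<bar> + 3) * real (nl i)" by simp
    then show ?thesis using W0 by (simp add: distrib_left distrib_right del: of_nat_nat)
  qed
  finally show ?thesis unfolding W_def .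
qed

section \<open>The energy in a gap\<close>

text \<open>The chain enters the analysis of a gap only through these facts about its end points;
  \<open>gap_sum\<close> is the summability of q - p modulo resonances, with the constant of
  \<open>gap_sum_le\<close>.\<close>

locale gap = lattice_potential S r C for S :: "'d::finite pot" and r C :: real +
  fixes w :: "real ^ 'd" and p q :: "'d conf"
  assumes stat_p: "\<And>i. gradW S r p i = 0" and stat_q: "\<And>i. gradW S r q i = 0"
    and res_p: "resonant w p" and res_q: "resonant w q"
    and le_pq: "conf_le p q" and q_le: "\<And>i. q i \<le> p i + 1"
    and slope_p: "slope_bound w p"
    and gap_sum: "\<And>F. finite F \<Longrightarrow> F \<subseteq> Dom w \<Longrightarrow> (\<Sum>i\<in>F. q i - p i) \<le> 2"
begin

definition K :: "'d conf set" where
  "K = {z. conf_le p z \<and> conf_le z q \<and> resonant w z}"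

definition a :: "int ^ 'd \<Rightarrow> real" where "a i = q i - p i"

lemma a_nonneg: "0 \<le> a i" and a_le_1: "a i \<le> 1"
  using le_pq q_le[of i] by (simp_all add: a_def conf_le_def)

lemma resonant_apply:
  assumes "resonant w z" "resonant_shift w k" obtains l where "ipair w k + real_of_int l = 0" "tau k l z = z"
  using assms unfolding resonant_def resonant_shift_def by blast

lemma invariant_a: "invariant w a"
  unfolding invariant_def
proof (intro allI impI)
  fix j k assume "resonant_shift w k"
  then obtain l where "ipair w k + real_of_int l = 0" by (auto simp: resonant_shift_def)
  then have "tau k l p j = p j" "tau k l q j = q j" using res_p res_q by (simp_all add: resonant_def)
  then show "a (j + k) = a j" by (simp add: a_def tau_def)
qed

lemma summable_a: "a summable_on Dom w"
proof (rule nonneg_bdd_above_summable_on)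
  show "bdd_above (sum a ` {F. F \<subseteq> Dom w \<and> finite F})"
    using gap_sum by (intro bdd_aboveI2[of _ _ 2]) (auto simp: a_def)
qed (rule a_nonneg)

text \<open>The dominating functions of the energy estimates. Boundedness is part of the notion so
  that a product of two of them is again summable.\<close>

definition good :: "(int ^ 'd \<Rightarrow> real) \<Rightarrow> bool" where
  "good b \<longleftrightarrow> invariant w b \<and> (\<forall>i. 0 \<le> b i) \<and> (\<exists>B. \<forall>i. b i \<le> B) \<and> b summable_on Dom w"

lemma good_a: "good a"
  using invariant_a a_nonneg a_le_1 summable_a unfolding good_def by blast

lemma good_shift: "good b \<Longrightarrow> good (\<lambda>j. b (j + m))"
  unfolding good_def using invariant_shift summable_shift by blast

lemma good_sum:
  assumes "finite I" "\<And>m. m \<in> I \<Longrightarrow> good (b m)" shows "good (\<lambda>j. \<Sum>m\<in>I. b m j)"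
proof -
  have "\<forall>m\<in>I. \<exists>B. \<forall>i. b m i \<le> B" using assms(2) by (auto simp: good_def)
  then obtain B where "\<forall>m\<in>I. \<forall>i. b m i \<le> B m" by metis
  then have "(\<Sum>m\<in>I. b m i) \<le> sum B I" for i by (intro sum_mono) auto
  moreover have "(\<lambda>j. \<Sum>m\<in>I. b m j) summable_on Dom w"
    by (rule infsum_sum_real(2)) (use assms in \<open>auto simp: good_def\<close>)
  moreover have "invariant w (\<lambda>j. \<Sum>m\<in>I. b m j)"
    using assms(2) unfolding invariant_def good_def by (auto intro!: sum.cong)
  moreover have "0 \<le> (\<Sum>m\<in>I. b m i)" for i using assms(2) by (intro sum_nonneg) (auto simp: good_def)
  ultimately show ?thesis unfolding good_def by blast
qed

lemma good_cmult: "good b \<Longrightarrow> 0 \<le> c \<Longrightarrow> good (\<lambda>j. c * b j)"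
  unfolding good_def invariant_def
  by (auto intro!: summable_on_cmult_right mult_left_mono exI[of _ "c * _"])

lemma good_mult:
  assumes b: "good b" and b': "good b'" shows "good (\<lambda>j. b j * b' j)"
proof -
  obtain B where B: "\<And>i. b' i \<le> B" using b' by (auto simp: good_def)
  obtain B' where B': "\<And>i. b i \<le> B'" using b by (auto simp: good_def)
  have nn: "\<And>i. 0 \<le> b i" "\<And>i. 0 \<le> b' i" using b b' by (auto simp: good_def)
  have "(\<lambda>j. b j * b' j) summable_on Dom w"
    by (rule summable_bound[of "\<lambda>j. b j * B"])
      (use b B nn in \<open>auto simp: good_def intro!: summable_on_cmult_left mult_left_mono\<close>)
  moreover have "b i * b' i \<le> B' * B" for i
    using B B' nn order_trans[OF nn(1) B'] by (intro mult_mono) auto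
  ultimately show ?thesis using b b' nn unfolding good_def invariant_def by auto
qed

definition spread :: "(int ^ 'd \<Rightarrow> real) \<Rightarrow> int ^ 'd \<Rightarrow> real" where
  "spread b j = (\<Sum>m\<in>lball 0 r. b (j + m))"

lemma good_spread: "good b \<Longrightarrow> good (spread b)"
  unfolding spread_def by (intro good_sum good_shift) auto

text \<open>The gradient vanishes at p, so \<open>A\<close> bounds it on all of \<open>K\<close>,
  and with it the speed of the flow; \<open>A'\<close> bounds the change of the gradient per unit of
  time.\<close>

definition A :: "int ^ 'd \<Rightarrow> real" where "A j = C * spread (spread a) j"

definition A' :: "int ^ 'd \<Rightarrow> real" where "A' j = C * spread (spread A) j"

lemma good_A: "good A" unfolding A_def using good_cmult[OF good_spread[OF good_spread[OF good_a]] C_nonneg] by simp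

lemma good_A': "good A'" unfolding A'_def using good_cmult[OF good_spread[OF good_spread[OF good_A]] C_nonneg] by simp

lemma gradW_lip_spread:
  assumes "\<And>i. \<bar>y i - z i\<bar> \<le> b i"
  shows "\<bar>gradW S r y j - gradW S r z j\<bar> \<le> C * spread (spread b) j"
proof -
  have "(\<Sum>i\<in>lball j r. \<Sum>k\<in>lball i r. \<bar>y k - z k\<bar>) \<le> (\<Sum>i\<in>lball j r. \<Sum>k\<in>lball i r. b k)"
    by (intro sum_mono assms)
  also have "\<dots> = spread (spread b) j" unfolding spread_def by (subst (1 2) sum_lball) simp
  finally show ?thesis
    using order_trans[OF gradW_lip mult_left_mono[OF _ C_nonneg]] by blast
qed

lemma K_diff: "y \<in> K \<Longrightarrow> z \<in> K \<Longrightarrow> \<bar>y i - z i\<bar> \<le> a i"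
  unfolding K_def conf_le_def a_def by (simp add: abs_le_iff) (smt (verit))

lemma p_in_K: "p \<in> K" and q_in_K: "q \<in> K"
  using res_p res_q le_pq by (auto simp: K_def)

lemma gradW_le_A: "z \<in> K \<Longrightarrow> \<bar>gradW S r z j\<bar> \<le> A j"
  using gradW_lip_spread[of z p a j] K_diff[OF _ p_in_K] stat_p by (simp add: A_def)

lemma K_bound: "z \<in> K \<Longrightarrow> \<bar>z (i + k) - z i - ipair w k\<bar> \<le> 4"
proof -
  assume "z \<in> K"
  then have "p j \<le> z j" "z j \<le> q j" for j by (auto simp: K_def conf_le_def)
  then have "p j \<le> z j \<and> z j \<le> p j + 1" for j using q_le[of j] order_trans by blast
  from this[of i] this[of "i + k"] show ?thesis
    using slope_p unfolding slope_bound_def by (smt (verit))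
qed

lemma pd_bounded: "\<exists>B. \<forall>z\<in>K. \<forall>j k. \<bar>pd k (S j) z\<bar> \<le> B"
proof -
  define M where "M = (\<Sum>i\<in>lball 0 r. 5 + \<bar>ipair w i\<bar>)"
  define B where "B = (\<Sum>m\<in>lball 0 r. \<bar>pd m (S 0) (\<lambda>_. 0)\<bar>) + C * M"
  have M0: "0 \<le> M" unfolding M_def by (intro sum_nonneg) auto
  have "\<bar>pd k (S j) z\<bar> \<le> B" if z: "z \<in> K" for z j k
  proof (cases "k - j \<in> lball 0 r")
    case True
    \<comment> \<open>By (B) the derivative may be evaluated at site 0 for a translate whose value
      there lies in [0, 1]. On the ball of radius r such translates are bounded independently of j:
      4 from \<open>K_bound\<close> and 1 from the value at 0, plus the linear part.\<close>
    define y where "y = tau j (- \<lfloor>z j\<rfloor>) z"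
    have "\<bar>y i\<bar> \<le> 5 + \<bar>ipair w i\<bar>" for i
    proof -
      have "y i = z (j + i) - z j + (z j - of_int \<lfloor>z j\<rfloor>)" by (simp add: y_def tau_def add.commute)
      moreover have "0 \<le> z j - of_int \<lfloor>z j\<rfloor>" "z j - of_int \<lfloor>z j\<rfloor> \<le> 1" by linarith+
      ultimately show ?thesis using K_bound[OF z, of j i] by linarith
    qed
    then have "(\<Sum>i\<in>lball 0 r. \<bar>y i - 0\<bar>) \<le> M" unfolding M_def by (intro sum_mono) simp
    then have "\<bar>pd (k - j) (S 0) y - pd (k - j) (S 0) (\<lambda>_. 0)\<bar> \<le> C * M"
      using order_trans[OF pd_lip mult_left_mono[OF _ C_nonneg]] by fastforce
    moreover have "\<bar>pd (k - j) (S 0) (\<lambda>_. 0)\<bar> \<le> (\<Sum>m\<in>lball 0 r. \<bar>pd m (S 0) (\<lambda>_. 0)\<bar>)"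
      by (rule member_le_sum[OF True, of "\<lambda>m. \<bar>pd m (S 0) (\<lambda>_. 0)\<bar>"]) auto
    moreover have "pd (k - j) (S 0) y = pd k (S j) z" by (simp add: y_def pd_tau)
    ultimately show ?thesis unfolding B_def by linarith
  next
    case False
    then have "pd k (S j) z = 0" by (intro pd_outside) (simp add: lball_def)
    then show ?thesis using M0 C_nonneg by (simp add: B_def sum_nonneg)
  qed
  then show ?thesis by blast
qed

definition Kb :: real where "Kb = \<bar>SOME B. \<forall>z\<in>K. \<forall>j k. \<bar>pd k (S j) z\<bar> \<le> B\<bar>"

lemma Kb: "z \<in> K \<Longrightarrow> \<bar>pd k (S j) z\<bar> \<le> Kb" and Kb_nonneg: "0 \<le> Kb"
  using someI_ex[OF pd_bounded] unfolding Kb_def by (force intro: order_trans[OF _ abs_ge_self])+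

lemma taylor_spread:
  "\<bar>S j y - S j z - (\<Sum>m\<in>lball 0 r. pd (j + m) (S j) z * (y (j + m) - z (j + m)))\<bar>
    \<le> C * (spread (\<lambda>i. \<bar>y i - z i\<bar>) j)\<^sup>2"
  using taylor[of j y z] by (simp add: sum_lball[of _ j] spread_def)

lemma linear_term_bound:
  assumes "z \<in> K" "\<And>i. \<bar>v i\<bar> \<le> b i"
  shows "\<bar>\<Sum>m\<in>lball 0 r. pd (j + m) (S j) z * v (j + m)\<bar> \<le> Kb * spread b j"
proof -
  have "\<bar>\<Sum>m\<in>lball 0 r. pd (j + m) (S j) z * v (j + m)\<bar> \<le> (\<Sum>m\<in>lball 0 r. Kb * b (j + m))"
    by (rule order_trans[OF sum_abs], rule sum_mono)
      (use Kb[OF assms(1)] assms(2) Kb_nonneg in \<open>simp add: abs_mult mult_mono\<close>)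
  then show ?thesis by (simp add: spread_def sum_distrib_left)
qed

definition bV :: "int ^ 'd \<Rightarrow> real" where "bV j = Kb * spread a j + C * (spread a j * spread a j)"

lemma summable_bV: "bV summable_on Dom w"
proof -
  note sa = good_spread[OF good_a]
  show ?thesis unfolding bV_def
    using good_cmult[OF sa Kb_nonneg] good_cmult[OF good_mult[OF sa sa] C_nonneg]
    by (intro summable_on_add) (auto simp: good_def)
qed

lemma S_diff_bound: "z \<in> K \<Longrightarrow> \<bar>S j z - S j p\<bar> \<le> bV j"
proof -
  assume z: "z \<in> K"
  have le: "spread (\<lambda>i. \<bar>z i - p i\<bar>) j \<le> spread a j" unfolding spread_def
    by (intro sum_mono K_diff z p_in_K)
  have "(spread (\<lambda>i. \<bar>z i - p i\<bar>) j)\<^sup>2 \<le> (spread a j)\<^sup>2"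
    by (rule power_mono[OF le]) (simp add: spread_def sum_nonneg)
  then have "C * (spread (\<lambda>i. \<bar>z i - p i\<bar>) j)\<^sup>2 \<le> C * (spread a j * spread a j)"
    using C_nonneg by (intro mult_left_mono) (auto simp: power2_eq_square)
  moreover have "\<bar>\<Sum>m\<in>lball 0 r. pd (j + m) (S j) p * (z (j + m) - p (j + m))\<bar> \<le> Kb * spread a j"
    by (rule linear_term_bound[OF p_in_K, of "\<lambda>i. z i - p i"]) (rule K_diff[OF z p_in_K])
  ultimately show ?thesis using taylor_spread[of j z p] unfolding bV_def by linarith
qed

definition V :: "'d conf \<Rightarrow> real" where "V z = infsum (\<lambda>j. S j z - S j p) (Dom w)"

lemma V_bounded: "z \<in> K \<Longrightarrow> \<bar>V z\<bar> \<le> infsum bV (Dom w)"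
  unfolding V_def by (rule infsum_abs_le[OF summable_bV S_diff_bound])

lemma V_tendsto:
  assumes "\<And>n. z n \<in> K" "z \<longlonglongrightarrow> x" shows "(\<lambda>n. V (z n)) \<longlonglongrightarrow> V x"
  unfolding V_def
proof (rule infsum_tendsto_dominated[OF summable_bV S_diff_bound[OF assms(1)]])
  fix j
  have "(\<lambda>n. S j (z n)) \<longlonglongrightarrow> S j x"
    using continuous_on_tendsto_compose[OF continuous_S assms(2)] by simp
  then show "(\<lambda>n. S j (z n) - S j p) \<longlonglongrightarrow> S j x - S j p" by (intro tendsto_intros)
qed

lemma resonant_gradW: "resonant w z \<Longrightarrow> invariant w (gradW S r z)"
  unfolding invariant_def by (metis resonant_apply gradW_tau)

text \<open>Summation by parts: sums of resonance-invariant functions over representatives are shift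
  invariant.\<close>

lemma infsum_linear_term:
  assumes z: "z \<in> K" and v: "invariant w v" and b: "good b" "\<And>i. \<bar>v i\<bar> \<le> b i"
  shows "infsum (\<lambda>j. \<Sum>m\<in>lball 0 r. pd (j + m) (S j) z * v (j + m)) (Dom w)
    = infsum (\<lambda>j. gradW S r z j * v j) (Dom w)"
proof -
  define g where "g m = (\<lambda>j. pd j (S (j - m)) z * v j)" for m
  have inv: "invariant w (g m)" for m
    unfolding invariant_def
  proof (intro allI impI)
    fix j k assume k: "resonant_shift w k"
    have "resonant w z" using z by (simp add: K_def)
    then obtain l where "tau k l z = z" using resonant_apply[OF _ k] by metis
    then have "pd (j + k) (S (j - m + k)) z = pd j (S (j - m)) z" using pd_tau[of j "j - m" k l z] by simp
    moreover have "v (j + k) = v j" using v k by (auto simp: invariant_def)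
    ultimately show "g m (j + k) = g m j" by (simp add: g_def algebra_simps)
  qed
  have sg: "g m summable_on Dom w" for m
    by (rule summable_bound[of "\<lambda>j. Kb * b j"])
      (use good_cmult[OF b(1) Kb_nonneg] Kb[OF z] b(2) Kb_nonneg in \<open>auto simp: good_def g_def abs_mult mult_mono\<close>)
  have "infsum (\<lambda>j. \<Sum>m\<in>lball 0 r. pd (j + m) (S j) z * v (j + m)) (Dom w)
      = infsum (\<lambda>j. \<Sum>m\<in>lball 0 r. g m (j + m)) (Dom w)" by (simp add: g_def)
  also have "\<dots> = (\<Sum>m\<in>lball 0 r. infsum (\<lambda>j. g m (j + m)) (Dom w))"
    by (rule infsum_sum_real(1)) (use summable_shift[OF inv sg] in auto)
  also have "\<dots> = (\<Sum>m\<in>lball 0 r. infsum (g m) (Dom w))" by (simp add: infsum_shift[OF inv])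
  also have "\<dots> = infsum (\<lambda>j. \<Sum>m\<in>lball 0 r. g m j) (Dom w)"
    by (rule infsum_sum_real(1)[symmetric]) (use sg in auto)
  also have "(\<lambda>j. \<Sum>m\<in>lball 0 r. g m j) = (\<lambda>j. gradW S r z j * v j)"
  proof
    fix j
    show "(\<Sum>m\<in>lball 0 r. g m j) = gradW S r z j * v j"
      unfolding gradW_def sum_lball_minus[of _ j r] g_def sum_distrib_right ..
  qed
  finally show ?thesis .
qed

end

section \<open>Decay of the energy along the flow\<close>

context gap
begin

lemma K_growth: "\<exists>c. \<forall>z\<in>K. \<forall>i. \<bar>z i\<bar> \<le> c * (1 + real (nl i))"
proof -
  define c where "c = \<bar>p 0\<bar> + 3 + (\<Sum>m\<in>UNIV. \<bar>w $ m\<bar>)"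
  have "\<bar>z i\<bar> \<le> (c + 1) * (1 + real (nl i))" if z: "z \<in> K" for z i
  proof -
    have "\<bar>p i\<bar> \<le> c * (1 + real (nl i))" unfolding c_def by (rule slope_bound_growth[OF slope_p])
    moreover have "\<bar>z i\<bar> \<le> \<bar>p i\<bar> + 1" using K_diff[OF z p_in_K, of i] a_le_1[of i] by linarith
    moreover have "0 \<le> real (nl i)" by (rule of_nat_0_le_iff)
    ultimately show ?thesis unfolding distrib_right mult_1 by linarith
  qed
  then show ?thesis by blast
qed

lemma tame_K: "z \<in> K \<Longrightarrow> tame z"
  using K_growth tame_of_linear_growth by blast

lemma K_tendsto: "(\<And>n. z n \<in> K) \<Longrightarrow> z \<longlonglongrightarrow> x \<Longrightarrow> (\<lambda>n. \<Phi> t (z n)) \<longlonglongrightarrow> \<Phi> t x"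
  using K_growth Psi_tendsto by metis

lemma Psi_resonant:
  assumes "tame z" "resonant w z" shows "resonant w (\<Phi> t z)"
  using assms unfolding resonant_def by (metis Psi_tau)

lemma Psi_in_K:
  assumes z: "z \<in> K" and t: "0 \<le> t" shows "\<Phi> t z \<in> K"
proof -
  have "\<Phi> t p = p" "\<Phi> t q = q"
    using Psi_stationary tame_K p_in_K q_in_K stat_p stat_q by blast+
  then show ?thesis
    using Psi_mono[OF tame_K[OF p_in_K] tame_K[OF z] _ t] Psi_mono[OF tame_K[OF z] tame_K[OF q_in_K] _ t]
      Psi_resonant[OF tame_K[OF z]] z by (simp add: K_def)
qed

lemma closed_K: "closed K"
proof -
  have "closed {z :: 'd conf. tau k l z = z}" for k l
    unfolding fun_eq_iff tau_def
    by (intro closed_Collect_all closed_Collect_eq continuous_intros continuous_on_product_coordinates)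
  then have "closed {z :: 'd conf. resonant w z}"
    unfolding resonant_def imp_conv_disj
    by (intro closed_Collect_all closed_Collect_disj closed_Collect_const)
  then show ?thesis unfolding K_def Collect_conj_eq
    by (intro closed_Int closed_conf_le continuous_on_const continuous_on_id)
qed

lemma displacement:
  assumes z: "z \<in> K" and s: "0 \<le> s" shows "\<bar>\<Phi> s z j - z j\<bar> \<le> s * A j"
proof -
  have "norm (\<Phi> s z j - \<Phi> 0 z j) \<le> A j * norm (s - 0)"
  proof (rule field_differentiable_bound[of "{0..s}" "\<lambda>s. \<Phi> s z j"])
    fix u assume u: "u \<in> {0..s}"
    show "((\<lambda>s. \<Phi> s z j) has_field_derivative - gradW S r (\<Phi> u z) j) (at u within {0..s})"
      by (rule DERIV_subset[OF Psi_deriv[OF tame_K[OF z]]]) simp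
    show "norm (- gradW S r (\<Phi> u z) j) \<le> A j"
      using gradW_le_A[OF Psi_in_K[OF z]] u by simp
  qed (use s in auto)
  then show ?thesis using s by (simp add: Psi_0[OF tame_K[OF z]] mult.commute)
qed

text \<open>By summation by parts the linear Taylor term is the sum of gradient times displacement.
  The displacement is - h times the gradient at an intermediate time, which differs from the initial
  one by at most h \<open>A'\<close>. Thus the energy loses h times the sum of squared gradients up
  to an error of order h^2 that is uniform on \<open>K\<close>; of the sum only one square is
  kept.\<close>

lemma energy_step:
  "\<exists>c\<ge>0. \<forall>z\<in>K. \<forall>h i. 0 < h \<longrightarrow> h \<le> 1 \<longrightarrow>
    V (\<Phi> h z) \<le> V z - h * (gradW S r z i)\<^sup>2 + c * h\<^sup>2"
proof -
  define B where "B j = spread A j * spread A j" for j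
  have gB: "good B" unfolding B_def by (intro good_mult good_spread good_A)
  have gAA': "good (\<lambda>j. A j * A' j)" by (intro good_mult good_A good_A')
  define c where "c = infsum (\<lambda>j. A j * A' j) (Dom w) + C * infsum B (Dom w)"
  have "0 \<le> c" unfolding c_def
    using C_nonneg gB good_A good_A' by (intro add_nonneg_nonneg mult_nonneg_nonneg infsum_nonneg) (auto simp: good_def)
  moreover have "V (\<Phi> h z) \<le> V z - h * (gradW S r z i)\<^sup>2 + c * h\<^sup>2"
    if z: "z \<in> K" and h: "0 < h" "h \<le> 1" for z h i
  proof -
    define y g d where "y = \<Phi> h z" and "g = gradW S r z" and "d = (\<lambda>j. y j - z j)"
    have yK: "y \<in> K" unfolding y_def using Psi_in_K[OF z] h by simp
    have tz: "tame z" by (rule tame_K[OF z])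
    have rz: "resonant w z" and ry: "resonant w y" using z yK by (auto simp: K_def)
    have dA: "\<bar>d j\<bar> \<le> h * A j" for j
      using displacement[OF z, of h j] h by (simp add: d_def y_def)
    have A0: "0 \<le> A j" for j using good_A by (simp add: good_def)
    have ig: "invariant w g" unfolding g_def by (rule resonant_gradW[OF rz])
    have gA: "\<bar>g j\<bar> \<le> A j" for j unfolding g_def by (rule gradW_le_A[OF z])
    have id: "invariant w d"
      unfolding invariant_def
    proof (intro allI impI)
      fix j k assume "resonant_shift w k"
      then obtain l where "ipair w k + real_of_int l = 0" by (auto simp: resonant_shift_def)
      then have "tau k l z j = z j" "tau k l y j = y j" using rz ry by (simp_all add: resonant_def)
      then show "d (j + k) = d j" by (simp add: d_def tau_def)
    qed
    have ghA: "good (\<lambda>j. h * A j)" using good_cmult[OF good_A] h by simp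
    define T where "T j = (\<Sum>m\<in>lball 0 r. pd (j + m) (S j) z * d (j + m))" for j
    have Tb: "\<bar>T j\<bar> \<le> Kb * spread (\<lambda>j. h * A j) j" for j
      unfolding T_def by (rule linear_term_bound[OF z dA])
    have sT: "T summable_on Dom w"
      by (rule summable_bound[OF _ Tb])
        (use good_cmult[OF good_spread[OF ghA] Kb_nonneg] in \<open>auto simp: good_def\<close>)
    have iT: "infsum T (Dom w) = infsum (\<lambda>j. g j * d j) (Dom w)"
      unfolding T_def g_def by (rule infsum_linear_term[OF z id ghA dA])
    have S_le: "S j y - S j z \<le> T j + (C * h\<^sup>2) * B j" for j
    proof -
      have "spread (\<lambda>i. \<bar>y i - z i\<bar>) j \<le> h * spread A j"
        unfolding spread_def sum_distrib_left by (rule sum_mono) (use dA in \<open>simp add: d_def\<close>)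
      then have "(spread (\<lambda>i. \<bar>y i - z i\<bar>) j)\<^sup>2 \<le> (h * spread A j)\<^sup>2"
        by (rule power_mono) (simp add: spread_def sum_nonneg)
      then have "C * (spread (\<lambda>i. \<bar>y i - z i\<bar>) j)\<^sup>2 \<le> C * (h * spread A j)\<^sup>2"
        using C_nonneg by (rule mult_left_mono)
      also have "\<dots> = (C * h\<^sup>2) * B j" by (simp add: B_def power2_eq_square)
      finally show ?thesis using taylor_spread[of j y z] unfolding T_def d_def by linarith
    qed
    have gd: "g j * d j \<le> - (h * (g j)\<^sup>2) + h\<^sup>2 * (A j * A' j)" for j
    proof -
      have "\<exists>s. 0 < s \<and> s < h \<and> \<Phi> h z j - \<Phi> 0 z j = (h - 0) * - gradW S r (\<Phi> s z) j"
        by (rule MVT2[OF h(1) Psi_deriv[OF tz]])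
      then obtain s where s: "0 < s" "s < h" "d j = - (h * gradW S r (\<Phi> s z) j)"
        by (auto simp: d_def y_def Psi_0[OF tz])
      have "\<bar>gradW S r (\<Phi> s z) j - g j\<bar> \<le> C * spread (spread (\<lambda>i. h * A i)) j"
        unfolding g_def
      proof (rule gradW_lip_spread)
        fix i
        show "\<bar>\<Phi> s z i - z i\<bar> \<le> h * A i"
          using displacement[OF z, of s i] s A0[of i] by (smt (verit) mult_right_mono)
      qed
      also have "\<dots> = h * A' j" by (simp add: A'_def spread_def sum_distrib_left mult_ac)
      finally have e: "\<bar>gradW S r (\<Phi> s z) j - g j\<bar> \<le> h * A' j" .
      have "\<bar>g j\<bar> * \<bar>gradW S r (\<Phi> s z) j - g j\<bar> \<le> A j * (h * A' j)"
        by (rule mult_mono[OF gA e A0]) simp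
      then have "- (g j * (gradW S r (\<Phi> s z) j - g j)) \<le> A j * (h * A' j)"
        by (simp add: abs_mult[symmetric] abs_le_iff)
      then have "h * - (g j * (gradW S r (\<Phi> s z) j - g j)) \<le> h * (A j * (h * A' j))"
        using h by (intro mult_left_mono) auto
      then show ?thesis unfolding s(3) by (simp add: power2_eq_square algebra_simps)
    qed
    have sgd: "(\<lambda>j. g j * d j) summable_on Dom w"
    proof (rule summable_bound[of "\<lambda>j. A j * (h * A j)"])
      show "(\<lambda>j. A j * (h * A j)) summable_on Dom w" using good_mult[OF good_A ghA] by (simp add: good_def)
      show "\<bar>g j * d j\<bar> \<le> A j * (h * A j)" for j
        unfolding abs_mult by (rule mult_mono[OF gA dA A0]) simp
    qed
    have sg2: "(\<lambda>j. (g j)\<^sup>2) summable_on Dom w"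
    proof (rule summable_bound[of "\<lambda>j. A j * A j"])
      show "(\<lambda>j. A j * A j) summable_on Dom w" using good_mult[OF good_A good_A] by (simp add: good_def)
      show "\<bar>(g j)\<^sup>2\<bar> \<le> A j * A j" for j
        unfolding power2_eq_square abs_mult by (rule mult_mono[OF gA gA A0]) simp
    qed
    have sB: "(\<lambda>j. (C * h\<^sup>2) * B j) summable_on Dom w"
      using gB by (intro summable_on_cmult_right) (simp add: good_def)
    have sAA': "(\<lambda>j. h\<^sup>2 * (A j * A' j)) summable_on Dom w"
      using gAA' by (intro summable_on_cmult_right) (simp add: good_def)
    have shg: "(\<lambda>j. - (h * (g j)\<^sup>2)) summable_on Dom w"
      using summable_on_cmult_right[OF sg2, of "- h"] by simp
    have sS: "(\<lambda>j. S j u - S j p) summable_on Dom w" if "u \<in> K" for u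
      by (rule summable_bound[OF summable_bV S_diff_bound[OF that]])
    have sSd: "(\<lambda>j. S j y - S j z) summable_on Dom w"
      using summable_on_add[OF sS[OF yK] summable_on_uminus[THEN iffD2, OF sS[OF z]]] by simp
    have "V y = infsum (\<lambda>j. (S j z - S j p) + (S j y - S j z)) (Dom w)" by (simp add: V_def)
    also have "\<dots> = V z + infsum (\<lambda>j. S j y - S j z) (Dom w)"
      unfolding V_def by (rule infsum_add[OF sS[OF z] sSd])
    also have "infsum (\<lambda>j. S j y - S j z) (Dom w) \<le> infsum (\<lambda>j. T j + (C * h\<^sup>2) * B j) (Dom w)"
      by (rule infsum_mono[OF sSd summable_on_add[OF sT sB] S_le])
    also have "\<dots> = infsum (\<lambda>j. g j * d j) (Dom w) + (C * h\<^sup>2) * infsum B (Dom w)"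
      using infsum_add[OF sT sB] gB by (simp add: iT infsum_cmult_right' good_def)
    also have "infsum (\<lambda>j. g j * d j) (Dom w) \<le> infsum (\<lambda>j. - (h * (g j)\<^sup>2) + h\<^sup>2 * (A j * A' j)) (Dom w)"
      by (rule infsum_mono[OF sgd summable_on_add[OF shg sAA'] gd])
    also have "\<dots> = - (h * infsum (\<lambda>j. (g j)\<^sup>2) (Dom w)) + h\<^sup>2 * infsum (\<lambda>j. A j * A' j) (Dom w)"
      using infsum_add[OF shg sAA'] by (simp add: infsum_uminus infsum_cmult_right')
    finally have le: "V y \<le> V z + (- (h * infsum (\<lambda>j. (g j)\<^sup>2) (Dom w)) + h\<^sup>2 * infsum (\<lambda>j. A j * A' j) (Dom w)
        + (C * h\<^sup>2) * infsum B (Dom w))" by simp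
    \<comment> \<open>A single term of the sum suffices; g is resonance invariant, so i may be
      replaced by its representative in \<open>Dom w\<close>.\<close>
    have "h * (g i)\<^sup>2 \<le> h * infsum (\<lambda>j. (g j)\<^sup>2) (Dom w)"
    proof -
      have "sum (\<lambda>j. (g j)\<^sup>2) {rep w i} \<le> infsum (\<lambda>j. (g j)\<^sup>2) (Dom w)"
        by (rule finite_sum_le_infsum[OF sg2]) auto
      then show ?thesis using h invariant_rep[OF ig, of i] by (intro mult_left_mono) auto
    qed
    then have "V y \<le> V z - h * (g i)\<^sup>2 + (h\<^sup>2 * infsum (\<lambda>j. A j * A' j) (Dom w) + (C * h\<^sup>2) * infsum B (Dom w))"
      using le by linarith
    then show ?thesis unfolding c_def y_def g_def by (simp add: algebra_simps)
  qed
  ultimately show ?thesis by blast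
qed

text \<open>Over n steps of length t / n the quadratic errors add up to c t^2 / n, which tends to
  0.\<close>

lemma V_antimono:
  assumes z: "z \<in> K" and t: "0 \<le> t" shows "V (\<Phi> t z) \<le> V z"
proof (cases "t = 0")
  case False
  then have t: "t > 0" using assms by simp
  obtain c where "0 \<le> c" and "\<forall>z\<in>K. \<forall>h i. 0 < h \<longrightarrow> h \<le> 1 \<longrightarrow>
      V (\<Phi> h z) \<le> V z - h * (gradW S r z i)\<^sup>2 + c * h\<^sup>2"
    using energy_step by (elim exE conjE)
  then have c: "0 \<le> c" "\<And>z h i. z \<in> K \<Longrightarrow> 0 < h \<Longrightarrow> h \<le> 1 \<Longrightarrow>
      V (\<Phi> h z) \<le> V z - h * (gradW S r z i)\<^sup>2 + c * h\<^sup>2"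
    by simp_all
  have step: "V (\<Phi> h u) \<le> V u + c * h\<^sup>2" if "u \<in> K" "0 < h" "h \<le> 1" for u h
  proof -
    have "0 \<le> h * (gradW S r u 0)\<^sup>2" using that by simp
    then show ?thesis using c(2)[OF that, of 0] by linarith
  qed
  have "V (\<Phi> t z) \<le> V z + c * t\<^sup>2 * (1 / real n)" if n: "n \<ge> nat \<lceil>t\<rceil> + 1" for n
  proof -
    have n0: "n > 0" and tn: "t \<le> real n" using n by linarith+
    define h where "h = t / real n"
    have h: "0 < h" "h \<le> 1" using t tn n0 by (auto simp: h_def)
    have "V (\<Phi> (real k * h) z) \<le> V z + real k * (c * h\<^sup>2)" for k
    proof (induction k)
      case 0 then show ?case by (simp add: Psi_0[OF tame_K[OF z]])
    next
      case (Suc k)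
      have "\<Phi> h (\<Phi> (real k * h) z) = \<Phi> (real (Suc k) * h) z"
        using Psi_add[OF tame_K[OF z], of h "real k * h"] by (simp add: algebra_simps)
      then have "V (\<Phi> (real (Suc k) * h) z) \<le> V (\<Phi> (real k * h) z) + c * h\<^sup>2"
        using step[OF Psi_in_K[OF z] h, of "real k * h"] h by simp
      then show ?case using Suc by (simp add: algebra_simps)
    qed
    from this[of n] show ?thesis using n0 by (simp add: h_def power2_eq_square)
  qed
  moreover have "(\<lambda>n. V z + c * t\<^sup>2 * (1 / real n)) \<longlonglongrightarrow> V z + c * t\<^sup>2 * 0"
    by (intro tendsto_intros lim_1_over_n)
  ultimately show ?thesis
    by (intro LIMSEQ_le_const[of "\<lambda>n. V z + c * t\<^sup>2 * (1 / real n)"]) auto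
qed (simp add: Psi_0[OF tame_K[OF z]])

lemma V_strict:
  assumes z: "z \<in> K" and i: "gradW S r z i \<noteq> 0" shows "V (\<Phi> 1 z) < V z"
proof -
  obtain c where "0 \<le> c" and "\<forall>z\<in>K. \<forall>h i. 0 < h \<longrightarrow> h \<le> 1 \<longrightarrow>
      V (\<Phi> h z) \<le> V z - h * (gradW S r z i)\<^sup>2 + c * h\<^sup>2"
    using energy_step by (elim exE conjE)
  then have c: "0 \<le> c" "\<And>z h i. z \<in> K \<Longrightarrow> 0 < h \<Longrightarrow> h \<le> 1 \<Longrightarrow>
      V (\<Phi> h z) \<le> V z - h * (gradW S r z i)\<^sup>2 + c * h\<^sup>2"
    by simp_all
  define G where "G = (gradW S r z i)\<^sup>2"
  have G: "G > 0" using i by (simp add: G_def)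
  \<comment> \<open>Small enough for the gain h G to beat the error c h^2; c + 1 avoids a division
    by 0.\<close>
  define h where "h = min 1 (G / (2 * (c + 1)))"
  have h: "0 < h" "h \<le> 1" using G c by (auto simp: h_def)
  have "c * h \<le> c * (G / (2 * (c + 1)))" using c by (intro mult_left_mono) (auto simp: h_def)
  also have "\<dots> \<le> G / 2" using G c by (simp add: divide_simps algebra_simps)
  also have "\<dots> < G" using G by simp
  finally have "h * (c * h) < h * G" using h by simp
  then have "V (\<Phi> h z) < V z" using c(2)[OF z h, of i] by (simp add: G_def power2_eq_square algebra_simps)
  moreover have "V (\<Phi> (1 - h) (\<Phi> h z)) \<le> V (\<Phi> h z)"
    using h by (intro V_antimono Psi_in_K z) auto
  ultimately show ?thesis using Psi_add[OF tame_K[OF z], of "1 - h" h] by simp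
qed

text \<open>The energy along the orbit is monotone and bounded, so it has a limit L as time tends to
  - infinity. Both V z and \<open>V (\<Phi> 1 z)\<close> are limits along such times and equal L,
  which \<open>V_strict\<close> allows only at stationary points.\<close>

lemma alpha_limit_stationary:
  assumes y: "\<And>t. \<Phi> t y \<in> K" and ty: "tame y" and t: "filterlim t at_bot sequentially"
    and lim: "(\<lambda>n. \<Phi> (t n) y) \<longlonglongrightarrow> z"
  shows "gradW S r z i = 0"
proof -
  have zK: "z \<in> K" by (rule closed_sequentially[OF closed_K _ lim]) (rule y)
  define f where "f s = V (\<Phi> s y)" for s
  have anti: "f s' \<le> f s" if "s \<le> s'" for s s'
    using V_antimono[OF y[of s], of "s' - s"] Psi_add[OF ty, of "s' - s" s] that by (simp add: f_def)
  have bdd: "bdd_above (range f)"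
    using V_bounded[OF y] by (intro bdd_aboveI2[of _ _ "infsum bV (Dom w)"]) (auto simp: f_def abs_le_iff)
  define L where "L = (SUP s. f s)"
  have conv: "(\<lambda>n. f (u n)) \<longlonglongrightarrow> L" if u: "filterlim u at_bot sequentially" for u :: "nat \<Rightarrow> real"
  proof (rule tendstoI)
    fix e :: real assume e: "e > 0"
    obtain s where s: "L - e < f s"
      using less_cSUP_iff[OF _ bdd, of "L - e"] e unfolding L_def by auto
    have "\<forall>\<^sub>F n in sequentially. u n \<le> s" using u unfolding filterlim_at_bot by blast
    then show "\<forall>\<^sub>F n in sequentially. dist (f (u n)) L < e"
    proof eventually_elim
      case (elim n)
      have "f (u n) \<le> L" unfolding L_def by (rule cSUP_upper[OF _ bdd]) simp
      then show ?case using s anti[OF elim] by (simp add: dist_real_def)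
    qed
  qed
  have "(\<lambda>n. f (t n)) \<longlonglongrightarrow> V z" unfolding f_def by (rule V_tendsto[OF y lim])
  then have "V z = L" using conv[OF t] LIMSEQ_unique by blast
  moreover have "(\<lambda>n. f (1 + t n)) \<longlonglongrightarrow> V (\<Phi> 1 z)"
    unfolding f_def using V_tendsto[OF _ K_tendsto[OF y lim, of 1]] y
    by (simp add: Psi_add[OF ty])
  moreover have "filterlim (\<lambda>n. 1 + t n) at_bot sequentially"
    unfolding filterlim_at_bot
  proof
    fix Z :: real
    have "\<forall>\<^sub>F n in sequentially. t n \<le> Z - 1" using t unfolding filterlim_at_bot by blast
    then show "\<forall>\<^sub>F n in sequentially. 1 + t n \<le> Z" by eventually_elim simp
  qed
  ultimately have "V (\<Phi> 1 z) = V z" using conv LIMSEQ_unique by blast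
  then show ?thesis using V_strict[OF zK, of i] by force
qed

end

section \<open>Monotone flows on a compact order interval\<close>

lemma ivt_eq:
  fixes f :: "real \<Rightarrow> real"
  assumes "f a \<le> c" "c \<le> f b" "a \<le> b" "\<And>t. isCont f t"
  shows "\<exists>t. a \<le> t \<and> t \<le> b \<and> f t = c"
  using IVT[of f a c b] assms by blast

lemma neg_neg_conf: "- (- z) = (z :: 'a \<Rightarrow> real)"
  by (rule ext) simp

text \<open>Abstracting from the gap makes z -> -z available: \<open>reflect\<close> reverses the
  order, swaps P with Q and suprema with infima, so a statement about orbits leaving P also covers
  orbits leaving Q. The group law is for all times, invariance of \<open>K\<close> and preservation
  of the order for forward time.\<close>

locale monotone_flow =
  fixes \<phi> :: "real \<Rightarrow> ('d::finite) conf \<Rightarrow> 'd conf" and K :: "'d conf set" and P Q :: "'d conf"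
  assumes compact: "compact K" and PK: "P \<in> K" and QK: "Q \<in> K"
    and lower: "\<And>z. z \<in> K \<Longrightarrow> conf_le P z" and upper: "\<And>z. z \<in> K \<Longrightarrow> conf_le z Q"
    and sup: "\<And>A. A \<subseteq> K \<Longrightarrow> A \<noteq> {} \<Longrightarrow> (\<lambda>i. SUP a\<in>A. a i) \<in> K"
    and inf: "\<And>A. A \<subseteq> K \<Longrightarrow> A \<noteq> {} \<Longrightarrow> (\<lambda>i. INF a\<in>A. a i) \<in> K"
    and zero: "\<And>z. z \<in> K \<Longrightarrow> \<phi> 0 z = z"
    and add: "\<And>s t z. z \<in> K \<Longrightarrow> \<phi> s (\<phi> t z) = \<phi> (s + t) z"
    and inv: "\<And>t z. z \<in> K \<Longrightarrow> 0 \<le> t \<Longrightarrow> \<phi> t z \<in> K"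
    and mono: "\<And>t y z. y \<in> K \<Longrightarrow> z \<in> K \<Longrightarrow> conf_le y z \<Longrightarrow> 0 \<le> t \<Longrightarrow> conf_le (\<phi> t y) (\<phi> t z)"
    and cont: "\<And>t z i. z \<in> K \<Longrightarrow> isCont (\<lambda>t. \<phi> t z i) t"
    and tends: "\<And>z x t. (\<And>n :: nat. z n \<in> K) \<Longrightarrow> z \<longlonglongrightarrow> x \<Longrightarrow> (\<lambda>n. \<phi> t (z n)) \<longlonglongrightarrow> \<phi> t x"
    and fixP: "\<And>t. \<phi> t P = P" and fixQ: "\<And>t. \<phi> t Q = Q"
    and fixed: "\<And>z. z \<in> K \<Longrightarrow> (\<And>t. 0 \<le> t \<Longrightarrow> \<phi> t z = z) \<Longrightarrow> z = P \<or> z = Q"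
begin

text \<open>As \<open>t n\<close> tends to infinity, the points at time s + \<open>t n\<close> are
  eventually reached in forward time, even for negative s; so the limit has its whole orbit, past
  included, in \<open>K\<close>.\<close>

lemma limit_of_orbits:
  assumes u: "\<And>n. u n \<in> K" and t0: "\<And>n. 0 \<le> t n" and t: "filterlim t at_top sequentially"
  obtains z \<sigma> where "strict_mono (\<sigma> :: nat \<Rightarrow> nat)" "(\<lambda>n. \<phi> (t (\<sigma> n)) (u (\<sigma> n))) \<longlonglongrightarrow> z"
    "\<And>s. (\<lambda>n. \<phi> (s + t (\<sigma> n)) (u (\<sigma> n))) \<longlonglongrightarrow> \<phi> s z" "\<And>s. \<phi> s z \<in> K"
    "\<And>s. \<forall>\<^sub>F n in sequentially. 0 \<le> s + t (\<sigma> n)" "z \<in> K"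
proof -
  define y where "y n = \<phi> (t n) (u n)" for n
  have yK: "\<And>n. y n \<in> K" unfolding y_def by (intro inv u t0)
  have "seq_compact K" using compact compact_eq_seq_compact_metric by blast
  moreover have "\<forall>n. y n \<in> K" using yK by simp
  ultimately obtain z \<sigma> where z: "z \<in> K" and \<sigma>: "strict_mono (\<sigma> :: nat \<Rightarrow> nat)" and lim: "(y \<circ> \<sigma>) \<longlonglongrightarrow> z"
    by (rule seq_compactE)
  have lim': "(\<lambda>n. \<phi> (s + t (\<sigma> n)) (u (\<sigma> n))) \<longlonglongrightarrow> \<phi> s z" for s
    using tends[OF _ lim, of s] yK by (simp add: y_def add[OF u])
  have ev: "\<forall>\<^sub>F n in sequentially. 0 \<le> s + t (\<sigma> n)" for s
  proof -
    have "filterlim (\<lambda>n. t (\<sigma> n)) at_top sequentially"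
      by (rule filterlim_compose[OF t filterlim_subseq[OF \<sigma>]])
    then have "\<forall>\<^sub>F n in sequentially. - s \<le> t (\<sigma> n)" unfolding filterlim_at_top by blast
    then show ?thesis by eventually_elim simp
  qed
  have "\<phi> s z \<in> K" for s
  proof (rule Lim_in_closed_set[OF compact_imp_closed[OF compact] _ _ lim'])
    show "\<forall>\<^sub>F n in sequentially. \<phi> (s + t (\<sigma> n)) (u (\<sigma> n)) \<in> K"
      using ev[of s] by eventually_elim (rule inv[OF u])
  qed simp
  moreover have "(\<lambda>n. \<phi> (t (\<sigma> n)) (u (\<sigma> n))) \<longlonglongrightarrow> z" using lim by (simp add: y_def o_def)
  ultimately show thesis using that \<sigma> lim' ev z by blast
qed

text \<open>If some entire orbit emanates from \<open>P\<close>, then the suprema of its past are subsolutions that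
  accumulate at \<open>P\<close>. The increasing orbits starting there all pass the level \<open>c\<close> on their way to
  \<open>Q\<close>, after a time that tends to infinity, and so they accumulate at a monotone entire orbit.\<close>

lemma monotone_entire_orbit:
  assumes c: "P 0 < c" "c < Q 0" and yK: "y \<in> K" and y: "\<And>t. \<phi> t y \<in> K" and yP: "y \<noteq> P"
    and past: "\<And>i e. e > 0 \<Longrightarrow> \<exists>T. \<forall>t\<le>T. \<bar>\<phi> t y i - P i\<bar> < e"
  shows "\<exists>z\<in>K. z 0 = c \<and> (\<forall>t. \<phi> t z \<in> K) \<and> (\<forall>s t. s \<le> t \<longrightarrow> conf_le (\<phi> s z) (\<phi> t z))"
proof -
  define A where "A n = (\<lambda>s. \<phi> s y) ` {..- real n}" for n :: nat
  define Z where "Z n = (\<lambda>i. SUP a\<in>A n. a i)" for n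
  have AK: "A n \<subseteq> K" and A0: "A n \<noteq> {}" for n using y by (auto simp: A_def)
  have ZK: "Z n \<in> K" for n unfolding Z_def by (rule sup[OF AK A0])
  have bdd: "bdd_above ((\<lambda>a. a i) ` A n)" for i n
    by (rule bdd_aboveI2[of _ _ "Q i"]) (use AK upper in \<open>auto simp: conf_le_def\<close>)
  have A_le: "conf_le a (Z n)" if "a \<in> A n" for a n
    unfolding conf_le_def Z_def using cSUP_upper[OF that bdd] by blast
  have Z_least: "conf_le (Z n) b" if "\<And>a. a \<in> A n \<Longrightarrow> conf_le a b" for b n
    unfolding conf_le_def Z_def by (intro allI cSUP_least[OF A0]) (use that in \<open>auto simp: conf_le_def\<close>)
  \<comment> \<open>A point of the past up to time - n is the image, under the flow for time t, of a
    still earlier point, which lies below \<open>Z n\<close>; hence \<open>Z n\<close> is a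
    subsolution.\<close>
  have sub: "conf_le (Z n) (\<phi> t (Z n))" if t: "0 \<le> t" for t n
  proof (rule Z_least)
    fix a assume "a \<in> A n"
    then obtain s where s: "a = \<phi> s y" "s \<le> - real n" by (auto simp: A_def)
    have "\<phi> (s - t) y \<in> A n" using s t by (auto simp: A_def)
    then have "conf_le (\<phi> t (\<phi> (s - t) y)) (\<phi> t (Z n))"
      using A_le ZK y t mono by blast
    then show "conf_le a (\<phi> t (Z n))" by (simp add: add[OF yK] s)
  qed
  have incr: "conf_le (\<phi> s (Z n)) (\<phi> t (Z n))" if "0 \<le> s" "s \<le> t" for s t n
    using mono[OF ZK inv[OF ZK] sub, of "t - s" s] that by (simp add: add[OF ZK])
  have Z_ne: "Z n \<noteq> P" for n
  proof
    assume ZP: "Z n = P"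
    have "\<phi> (- real n) y \<in> A n" by (auto simp: A_def)
    then have "\<phi> (- real n) y = P" using A_le ZP lower y conf_le_antisym by metis
    then have "\<phi> (real n) (\<phi> (- real n) y) = P" using fixP by simp
    then show False using yP by (simp add: add[OF yK] zero[OF yK])
  qed
  have to_Q: "(\<lambda>m. \<phi> (real m) (Z n)) \<longlonglongrightarrow> Q" for n
  proof -
    define X where "X m = \<phi> (real m) (Z n)" for m :: nat
    define W where "W = (\<lambda>i. SUP m. X m i)"
    have XK: "X m \<in> K" for m unfolding X_def by (rule inv[OF ZK]) simp
    have bX: "bdd_above (range (\<lambda>m. X m i))" for i
      by (rule bdd_aboveI2[of _ _ "Q i"]) (use XK upper in \<open>auto simp: conf_le_def\<close>)
    have lim: "X \<longlonglongrightarrow> W"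
      unfolding tendsto_conf_iff W_def
    proof (intro allI LIMSEQ_incseq_SUP bX)
      fix i show "incseq (\<lambda>m. X m i)"
        unfolding incseq_def X_def using incr by (auto simp: conf_le_def)
    qed
    have WK: "W \<in> K" by (rule closed_sequentially[OF compact_imp_closed[OF compact] XK lim])
    have "\<phi> t W = W" if t: "0 \<le> t" for t
    proof (rule LIMSEQ_unique[OF tends[OF XK lim]], subst tendsto_conf_iff, rule allI)
      fix i
      have limi: "(\<lambda>m. X m i) \<longlonglongrightarrow> W i" using lim by (simp add: tendsto_conf_iff)
      obtain k :: nat where k: "t \<le> real k" using real_arch_simple by blast
      show "(\<lambda>m. \<phi> t (X m) i) \<longlonglongrightarrow> W i"
      proof (rule tendsto_sandwich[OF _ _ limi LIMSEQ_ignore_initial_segment[OF limi, of k]]; rule always_eventually; rule allI)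
        fix m
        have e: "\<phi> t (X m) = \<phi> (t + real m) (Z n)" by (simp add: X_def add[OF ZK])
        show "X m i \<le> \<phi> t (X m) i" unfolding e unfolding X_def
          using incr[of "real m" "t + real m"] t by (simp add: conf_le_def)
        show "\<phi> t (X m) i \<le> X (m + k) i" unfolding e unfolding X_def
          using incr[of "t + real m" "real (m + k)"] t k by (simp add: conf_le_def)
      qed
    qed
    then have "W = P \<or> W = Q" using fixed WK by blast
    moreover have "W \<noteq> P"
    proof
      assume "W = P"
      have "X 0 i \<le> W i" for i unfolding W_def by (rule cSUP_upper[OF _ bX]) simp
      then have "conf_le (Z n) P" using \<open>W = P\<close> by (simp add: X_def zero[OF ZK] conf_le_def)
      then show False using Z_ne lower[OF ZK] conf_le_antisym by blast
    qed
    moreover have "X = (\<lambda>m. \<phi> (real m) (Z n))" by (simp add: X_def fun_eq_iff)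
    ultimately show ?thesis using lim by simp
  qed
  have Z_to_P: "Z \<longlonglongrightarrow> P"
  proof (subst tendsto_conf_iff, rule allI, rule tendstoI)
    fix i and e :: real assume e: "e > 0"
    then obtain T where T: "\<And>t. t \<le> T \<Longrightarrow> \<bar>\<phi> t y i - P i\<bar> < e / 2" using past[of "e / 2" i] by auto
    obtain k :: nat where k: "- T \<le> real k" using real_arch_simple by blast
    show "\<forall>\<^sub>F n in sequentially. dist (Z n i) (P i) < e"
      using eventually_ge_at_top[of k]
    proof eventually_elim
      case (elim n)
      have "a i \<le> P i + e / 2" if aA: "a \<in> A n" for a
      proof -
        obtain s where s: "a = \<phi> s y" "s \<le> - real n" using aA by (auto simp: A_def)
        then have "s \<le> T" using k elim by linarith
        then have "\<phi> s y i \<le> P i + e / 2" using T[of s] by linarith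
        then show ?thesis using s by simp
      qed
      then have "Z n i \<le> P i + e / 2" unfolding Z_def by (intro cSUP_least A0)
      moreover have "P i \<le> Z n i" using lower[OF ZK] by (simp add: conf_le_def)
      ultimately show ?case using e by (simp add: dist_real_def)
    qed
  qed
  have "\<forall>\<^sub>F n in sequentially. Z n 0 < c"
    using order_tendstoD(2)[of "\<lambda>n. Z n 0" "P 0"] Z_to_P c(1) by (simp add: tendsto_conf_iff)
  then obtain n0 where n0: "\<And>n. n \<ge> n0 \<Longrightarrow> Z n 0 < c" unfolding eventually_sequentially by blast
  define u where "u n = Z (n0 + n)" for n
  have uK: "u n \<in> K" for n unfolding u_def by (rule ZK)
  have "\<exists>t\<ge>0. \<phi> t (u n) 0 = c" for n
  proof -
    have "(\<lambda>m. \<phi> (real m) (u n) 0) \<longlonglongrightarrow> Q 0"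
      using to_Q[of "n0 + n"] by (simp add: tendsto_conf_iff u_def)
    then have "\<forall>\<^sub>F m in sequentially. c < \<phi> (real m) (u n) 0" using c(2) by (rule order_tendstoD(1))
    then obtain m where m: "c < \<phi> (real m) (u n) 0" unfolding eventually_sequentially by blast
    have "\<exists>t. 0 \<le> t \<and> t \<le> real m \<and> \<phi> t (u n) 0 = c"
      by (rule ivt_eq) (use n0[of "n0 + n"] m cont[OF uK] in \<open>auto simp: zero[OF uK] u_def[symmetric] less_imp_le\<close>)
    then show ?thesis by blast
  qed
  then obtain t where t: "\<And>n. 0 \<le> t n" "\<And>n. \<phi> (t n) (u n) 0 = c" by metis
  have u_to_P: "u \<longlonglongrightarrow> P" unfolding u_def using LIMSEQ_ignore_initial_segment[OF Z_to_P, of n0] by (simp add: add.commute)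
  \<comment> \<open>The starting points converge to the fixed point P, so at any given time their
    orbits are eventually still below c; the crossing must come later.\<close>
  have "filterlim t at_top sequentially"
    unfolding filterlim_at_top
  proof
    fix M :: real
    have "(\<lambda>n. \<phi> \<bar>M\<bar> (u n) 0) \<longlonglongrightarrow> P 0"
      using tends[OF uK u_to_P, of "\<bar>M\<bar>"] fixP by (simp add: tendsto_conf_iff)
    then have "\<forall>\<^sub>F n in sequentially. \<phi> \<bar>M\<bar> (u n) 0 < c" using c(1) by (rule order_tendstoD(2))
    then show "\<forall>\<^sub>F n in sequentially. M \<le> t n"
    proof eventually_elim
      case (elim n)
      show ?case
      proof (rule ccontr)
        assume "\<not> M \<le> t n"
        then have "conf_le (\<phi> (t n) (u n)) (\<phi> \<bar>M\<bar> (u n))" unfolding u_def by (intro incr) (use t in auto)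
        then have "\<phi> (t n) (u n) 0 \<le> \<phi> \<bar>M\<bar> (u n) 0" by (simp add: conf_le_def)
        then show False using elim t(2)[of n] by linarith
      qed
    qed
  qed
  then obtain z \<sigma> where \<sigma>: "strict_mono (\<sigma> :: nat \<Rightarrow> nat)" and lim: "(\<lambda>n. \<phi> (t (\<sigma> n)) (u (\<sigma> n))) \<longlonglongrightarrow> z"
    and lims: "\<And>s. (\<lambda>n. \<phi> (s + t (\<sigma> n)) (u (\<sigma> n))) \<longlonglongrightarrow> \<phi> s z" and zK: "\<And>s. \<phi> s z \<in> K"
    and ev: "\<And>s. \<forall>\<^sub>F n in sequentially. 0 \<le> s + t (\<sigma> n)" and z: "z \<in> K"
    by (rule limit_of_orbits[of u t, OF uK t(1)]) (rule that)
  have "(\<lambda>n. \<phi> (t (\<sigma> n)) (u (\<sigma> n)) 0) \<longlonglongrightarrow> z 0" using lim by (simp add: tendsto_conf_iff)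
  then have "z 0 = c" by (simp add: t(2) LIMSEQ_const_iff)
  moreover have "conf_le (\<phi> s z) (\<phi> s' z)" if ss: "s \<le> s'" for s s'
    unfolding conf_le_def
  proof
    fix i
    have lims_i: "(\<lambda>n. \<phi> (s + t (\<sigma> n)) (u (\<sigma> n)) i) \<longlonglongrightarrow> \<phi> s z i" for s
      using lims[of s] by (simp add: tendsto_conf_iff)
    show "\<phi> s z i \<le> \<phi> s' z i"
    proof (rule tendsto_le[OF _ lims_i lims_i])
      show "\<forall>\<^sub>F n in sequentially. \<phi> (s + t (\<sigma> n)) (u (\<sigma> n)) i \<le> \<phi> (s' + t (\<sigma> n)) (u (\<sigma> n)) i"
        using ev[of s]
      proof eventually_elim
        case (elim n)
        then show ?case using incr[of "s + t (\<sigma> n)" "s' + t (\<sigma> n)" "n0 + \<sigma> n"] ss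
          by (simp add: conf_le_def u_def)
      qed
    qed simp
  qed
  ultimately show ?thesis using zK z by blast
qed

lemma reflect: "monotone_flow (\<lambda>t z. - \<phi> t (- z)) (uminus ` K) (- Q) (- P)"
proof -
  have in_iff: "z \<in> uminus ` K \<longleftrightarrow> - z \<in> K" for z
    by (metis image_iff neg_neg_conf)
  have le_iff: "conf_le (- y) (- z) \<longleftrightarrow> conf_le z y" for y z :: "'d conf"
    by (simp add: conf_le_def)
  have neg_image: "uminus ` A \<subseteq> K" if "A \<subseteq> uminus ` K" for A
    using that in_iff by blast
  show ?thesis
  proof
    have "continuous_on K uminus"
      by (intro continuous_on_coordinatewise_then_product)
        (auto intro!: continuous_intros continuous_on_subset[OF continuous_on_product_coordinates])
    then show "compact (uminus ` K)" by (rule compact_continuous_image[OF _ compact])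
    show "- Q \<in> uminus ` K" "- P \<in> uminus ` K" using PK QK by auto
    show "conf_le (- Q) z" "conf_le z (- P)" if "z \<in> uminus ` K" for z
      using that upper lower le_iff by auto
    show "(\<lambda>i. SUP a\<in>A. a i) \<in> uminus ` K" if "A \<subseteq> uminus ` K" "A \<noteq> {}" for A
    proof -
      have "- (\<lambda>i. SUP a\<in>A. a i) = (\<lambda>i. INF b\<in>uminus ` A. b i)"
        by (rule ext) (simp add: Inf_real_def image_image)
      then show ?thesis using inf[OF neg_image[OF that(1)]] that(2) by (simp add: in_iff)
    qed
    show "(\<lambda>i. INF a\<in>A. a i) \<in> uminus ` K" if "A \<subseteq> uminus ` K" "A \<noteq> {}" for A
    proof -
      have "- (\<lambda>i. INF a\<in>A. a i) = (\<lambda>i. SUP b\<in>uminus ` A. b i)"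
        by (rule ext) (simp add: Inf_real_def image_image)
      then show ?thesis using sup[OF neg_image[OF that(1)]] that(2) by (simp add: in_iff)
    qed
    show "- \<phi> 0 (- z) = z" if "z \<in> uminus ` K" for z
      using that zero by (auto simp: neg_neg_conf)
    show "- \<phi> s (- (- \<phi> t (- z))) = - \<phi> (s + t) (- z)" if "z \<in> uminus ` K" for s t z
      using that add by (auto simp: neg_neg_conf)
    show "- \<phi> t (- z) \<in> uminus ` K" if "z \<in> uminus ` K" "0 \<le> t" for t z
      using that inv by (auto simp: neg_neg_conf)
    show "conf_le (- \<phi> t (- y)) (- \<phi> t (- z))"
      if "y \<in> uminus ` K" "z \<in> uminus ` K" "conf_le y z" "0 \<le> t" for t y z
      using that mono le_iff by (auto simp: neg_neg_conf)
    show "isCont (\<lambda>t. (- \<phi> t (- z)) i) t" if "z \<in> uminus ` K" for t z i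
      using that cont by (auto simp: neg_neg_conf)
    show "(\<lambda>n. - \<phi> t (- z n)) \<longlonglongrightarrow> - \<phi> t (- x)"
      if "\<And>n :: nat. z n \<in> uminus ` K" "z \<longlonglongrightarrow> x" for z x t
    proof -
      have "(\<lambda>n. - z n) \<longlonglongrightarrow> - x"
        using that(2) by (auto simp: tendsto_conf_iff intro: tendsto_minus)
      from tends[OF _ this, of t] show ?thesis
        using that(1) in_iff by (auto simp: tendsto_conf_iff intro: tendsto_minus)
    qed
    show "- \<phi> t (- (- Q)) = - Q" "- \<phi> t (- (- P)) = - P" for t by (simp_all add: neg_neg_conf fixP fixQ)
    show "z = - Q \<or> z = - P" if z: "z \<in> uminus ` K" and f: "\<And>t. 0 \<le> t \<Longrightarrow> - \<phi> t (- z) = z" for z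
    proof -
      have "\<phi> t (- z) = - z" if "0 \<le> t" for t using f[OF that] by (metis neg_neg_conf)
      then have "- z = P \<or> - z = Q" using fixed z in_iff by blast
      then show ?thesis by (metis neg_neg_conf)
    qed
  qed
qed

text \<open>If the closed property B recurred at arbitrarily early times, compactness of
  \<open>K\<close> would yield a limit with B along times tending to - infinity. The bound T lets an
  application use what is known about the orbit up to time T.\<close>

lemma past_limit:
  assumes yK: "\<And>t. \<phi> t y \<in> K"
    and lim: "\<And>t z. filterlim t at_bot sequentially \<Longrightarrow> (\<And>n. t n \<le> T) \<Longrightarrow> (\<lambda>n. \<phi> (t n) y) \<longlonglongrightarrow> z \<Longrightarrow> \<not> B z"
    and B: "\<And>z. closed {z. B z}"
  shows "\<exists>T. \<forall>t\<le>T. \<not> B (\<phi> t y)"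
proof (rule ccontr)
  assume "\<not> ?thesis"
  then have "\<forall>n. \<exists>t. t \<le> min T (- real n) \<and> B (\<phi> t y)" by blast
  then obtain t where t: "\<And>n. t n \<le> T" "\<And>n. t n \<le> - real n" "\<And>n. B (\<phi> (t n) y)" by (metis min.bounded_iff)
  have "seq_compact K" using compact compact_eq_seq_compact_metric by blast
  moreover have "\<forall>n. \<phi> (t n) y \<in> K" using yK by simp
  ultimately obtain z \<sigma> where z: "z \<in> K" and \<sigma>: "strict_mono (\<sigma> :: nat \<Rightarrow> nat)" and l: "((\<lambda>n. \<phi> (t n) y) \<circ> \<sigma>) \<longlonglongrightarrow> z"
    by (rule seq_compactE)
  have "filterlim (\<lambda>n. t (\<sigma> n)) at_bot sequentially"
    unfolding filterlim_at_bot
  proof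
    fix M :: real
    obtain k :: nat where k: "- M \<le> real k" using real_arch_simple by blast
    show "\<forall>\<^sub>F n in sequentially. t (\<sigma> n) \<le> M"
      using eventually_ge_at_top[of k]
    proof eventually_elim
      case (elim n)
      then have "real k \<le> real (\<sigma> n)" using seq_suble[OF \<sigma>, of n] by linarith
      then show ?case using t(2)[of "\<sigma> n"] k by linarith
    qed
  qed
  then have "\<not> B z" using lim[of "\<lambda>n. t (\<sigma> n)" z] t(1) l by (simp add: o_def)
  moreover have "z \<in> {z. B z}" by (rule closed_sequentially[OF B _ l]) (simp add: t(3))
  ultimately show False by simp
qed

text \<open>At every time n the image of the segment still joins the fixed points P and Q, so some
  point of it is at level c. Moving time n to 0 and letting n grow gives an orbit with an unbounded
  past.\<close>

lemma entire_orbit: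
  assumes c: "P 0 \<le> c" "c \<le> Q 0"
    and seg: "\<And>s. 0 \<le> s \<Longrightarrow> s \<le> 1 \<Longrightarrow> (\<lambda>i. P i + s * (Q i - P i)) \<in> K"
  shows "\<exists>y\<in>K. y 0 = c \<and> (\<forall>t. \<phi> t y \<in> K)"
proof -
  define \<zeta> where "\<zeta> s = (\<lambda>i. P i + s * (Q i - P i))" for s
  have \<zeta>K: "\<zeta> s \<in> K" if "s \<in> {0..1}" for s using seg that by (simp add: \<zeta>_def)
  have "\<exists>s\<in>{0..1}. \<phi> (real n) (\<zeta> s) 0 = c" for n
  proof -
    have "continuous_on {0..1} (\<lambda>s. \<phi> (real n) (\<zeta> s) 0)"
    proof (rule continuous_on_sequentiallyI)
      fix x and a :: real assume x: "\<forall>n. x n \<in> {0..1}" "a \<in> {0..1}" "x \<longlonglongrightarrow> a"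
      have "(\<lambda>m. \<zeta> (x m)) \<longlonglongrightarrow> \<zeta> a"
        unfolding tendsto_conf_iff \<zeta>_def by (intro allI tendsto_intros x(3))
      from tends[OF \<zeta>K this, of "real n"] x(1)
      show "(\<lambda>m. \<phi> (real n) (\<zeta> (x m)) 0) \<longlonglongrightarrow> \<phi> (real n) (\<zeta> a) 0"
        by (simp add: tendsto_conf_iff)
    qed
    moreover have "\<zeta> 0 = P" "\<zeta> 1 = Q" by (auto simp: \<zeta>_def)
    ultimately show ?thesis
      using IVT'[of "\<lambda>s. \<phi> (real n) (\<zeta> s) 0" 0 c 1] c fixP fixQ by auto
  qed
  then obtain s where s: "\<And>n. s n \<in> {0..1}" "\<And>n. \<phi> (real n) (\<zeta> (s n)) 0 = c" by metis
  have t0: "\<And>n. 0 \<le> real n" by simp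
  obtain z \<sigma> where "strict_mono (\<sigma> :: nat \<Rightarrow> nat)" and lim: "(\<lambda>n. \<phi> (real (\<sigma> n)) (\<zeta> (s (\<sigma> n)))) \<longlonglongrightarrow> z"
    and "\<And>t. (\<lambda>n. \<phi> (t + real (\<sigma> n)) (\<zeta> (s (\<sigma> n)))) \<longlonglongrightarrow> \<phi> t z" and z: "\<And>t. \<phi> t z \<in> K"
    and "\<And>t. \<forall>\<^sub>F n in sequentially. 0 \<le> t + real (\<sigma> n)" and zK: "z \<in> K"
    by (rule limit_of_orbits[of "\<lambda>n. \<zeta> (s n)" real, OF \<zeta>K[OF s(1)] t0 filterlim_real_sequentially]) (rule that)
  from lim have "(\<lambda>n. \<phi> (real (\<sigma> n)) (\<zeta> (s (\<sigma> n))) 0) \<longlonglongrightarrow> z 0" by (simp add: tendsto_conf_iff)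
  then have "z 0 = c" by (simp add: s(2) LIMSEQ_const_iff)
  then show ?thesis using z zK by blast
qed

text \<open>All limits in the past of the entire orbit are P or Q, and neither is at level c at the
  origin. So before some time the orbit stays on one side of c and therefore emanates from one end
  point; for Q the reflected flow is used.\<close>

theorem connecting_orbit:
  assumes c: "P 0 < c" "c < Q 0"
    and seg: "\<And>s. 0 \<le> s \<Longrightarrow> s \<le> 1 \<Longrightarrow> (\<lambda>i. P i + s * (Q i - P i)) \<in> K"
    and alpha: "\<And>y t z. y \<in> K \<Longrightarrow> (\<And>s. \<phi> s y \<in> K) \<Longrightarrow> filterlim t at_bot sequentially \<Longrightarrow>
      (\<lambda>n. \<phi> (t n) y) \<longlonglongrightarrow> z \<Longrightarrow> z = P \<or> z = Q"
  shows "\<exists>z\<in>K. z 0 = c \<and> (\<forall>t. \<phi> t z \<in> K) \<and>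
    ((\<forall>s t. s \<le> t \<longrightarrow> conf_le (\<phi> s z) (\<phi> t z)) \<or> (\<forall>s t. s \<le> t \<longrightarrow> conf_le (\<phi> t z) (\<phi> s z)))"
proof -
  obtain y where y: "y \<in> K" "y 0 = c" "\<And>t. \<phi> t y \<in> K"
    using entire_orbit[OF less_imp_le[OF c(1)] less_imp_le[OF c(2)] seg] by blast
  have lim_ne: "z = P \<or> z = Q" if "filterlim t at_bot sequentially" "(\<lambda>n. \<phi> (t n) y) \<longlonglongrightarrow> z" for t z
    using alpha[OF y(1) y(3) that] .
  have "\<exists>T. \<forall>t\<le>T. \<not> \<phi> t y 0 = c"
    by (rule past_limit[OF y(3), of 0])
      (use lim_ne c in \<open>force, intro closed_Collect_eq continuous_on_product_coordinates continuous_on_const\<close>)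
  then obtain T where T: "\<And>t. t \<le> T \<Longrightarrow> \<phi> t y 0 \<noteq> c" by blast
  have "(\<forall>t\<le>T. \<phi> t y 0 < c) \<or> (\<forall>t\<le>T. c < \<phi> t y 0)"
  proof (rule ccontr)
    assume "\<not> ?thesis"
    then obtain a b where ab: "a \<le> T" "b \<le> T" "c \<le> \<phi> a y 0" "\<phi> b y 0 \<le> c" by (auto simp: not_less)
    have co: "\<forall>x. a' \<le> x \<and> x \<le> b' \<longrightarrow> isCont (\<lambda>t. \<phi> t y 0) x" for a' b' using cont[OF y(1)] by blast
    show False
    proof (cases "a \<le> b")
      case True
      then obtain x where "x \<le> b" "\<phi> x y 0 = c" using IVT2[OF ab(4,3) True co] by blast
      then show False using T[of x] ab by linarith
    next
      case False
      then obtain x where "x \<le> a" "\<phi> x y 0 = c" using IVT[OF ab(4,3) _ co] by force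
      then show False using T[of x] ab by linarith
    qed
  qed
  then show ?thesis
  proof
    assume less: "\<forall>t\<le>T. \<phi> t y 0 < c"
    have "\<exists>T. \<forall>t\<le>T. \<bar>\<phi> t y i - P i\<bar> < e" if e: "e > 0" for i e
    proof -
      have "\<exists>T. \<forall>t\<le>T. \<not> e \<le> \<bar>\<phi> t y i - P i\<bar>"
      proof (rule past_limit[OF y(3), of T])
        fix t z assume t: "filterlim t at_bot sequentially" "\<And>n. t n \<le> T" and l: "(\<lambda>n. \<phi> (t n) y) \<longlonglongrightarrow> z"
        have "(\<lambda>n. \<phi> (t n) y 0) \<longlonglongrightarrow> z 0" using l by (simp add: tendsto_conf_iff)
        then have "z 0 \<le> c" by (rule LIMSEQ_le_const2) (use less t(2) less_imp_le in blast)
        then have "z = P" using lim_ne[OF t(1) l] c(2) by auto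
        then show "\<not> e \<le> \<bar>z i - P i\<bar>" using e by simp
      qed (intro closed_Collect_le continuous_intros continuous_on_product_coordinates)
      then show ?thesis by (simp add: not_le)
    qed
    moreover have "y \<noteq> P" using y(2) c(1) by auto
    ultimately show ?thesis using monotone_entire_orbit[OF c y(1) y(3)] by blast
  next
    assume greater: "\<forall>t\<le>T. c < \<phi> t y 0"
    have past: "\<exists>T. \<forall>t\<le>T. \<bar>\<phi> t y i - Q i\<bar> < e" if e: "e > 0" for i e
    proof -
      have "\<exists>T. \<forall>t\<le>T. \<not> e \<le> \<bar>\<phi> t y i - Q i\<bar>"
      proof (rule past_limit[OF y(3), of T])
        fix t z assume t: "filterlim t at_bot sequentially" "\<And>n. t n \<le> T" and l: "(\<lambda>n. \<phi> (t n) y) \<longlonglongrightarrow> z"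
        have "(\<lambda>n. \<phi> (t n) y 0) \<longlonglongrightarrow> z 0" using l by (simp add: tendsto_conf_iff)
        then have "c \<le> z 0" by (rule LIMSEQ_le_const) (use greater t(2) less_imp_le in blast)
        then have "z = Q" using lim_ne[OF t(1) l] c(1) by auto
        then show "\<not> e \<le> \<bar>z i - Q i\<bar>" using e by simp
      qed (intro closed_Collect_le continuous_intros continuous_on_product_coordinates)
      then show ?thesis by (simp add: not_le)
    qed
    interpret R: monotone_flow "\<lambda>t z. - \<phi> t (- z)" "uminus ` K" "- Q" "- P" by (rule reflect)
    have "\<exists>z\<in>uminus ` K. z 0 = - c \<and> (\<forall>t. - \<phi> t (- z) \<in> uminus ` K) \<and>
        (\<forall>s t. s \<le> t \<longrightarrow> conf_le (- \<phi> s (- z)) (- \<phi> t (- z)))"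
    proof (rule R.monotone_entire_orbit[of "- c" "- y"])
      show "\<exists>T. \<forall>t\<le>T. \<bar>(- \<phi> t (- (- y))) i - (- Q) i\<bar> < e" if "e > 0" for i e
        using past[OF that, of i] by (simp add: abs_minus_commute neg_neg_conf)
      show "- y \<noteq> - Q" using y(2) c(2) by (metis neg_neg_conf less_irrefl)
    qed (use c y in \<open>auto simp: neg_neg_conf\<close>)
    then obtain z where z: "z 0 = - c" "\<And>t. - \<phi> t (- z) \<in> uminus ` K"
      "\<And>s t. s \<le> t \<Longrightarrow> conf_le (- \<phi> s (- z)) (- \<phi> t (- z))" and zK: "z \<in> uminus ` K" by blast
    have "- z \<in> K" using zK by (metis image_iff neg_neg_conf)
    moreover have "\<phi> t (- z) \<in> K" for t using z(2)[of t] by (metis image_iff neg_neg_conf)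
    ultimately show ?thesis
      by (intro bexI[of _ "- z"]) (use z(1,3) in \<open>auto simp: conf_le_def\<close>)
  qed
qed

end

section \<open>Invariant chains\<close>

lemma chain_inf_seq:
  fixes A :: "('d::finite) conf set"
  assumes ne: "A \<noteq> {}" and chain: "\<And>a b. a \<in> A \<Longrightarrow> b \<in> A \<Longrightarrow> conf_le a b \<or> conf_le b a"
    and bdd: "\<And>i. bdd_below ((\<lambda>a. a i) ` A)"
  obtains f where "\<And>n. f n \<in> A" "f \<longlonglongrightarrow> (\<lambda>i. INF a\<in>A. a i)"
proof -
  have "\<exists>f. (\<forall>n. f n \<in> uminus ` A) \<and> f \<longlonglongrightarrow> (\<lambda>i. SUP a\<in>uminus ` A. a i)"
  proof (rule chain_sup_seq[of "uminus ` A"])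
    fix a b assume "a \<in> uminus ` A" "b \<in> uminus ` A"
    then show "conf_le a b \<or> conf_le b a" using chain by (force simp: conf_le_def)
  next
    fix i
    obtain m where "\<And>a. a \<in> A \<Longrightarrow> m \<le> a i" using bdd[of i] by (auto simp: bdd_below_def)
    then show "bdd_above ((\<lambda>a. a i) ` uminus ` A)" by (intro bdd_aboveI2[of _ _ "- m"]) auto
  qed (use ne in auto)
  then obtain f where f: "\<And>n. f n \<in> uminus ` A" "f \<longlonglongrightarrow> (\<lambda>i. SUP a\<in>uminus ` A. a i)" by blast
  have "- f n \<in> A" for n using f(1)[of n] by (metis image_iff neg_neg_conf)
  moreover have "(\<lambda>n. - f n) \<longlonglongrightarrow> (\<lambda>i. INF a\<in>A. a i)"
  proof (subst tendsto_conf_iff, rule allI)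
    fix i
    have "(\<lambda>n. - f n i) \<longlonglongrightarrow> - (SUP a\<in>uminus ` A. a i)"
      using f(2) by (intro tendsto_minus) (simp add: tendsto_conf_iff)
    then show "(\<lambda>n. (- f n) i) \<longlonglongrightarrow> (INF a\<in>A. a i)" by (simp add: Inf_real_def image_image)
  qed
  ultimately show thesis by (rule that)
qed

lemma slope_bound_nmult:
  assumes "slope_bound w a" shows "\<bar>a (nmult n k) - a 0 - real n * ipair w k\<bar> \<le> 3"
  using assms unfolding slope_bound_def by (metis add_0 ipair_nmult)

text \<open>Otherwise iterating the shift makes the values deviate linearly from the mean slope
  along the multiples of k, which the slope bound forbids.\<close>

lemma tau_fixed_resonant:
  assumes a: "slope_bound w a" and fx: "tau k l a = a" shows "ipair w k + real_of_int l = 0"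
proof (rule ccontr)
  assume ne: "ipair w k + real_of_int l \<noteq> 0"
  have "a (nmult n k) + real n * real_of_int l = a 0" for n
  proof (induction n)
    case (Suc n)
    have "tau k l a (nmult n k) = a (nmult n k)" by (simp add: fx)
    then show ?case using Suc by (simp add: tau_def algebra_simps)
  qed simp
  then have "\<bar>real n * (ipair w k + real_of_int l)\<bar> \<le> 3" for n
    using slope_bound_nmult[OF a, of n k] by (simp add: algebra_simps abs_le_iff) (smt (verit))
  then have "real n * \<bar>ipair w k + real_of_int l\<bar> \<le> 3" for n by (simp add: abs_mult)
  moreover obtain n where "3 < real n * \<bar>ipair w k + real_of_int l\<bar>"
    using reals_Archimedean3[of "\<bar>ipair w k + real_of_int l\<bar>"] ne by auto
  ultimately show False by (simp add: not_le[symmetric])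
qed

lemma slope_bound_has_rotvec:
  assumes "slope_bound w a" shows "has_rotvec a w"
  unfolding has_rotvec_def
proof
  fix i
  have "(\<lambda>n. a (nmult n i) / real n) \<longlonglongrightarrow> ipair w i"
  proof (rule tendsto_sandwich[of "\<lambda>n. ipair w i - (\<bar>a 0\<bar> + 3) * (1 / real n)" _ _ "\<lambda>n. ipair w i + (\<bar>a 0\<bar> + 3) * (1 / real n)"])
    have "(\<lambda>n. ipair w i - (\<bar>a 0\<bar> + 3) * (1 / real n)) \<longlonglongrightarrow> ipair w i - (\<bar>a 0\<bar> + 3) * 0"
      "(\<lambda>n. ipair w i + (\<bar>a 0\<bar> + 3) * (1 / real n)) \<longlonglongrightarrow> ipair w i + (\<bar>a 0\<bar> + 3) * 0"
      by (intro tendsto_intros lim_1_over_n)+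
    then show "(\<lambda>n. ipair w i - (\<bar>a 0\<bar> + 3) * (1 / real n)) \<longlonglongrightarrow> ipair w i"
      "(\<lambda>n. ipair w i + (\<bar>a 0\<bar> + 3) * (1 / real n)) \<longlonglongrightarrow> ipair w i" by simp_all
    have *: "\<bar>a (nmult n i) - real n * ipair w i\<bar> \<le> \<bar>a 0\<bar> + 3" for n
      using slope_bound_nmult[OF assms, of n i] by linarith
    show "\<forall>\<^sub>F n in sequentially. ipair w i - (\<bar>a 0\<bar> + 3) * (1 / real n) \<le> a (nmult n i) / real n"
      using eventually_gt_at_top[of 0]
    proof eventually_elim
      case (elim n)
      have "(real n * ipair w i - (\<bar>a 0\<bar> + 3)) / real n \<le> a (nmult n i) / real n"
        using *[of n] by (intro divide_right_mono) auto
      then show ?case using elim by (simp add: diff_divide_distrib)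
    qed
    show "\<forall>\<^sub>F n in sequentially. a (nmult n i) / real n \<le> ipair w i + (\<bar>a 0\<bar> + 3) * (1 / real n)"
      using eventually_gt_at_top[of 0]
    proof eventually_elim
      case (elim n)
      have "a (nmult n i) / real n \<le> (real n * ipair w i + (\<bar>a 0\<bar> + 3)) / real n"
        using *[of n] by (intro divide_right_mono) auto
      then show ?case using elim by (simp add: add_divide_distrib)
    qed
  qed
  then show "(\<lambda>n. a (\<chi> m. int n * i $ m) / real n) \<longlonglongrightarrow> ipair w i" by (simp add: nmult_def)
qed

section \<open>Invariant chains and their gaps\<close>

context lattice_potential
begin

lemma slope_bound_tame: "slope_bound w a \<Longrightarrow> tame (a :: 'd conf)"
  by (rule tame_of_linear_growth, rule slope_bound_growth)

lemma slope_bound_tendsto: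
  assumes sb: "\<And>n. slope_bound w (z n)" and lim: "z \<longlonglongrightarrow> x"
  shows "(\<lambda>n. \<Phi> t (z n)) \<longlonglongrightarrow> \<Phi> t x"
proof -
  have "(\<lambda>n. z n 0) \<longlonglongrightarrow> x 0" using lim by (simp add: tendsto_conf_iff)
  then have "Bseq (\<lambda>n. z n 0)" using convergent_imp_Bseq convergentI by blast
  then obtain B where B: "\<And>n. \<bar>z n 0\<bar> \<le> B" unfolding Bseq_def by auto
  have "\<bar>z n i\<bar> \<le> (B + 3 + (\<Sum>m\<in>UNIV. \<bar>w $ m\<bar>)) * (1 + real (nl i))" for n i
    by (rule order_trans[OF slope_bound_growth[OF sb]], rule mult_right_mono) (use B[of n] in auto)
  then show ?thesis using lim by (rule Psi_tendsto)
qed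

text \<open>All real times are included on purpose: the two-sided invariance gives
  \<open>Psi_le_iff\<close> and the stationarity of the end points of a gap.\<close>

definition invariant_chain :: "real ^ 'd \<Rightarrow> 'd conf \<Rightarrow> 'd conf set \<Rightarrow> bool" where
  "invariant_chain w x G \<longleftrightarrow> x \<in> G \<and> (\<forall>a\<in>G. resonant w a) \<and>
     (\<forall>a\<in>G. \<forall>b\<in>G. conf_le a b \<or> conf_le b a) \<and>
     (\<forall>k l. \<forall>a\<in>G. tau k l a \<in> G) \<and> (\<forall>t. \<forall>a\<in>G. \<Phi> t a \<in> G)"

end

locale chain = lattice_potential S r C for S :: "'d::finite pot" and r C :: real +
  fixes w :: "real ^ 'd" and x :: "'d conf" and G :: "'d conf set"
  assumes slope: "\<And>i k. \<bar>x (i + k) - x i - ipair w k\<bar> \<le> 1" and ic: "invariant_chain w x G"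
begin

lemma xG: "x \<in> G" and res: "a \<in> G \<Longrightarrow> resonant w a"
  and total: "a \<in> G \<Longrightarrow> b \<in> G \<Longrightarrow> conf_le a b \<or> conf_le b a"
  and tauG: "a \<in> G \<Longrightarrow> tau k l a \<in> G" and PsiG: "a \<in> G \<Longrightarrow> \<Phi> t a \<in> G"
  using ic unfolding invariant_chain_def by auto

lemma le_of_less_at: "a \<in> G \<Longrightarrow> b \<in> G \<Longrightarrow> a i < b i \<Longrightarrow> conf_le a b"
  using total unfolding conf_le_def by (metis not_le)

lemma slope_bound: assumes a: "a \<in> G" shows "slope_bound w a"
proof -
  \<comment> \<open>Two members of the chain are ordered by a strict inequality at one site, so a is
    enclosed between the translates by l - 1 and l + 1 rather than l and l + 1.\<close>
  define l where "l = \<lfloor>a 0 - x 0\<rfloor>"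
  have "conf_le (tau 0 (l - 1) x) a"
    by (rule le_of_less_at[OF tauG[OF xG] a, of _ _ 0]) (simp add: tau_def l_def, linarith)
  moreover have "conf_le a (tau 0 (l + 1) x)"
    by (rule le_of_less_at[OF a tauG[OF xG], of 0]) (simp add: tau_def l_def, linarith)
  ultimately have "x i + real_of_int l - 1 \<le> a i" "a i \<le> x i + real_of_int l + 1" for i
    by (auto simp: conf_le_def tau_def algebra_simps)
  then have near: "\<bar>a i - x i - real_of_int l\<bar> \<le> 1" for i by (simp add: abs_le_iff algebra_simps)
  show ?thesis unfolding slope_bound_def
  proof (intro allI)
    fix i k
    show "\<bar>a (i + k) - a i - ipair w k\<bar> \<le> 3" using near[of i] near[of "i + k"] slope[of i k] by linarith
  qed
qed

lemma tame: "a \<in> G \<Longrightarrow> tame a"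
  using slope_bound slope_bound_tame by blast

text \<open>For negative t: if the images were in the opposite order, flowing forward by - t would
  reverse the order of a and b and force a = b.\<close>

lemma Psi_le_iff: assumes "a \<in> G" "b \<in> G" "conf_le a b" shows "conf_le (\<Phi> t a) (\<Phi> t b)"
proof (cases "0 \<le> t")
  case True
  then show ?thesis using assms Psi_mono tame by blast
next
  case False
  show ?thesis
  proof (cases "conf_le (\<Phi> t b) (\<Phi> t a)")
    case True
    then have "conf_le (\<Phi> (- t) (\<Phi> t b)) (\<Phi> (- t) (\<Phi> t a))"
      by (rule Psi_mono[OF tame[OF PsiG[OF assms(2)]] tame[OF PsiG[OF assms(1)]]]) (use False in simp)
    then have "conf_le b a" by (simp add: Psi_add Psi_0 tame assms)
    then have "a = b" using assms(3) conf_le_antisym by blast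
    then show ?thesis by simp
  next
    case False
    then show ?thesis using total PsiG assms by blast
  qed
qed

lemma strictly_ordered:
  assumes "a \<in> G" "b \<in> G" shows "conf_ll a b \<or> a = b \<or> conf_ll b a"
proof -
  have *: "conf_ll a b" if "a \<in> G" "b \<in> G" "conf_le a b" "a \<noteq> b" for a b
    unfolding conf_ll_def
  proof
    fix i
    have "a i \<noteq> b i" using ordered_orbits[of a b i] tame Psi_le_iff that by blast
    then show "a i < b i" using that(3) by (simp add: conf_le_def less_le)
  qed
  show ?thesis using * total assms by metis
qed

lemma eq_at_point: "a \<in> G \<Longrightarrow> b \<in> G \<Longrightarrow> a i = b i \<Longrightarrow> a = b"
  using strictly_ordered unfolding conf_ll_def by (metis less_irrefl)

lemma birkhoff: "a \<in> G \<Longrightarrow> birkhoff a"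
  unfolding birkhoff_def using total tauG by blast

lemma in_Bbar: "a \<in> G \<Longrightarrow> a \<in> Bbar w"
  using birkhoff slope_bound slope_bound_has_rotvec res by (auto simp: Bbar_def resonant_def)

text \<open>All members share one slope bound, so the flow is continuous along convergent sequences
  of members. Two incomparable limits would be strictly separated in opposite directions at two
  sites, and these inequalities would persist for members.\<close>

lemma closure_invariant_chain: "invariant_chain w x (closure G)"
proof -
  have seq: "\<exists>f. (\<forall>n. f n \<in> G) \<and> f \<longlonglongrightarrow> a" if "a \<in> closure G" for a
    using that by (simp add: closure_sequential)
  have clos: "a \<in> closure G" if "\<And>n. f n \<in> G" "f \<longlonglongrightarrow> a" for f a
    using that closure_sequential by blast
  have tau_lim: "(\<lambda>n. tau k l (f n)) \<longlonglongrightarrow> tau k l a" if "f \<longlonglongrightarrow> a" for f a k l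
    using continuous_on_tendsto_compose[OF continuous_on_tau[of UNIV k l] that] by simp
  show ?thesis
    unfolding invariant_chain_def
  proof (intro conjI ballI allI)
    show "x \<in> closure G" using xG closure_subset by blast
  next
    fix a assume "a \<in> closure G"
    then obtain f where f: "\<And>n. f n \<in> G" "f \<longlonglongrightarrow> a" using seq by blast
    show "resonant w a" unfolding resonant_def
    proof (intro allI impI)
      fix k l assume "ipair w k + real_of_int l = 0"
      then have "tau k l (f n) = f n" for n using res[OF f(1)] by (simp add: resonant_def)
      then show "tau k l a = a" using tau_lim[OF f(2), of k l] f(2) LIMSEQ_unique by fastforce
    qed
    show "tau k l a \<in> closure G" for k l by (rule clos[OF tauG[OF f(1)] tau_lim[OF f(2)]])
    show "\<Phi> t a \<in> closure G" for t
      by (rule clos[OF PsiG[OF f(1)] slope_bound_tendsto[OF slope_bound[OF f(1)] f(2)]])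
  next
    fix a b assume "a \<in> closure G" "b \<in> closure G"
    then obtain f g where f: "\<And>n. f n \<in> G" "f \<longlonglongrightarrow> a" and g: "\<And>n. g n \<in> G" "g \<longlonglongrightarrow> b" using seq by metis
    show "conf_le a b \<or> conf_le b a"
    proof (rule ccontr)
      assume "\<not> ?thesis"
      then obtain i j where ij: "b i < a i" "a j < b j" by (auto simp: conf_le_def not_le)
      have d: "(\<lambda>n. f n i - g n i) \<longlonglongrightarrow> a i - b i" "(\<lambda>n. g n j - f n j) \<longlonglongrightarrow> b j - a j"
        by (intro tendsto_diff; use f(2) g(2) in \<open>simp add: tendsto_conf_iff\<close>)+
      have "\<forall>\<^sub>F n in sequentially. 0 < f n i - g n i" "\<forall>\<^sub>F n in sequentially. 0 < g n j - f n j"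
        by (rule order_tendstoD(1)[OF d(1)], use ij in simp, rule order_tendstoD(1)[OF d(2)], use ij in simp)
      then have "\<forall>\<^sub>F n in sequentially. False"
      proof eventually_elim
        case (elim n)
        then show False using total[OF f(1)[of n] g(1)[of n]] by (force simp: conf_le_def not_le[symmetric])
      qed
      then show False by simp
    qed
  qed
qed

definition is_gap :: "'d conf \<Rightarrow> 'd conf \<Rightarrow> bool" where
  "is_gap p q \<longleftrightarrow> p \<in> G \<and> q \<in> G \<and> conf_le p q \<and> p \<noteq> q \<and> (\<forall>z\<in>G. conf_le z p \<or> conf_le q z)"

text \<open>Shifts map gaps to gaps, and two gaps of a chain coincide or are disjoint. The last
  alternative is the second one for the inverse shift.\<close>

lemma gap_shift:
  assumes g: "is_gap p q"
  shows "tau k l p = p \<or> conf_le q (tau k l p) \<or> conf_le (tau k l q) p"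
proof -
  have pG: "p \<in> G" and gp: "\<And>z. z \<in> G \<Longrightarrow> conf_le z p \<or> conf_le q z" using g by (auto simp: is_gap_def)
  show ?thesis
  proof (cases "conf_le q (tau k l p)")
    case False
    then have 1: "conf_le (tau k l p) p" using gp tauG[OF pG] by blast
    then have 2: "conf_le p (tau (- k) (- l) p)" by (simp add: tau_le_iff)
    show ?thesis
    proof (cases "conf_le (tau (- k) (- l) p) p")
      case True
      then have "tau (- k) (- l) p = p" using 2 conf_le_antisym by blast
      then have "tau k l p = p" by (simp add: tau_eq_iff)
      then show ?thesis by blast
    next
      case False
      then have "conf_le q (tau (- k) (- l) p)" using gp tauG[OF pG] by blast
      then show ?thesis by (simp add: tau_le_iff)
    qed
  qed blast
qed

lemma gap_resonant:
  assumes "is_gap p q" "tau k l p = p" shows "ipair w k + real_of_int l = 0"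
  by (rule tau_fixed_resonant[OF slope_bound assms(2)]) (use assms(1) in \<open>simp add: is_gap_def\<close>)

text \<open>Members of G avoid the gap, so they are comparable with every point of the orbit. A
  shift either moves the gap off itself or fixes p; in that case it is a resonance and fixes every
  point of the orbit, and only monotonicity in time is left to compare.\<close>

lemma extend:
  assumes g: "is_gap p q" and z: "tame z" "resonant w z"
    and K: "\<And>t. conf_le p (\<Phi> t z)" "\<And>t. conf_le (\<Phi> t z) q"
    and m: "(\<forall>s t. s \<le> t \<longrightarrow> conf_le (\<Phi> s z) (\<Phi> t z)) \<or> (\<forall>s t. s \<le> t \<longrightarrow> conf_le (\<Phi> t z) (\<Phi> s z))"
  shows "invariant_chain w x (G \<union> {tau k l (\<Phi> t z) | k l t. True})"
proof -
  have pG: "p \<in> G" and gp: "\<And>z. z \<in> G \<Longrightarrow> conf_le z p \<or> conf_le q z" using g by (auto simp: is_gap_def)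
  have rz: "resonant w (\<Phi> t z)" for t using z unfolding resonant_def by (metis Psi_tau)
  have c1: "conf_le a (tau k l (\<Phi> t z)) \<or> conf_le (tau k l (\<Phi> t z)) a" if "a \<in> G" for a k l t
  proof -
    have "conf_le (tau (- k) (- l) a) p \<or> conf_le q (tau (- k) (- l) a)" using gp tauG that by blast
    then have "conf_le (tau (- k) (- l) a) (\<Phi> t z) \<or> conf_le (\<Phi> t z) (tau (- k) (- l) a)"
      using K conf_le_trans by blast
    then show ?thesis
      unfolding le_tau_iff[of a k l "\<Phi> t z"] tau_le_iff[of k l "\<Phi> t z" a] by blast
  qed
  have c2: "conf_le (\<Phi> s z) (tau k l (\<Phi> t z)) \<or> conf_le (tau k l (\<Phi> t z)) (\<Phi> s z)" for s t k l
    using gap_shift[OF g, of k l]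
  proof (elim disjE)
    assume "tau k l p = p"
    then have "tau k l (\<Phi> t z) = \<Phi> t z" using gap_resonant[OF g] rz by (auto simp: resonant_def)
    then show ?thesis using m by (metis linear)
  next
    assume "conf_le q (tau k l p)"
    then show ?thesis using K tau_mono conf_le_trans by metis
  next
    assume "conf_le (tau k l q) p"
    then show ?thesis using K tau_mono conf_le_trans by metis
  qed
  have c3: "conf_le (tau k' l' (\<Phi> s z)) (tau k l (\<Phi> t z)) \<or> conf_le (tau k l (\<Phi> t z)) (tau k' l' (\<Phi> s z))" for s t k l k' l'
    unfolding tau_le_iff[of k' l' "\<Phi> s z"] le_tau_iff[of "tau k l (\<Phi> t z)" k' l' "\<Phi> s z"] tau_tau
    by (rule c2)
  show ?thesis
    unfolding invariant_chain_def
  proof (intro conjI ballI allI)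
    fix a assume "a \<in> G \<union> {tau k l (\<Phi> t z) |k l t. True}"
    then consider "a \<in> G" | k l t where "a = tau k l (\<Phi> t z)" by blast
    note a = this
    show "resonant w a"
      using a
    proof cases
      case 2
      then show ?thesis using rz[of t] unfolding resonant_def by (metis add.commute tau_tau)
    qed (rule res)
    show "tau k l a \<in> G \<union> {tau k l (\<Phi> t z) |k l t. True}" for k l
      using a
    proof cases
      case (2 k' l' t)
      then have "tau k l a = tau (k + k') (l + l') (\<Phi> t z)" by simp
      then show ?thesis by blast
    qed (use tauG in blast)
    show "\<Phi> s a \<in> G \<union> {tau k l (\<Phi> t z) |k l t. True}" for s
      using a
    proof cases
      case (2 k l t)
      then have "\<Phi> s a = tau k l (\<Phi> (s + t) z)"
        by (simp add: Psi_tau[OF tame_Psi[OF z(1)]] Psi_add[OF z(1)])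
      then show ?thesis by blast
    qed (use PsiG in blast)
  next
    fix a b assume a: "a \<in> G \<union> {tau k l (\<Phi> t z) |k l t. True}" and b: "b \<in> G \<union> {tau k l (\<Phi> t z) |k l t. True}"
    then consider "a \<in> G" "b \<in> G" | k l t where "a \<in> G" "b = tau k l (\<Phi> t z)"
      | k l t where "b \<in> G" "a = tau k l (\<Phi> t z)" | k l t k' l' s where "a = tau k l (\<Phi> t z)" "b = tau k' l' (\<Phi> s z)"
      by blast
    then show "conf_le a b \<or> conf_le b a"
      by cases (use total c1 c3 in blast)+
  qed (use xG in auto)
qed

text \<open>For small |t| continuity at the origin keeps the orbit of p from reaching q, so it stays
  below p. Using this for t and - t, with the order preserved by the flow, shows that p does not
  move; likewise for q.\<close>

lemma gap_stationary:
  assumes g: "is_gap p q" shows "gradW S r p i = 0" "gradW S r q i = 0"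
proof -
  have pG: "p \<in> G" and qG: "q \<in> G" and gp: "\<And>z. z \<in> G \<Longrightarrow> conf_le z p \<or> conf_le q z"
    and pq: "p 0 < q 0"
    using g strictly_ordered[of p q] by (auto simp: is_gap_def conf_le_def conf_ll_def) (meson less_le_not_le)
  have ev: "\<exists>e>0. \<forall>t. \<bar>t\<bar> < e \<longrightarrow> \<bar>\<Phi> t a 0 - a 0\<bar> < q 0 - p 0" if "a \<in> G" for a
  proof -
    have "isCont (\<lambda>t. \<Phi> t a 0) 0" by (rule Psi_continuous[OF tame[OF that]])
    then have "\<forall>e>0. \<exists>d>0. \<forall>t. \<bar>t - 0\<bar> < d \<longrightarrow> \<bar>\<Phi> t a 0 - \<Phi> 0 a 0\<bar> < e"
      unfolding continuous_at_real_range by (simp add: real_norm_def)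
    then show ?thesis using pq by (simp add: Psi_0[OF tame[OF that]])
  qed
  obtain e where e: "e > 0" "\<And>t. \<bar>t\<bar> < e \<Longrightarrow> \<bar>\<Phi> t p 0 - p 0\<bar> < q 0 - p 0" using ev[OF pG] by blast
  have le_p: "conf_le (\<Phi> t p) p" if "\<bar>t\<bar> < e" for t
    using gp[OF PsiG[OF pG], of t] e(2)[OF that] unfolding conf_le_def by (smt (verit))
  have "\<Phi> t p = p" if "0 \<le> t" "t < e" for t
  proof (rule conf_le_antisym[OF le_p])
    have "conf_le (\<Phi> t (\<Phi> (- t) p)) (\<Phi> t p)"
      by (rule Psi_le_iff[OF PsiG[OF pG] pG le_p]) (use that in auto)
    then show "conf_le p (\<Phi> t p)" by (simp add: Psi_add Psi_0 tame pG)
  qed (use that in auto)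
  then show "gradW S r p i = 0" by (rule stationary_of_Psi[OF tame[OF pG] _ e(1)])
  obtain e where e: "e > 0" "\<And>t. \<bar>t\<bar> < e \<Longrightarrow> \<bar>\<Phi> t q 0 - q 0\<bar> < q 0 - p 0" using ev[OF qG] by blast
  have le_q: "conf_le q (\<Phi> t q)" if "\<bar>t\<bar> < e" for t
    using gp[OF PsiG[OF qG], of t] e(2)[OF that] unfolding conf_le_def by (smt (verit))
  have "\<Phi> t q = q" if "0 \<le> t" "t < e" for t
  proof (rule conf_le_antisym[OF _ le_q])
    have "conf_le (\<Phi> t q) (\<Phi> t (\<Phi> (- t) q))"
      by (rule Psi_le_iff[OF qG PsiG[OF qG] le_q]) (use that in auto)
    then show "conf_le (\<Phi> t q) q" by (simp add: Psi_add Psi_0 tame qG)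
  qed (use that in auto)
  then show "gradW S r q i = 0" by (rule stationary_of_Psi[OF tame[OF qG] _ e(1)])
qed

text \<open>The shifts of a gap by representatives modulo the resonance lattice are pairwise disjoint
  and can be moved into the interval between 0 and 2 by vertical shifts.\<close>

lemma gap_sum_le:
  assumes g: "is_gap p q" and F: "finite F" "F \<subseteq> Dom w"
  shows "(\<Sum>i\<in>F. q i - p i) \<le> 2"
proof -
  have pG: "p \<in> G" and qG: "q \<in> G" and le: "conf_le p q" using g by (auto simp: is_gap_def)
  have q1: "conf_le q (tau 0 1 p)"
  proof -
    have "\<not> conf_le (tau 0 1 p) p" by (auto simp: conf_le_def tau_def)
    then show ?thesis using g tauG[OF pG] by (auto simp: is_gap_def)
  qed
  define l where "l i = - \<lfloor>p i\<rfloor>" for i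
  define I where "I i = {p i + real_of_int (l i)<..<q i + real_of_int (l i)}" for i
  have disj: "I i \<inter> I j = {}" if ij: "i \<in> F" "j \<in> F" "i \<noteq> j" for i j
  proof -
    \<comment> \<open>A fixed p would make i - j a resonance, whereas F contains at most one
      representative of each coset.\<close>
    have ne: "tau (i - j) (l i - l j) p \<noteq> p"
    proof
      assume "tau (i - j) (l i - l j) p = p"
      then have "resonant_shift w (i - j)" using gap_resonant[OF g] unfolding resonant_shift_def by blast
      then have "rep w i = rep w j" by (simp add: rep_eq_iff)
      moreover obtain u v where "i = rep w u" "j = rep w v" using ij F(2) by blast
      ultimately show False using ij(3) by simp
    qed
    have "q j + real_of_int (l j) \<le> p i + real_of_int (l i) \<or> q i + real_of_int (l i) \<le> p j + real_of_int (l j)"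
      using gap_shift[OF g, of "i - j" "l i - l j"] ne
    proof (elim disjE)
      assume "conf_le q (tau (i - j) (l i - l j) p)"
      then have "q j \<le> tau (i - j) (l i - l j) p j" unfolding conf_le_def by blast
      then show ?thesis by (simp add: tau_def)
    next
      assume "conf_le (tau (i - j) (l i - l j) q) p"
      then have "tau (i - j) (l i - l j) q j \<le> p j" unfolding conf_le_def by blast
      then show ?thesis by (simp add: tau_def)
    qed simp
    then show ?thesis by (auto simp: I_def)
  qed
  have I2: "I i \<subseteq> {0..2}" for i
  proof -
    have "q i \<le> p i + 1" using q1 by (simp add: conf_le_def tau_def)
    moreover have "0 \<le> p i + real_of_int (l i)" "p i + real_of_int (l i) \<le> 1" unfolding l_def by linarith+
    ultimately show ?thesis by (auto simp: I_def)
  qed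
  have "(\<Sum>i\<in>F. q i - p i) = (\<Sum>i\<in>F. measure lborel (I i))"
    using le by (intro sum.cong) (auto simp: I_def conf_le_def)
  also have "\<dots> = measure lborel (\<Union>i\<in>F. I i)"
  proof (rule measure_finite_Union[symmetric, OF F(1)])
    show "I ` F \<subseteq> sets lborel" by (auto simp: I_def)
    show "disjoint_family_on I F" using disj by (auto simp: disjoint_family_on_def)
    show "emeasure lborel (I i) \<noteq> \<infinity>" for i
      using le by (simp add: I_def conf_le_def)
  qed
  also have "\<dots> \<le> measure lborel {0..2 :: real}"
  proof (rule measure_mono_fmeasurable)
    show "(\<Union>i\<in>F. I i) \<in> sets lborel" using F(1) by (auto simp: I_def)
  qed (use I2 in \<open>auto intro: fmeasurable_compact\<close>)
  finally show ?thesis by simp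
qed

end

lemma SUP_add_const:
  fixes f :: "'a \<Rightarrow> real"
  assumes "A \<noteq> {}" "bdd_above (f ` A)" shows "(SUP a\<in>A. f a + c) = (SUP a\<in>A. f a) + c"
proof (rule antisym)
  show "(SUP a\<in>A. f a + c) \<le> (SUP a\<in>A. f a) + c"
    by (rule cSUP_least[OF assms(1)]) (simp add: cSUP_upper assms(2))
  obtain M where "\<And>a. a \<in> A \<Longrightarrow> f a \<le> M" using assms(2) by (auto simp: bdd_above_def)
  then have bdd: "bdd_above ((\<lambda>a. f a + c) ` A)" by (intro bdd_aboveI2[of _ _ "M + c"]) auto
  have "(SUP a\<in>A. f a) \<le> (SUP a\<in>A. f a + c) - c"
  proof (rule cSUP_least[OF assms(1)])
    fix a assume "a \<in> A"
    then have "f a + c \<le> (SUP a\<in>A. f a + c)" by (rule cSUP_upper[OF _ bdd])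
    then show "f a \<le> (SUP a\<in>A. f a + c) - c" by simp
  qed
  then show "(SUP a\<in>A. f a) + c \<le> (SUP a\<in>A. f a + c)" by simp
qed

lemma INF_add_const:
  fixes f :: "'a \<Rightarrow> real"
  assumes "A \<noteq> {}" "bdd_below (f ` A)" shows "(INF a\<in>A. f a + c) = (INF a\<in>A. f a) + c"
proof -
  obtain M where "\<And>a. a \<in> A \<Longrightarrow> M \<le> f a" using assms(2) by (auto simp: bdd_below_def)
  then have "bdd_above ((\<lambda>a. - f a) ` A)" by (intro bdd_aboveI2[of _ _ "- M"]) auto
  from SUP_add_const[OF assms(1) this, of "- c"] show ?thesis
    by (simp add: Inf_real_def image_image)
qed

section \<open>The order interval of a gap as a monotone flow\<close>

context gap
begin

lemma K_sup:
  assumes B: "B \<subseteq> K" "B \<noteq> {}" shows "(\<lambda>i. SUP a\<in>B. a i) \<in> K"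
proof -
  have le: "p i \<le> a i" "a i \<le> q i" if "a \<in> B" for a i using B that by (auto simp: K_def conf_le_def)
  then have bdd: "bdd_above ((\<lambda>a. a i) ` B)" for i by (intro bdd_aboveI2) auto
  obtain a0 where a0: "a0 \<in> B" using B by blast
  have "p i \<le> (SUP a\<in>B. a i)" for i
    using le(1)[OF a0, of i] cSUP_upper[OF a0 bdd, of i] by linarith
  moreover have "(SUP a\<in>B. a i) \<le> q i" for i by (rule cSUP_least[OF B(2)]) (rule le(2))
  moreover have "tau k l (\<lambda>i. SUP a\<in>B. a i) = (\<lambda>i. SUP a\<in>B. a i)" if "ipair w k + real_of_int l = 0" for k l
  proof
    fix i
    have "tau k l a = a" if "a \<in> B" for a
      using B that \<open>ipair w k + real_of_int l = 0\<close> by (auto simp: K_def resonant_def)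
    then have *: "a (i + k) + real_of_int l = a i" if "a \<in> B" for a
      using that by (metis tau_apply)
    have "(SUP a\<in>B. a (i + k)) + real_of_int l = (SUP a\<in>B. a (i + k) + real_of_int l)"
      by (rule SUP_add_const[OF B(2) bdd, symmetric])
    also have "\<dots> = (SUP a\<in>B. a i)" by (rule SUP_cong) (auto simp: *)
    finally show "tau k l (\<lambda>i. SUP a\<in>B. a i) i = (SUP a\<in>B. a i)" by (simp add: tau_def)
  qed
  ultimately show ?thesis by (simp add: K_def conf_le_def resonant_def)
qed

lemma K_inf:
  assumes B: "B \<subseteq> K" "B \<noteq> {}" shows "(\<lambda>i. INF a\<in>B. a i) \<in> K"
proof -
  have le: "p i \<le> a i" "a i \<le> q i" if "a \<in> B" for a i using B that by (auto simp: K_def conf_le_def)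
  then have bdd: "bdd_below ((\<lambda>a. a i) ` B)" for i by (intro bdd_belowI2) auto
  obtain a0 where a0: "a0 \<in> B" using B by blast
  have "(INF a\<in>B. a i) \<le> q i" for i
    using le(2)[OF a0, of i] cINF_lower[OF bdd a0, of i] by linarith
  moreover have "p i \<le> (INF a\<in>B. a i)" for i by (rule cINF_greatest[OF B(2)]) (rule le(1))
  moreover have "tau k l (\<lambda>i. INF a\<in>B. a i) = (\<lambda>i. INF a\<in>B. a i)" if "ipair w k + real_of_int l = 0" for k l
  proof
    fix i
    have "tau k l a = a" if "a \<in> B" for a
      using B that \<open>ipair w k + real_of_int l = 0\<close> by (auto simp: K_def resonant_def)
    then have *: "a (i + k) + real_of_int l = a i" if "a \<in> B" for a
      using that by (metis tau_apply)
    have "(INF a\<in>B. a (i + k)) + real_of_int l = (INF a\<in>B. a (i + k) + real_of_int l)"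
      by (rule INF_add_const[OF B(2) bdd, symmetric])
    also have "\<dots> = (INF a\<in>B. a i)" by (rule INF_cong) (auto simp: *)
    finally show "tau k l (\<lambda>i. INF a\<in>B. a i) i = (INF a\<in>B. a i)" by (simp add: tau_def)
  qed
  ultimately show ?thesis by (simp add: K_def conf_le_def resonant_def)
qed

lemma compact_K: "compact K"
proof -
  have "K \<subseteq> {z. \<forall>i. p i \<le> z i \<and> z i \<le> q i}" by (auto simp: K_def conf_le_def)
  then show ?thesis
    using compact_Int_closed[OF compact_conf_box closed_K, of p q] by (simp add: inf.absorb2)
qed

lemma K_segment:
  assumes "0 \<le> s" "s \<le> 1" shows "(\<lambda>i. p i + s * (q i - p i)) \<in> K"
proof -
  have pq: "p i \<le> q i" for i using le_pq by (simp add: conf_le_def)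
  have "p i + s * (q i - p i) \<le> q i" for i
    using mult_right_mono[OF assms(2), of "q i - p i"] pq[of i] by simp
  moreover have "p i \<le> p i + s * (q i - p i)" for i using assms(1) pq[of i] by simp
  moreover have "resonant w (\<lambda>i. p i + s * (q i - p i))"
    unfolding resonant_def
  proof (intro allI impI ext)
    fix k l i assume "ipair w k + real_of_int l = 0"
    then have "tau k l p i = p i" "tau k l q i = q i" using res_p res_q by (simp_all add: resonant_def)
    then have *: "p (i + k) = p i - real_of_int l" "q (i + k) = q i - real_of_int l" by (simp_all add: tau_def)
    show "tau k l (\<lambda>i. p i + s * (q i - p i)) i = p i + s * (q i - p i)" by (simp add: tau_def *)
  qed
  ultimately show ?thesis by (simp add: K_def conf_le_def)
qed

lemma monotone_orbit_in_gap:
  assumes pq: "p 0 < q 0"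
  shows "\<exists>z\<in>K. z \<noteq> p \<and> z \<noteq> q \<and> (\<forall>t. \<Phi> t z \<in> K) \<and>
    ((\<forall>s t. s \<le> t \<longrightarrow> conf_le (\<Phi> s z) (\<Phi> t z)) \<or> (\<forall>s t. s \<le> t \<longrightarrow> conf_le (\<Phi> t z) (\<Phi> s z)))"
proof (cases "\<exists>z\<in>K. z \<noteq> p \<and> z \<noteq> q \<and> (\<forall>t\<ge>0. \<Phi> t z = z)")
  case True
  then obtain z where z: "z \<in> K" "z \<noteq> p" "z \<noteq> q" "\<And>t. 0 \<le> t \<Longrightarrow> \<Phi> t z = z" by blast
  have "\<Phi> t z = z" for t
  proof (cases "0 \<le> t")
    case False
    then have "\<Phi> t (\<Phi> (- t) z) = \<Phi> t z" using z(4)[of "- t"] by simp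
    then show ?thesis by (simp add: Psi_add Psi_0 tame_K z(1))
  qed (rule z(4))
  then show ?thesis using z(1-3) by (intro bexI[of _ z]) auto
next
  case False
  then have fixed: "z = p \<or> z = q" if "z \<in> K" "\<And>t. 0 \<le> t \<Longrightarrow> \<Phi> t z = z" for z using that by blast
  interpret F: monotone_flow \<Phi> K p q
  proof
    show "\<Phi> t p = p" "\<Phi> t q = q" for t
      using Psi_stationary tame_K p_in_K q_in_K stat_p stat_q by blast+
  qed (use compact_K p_in_K q_in_K K_sup K_inf Psi_0 Psi_add tame_K Psi_in_K Psi_mono
      Psi_continuous K_tendsto fixed in \<open>auto simp: K_def\<close>)
  \<comment> \<open>The level lies strictly between the end points, which keeps the orbit different
    from both.\<close>
  have "\<exists>z\<in>K. z 0 = (p 0 + q 0) / 2 \<and> (\<forall>t. \<Phi> t z \<in> K) \<and>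
    ((\<forall>s t. s \<le> t \<longrightarrow> conf_le (\<Phi> s z) (\<Phi> t z)) \<or> (\<forall>s t. s \<le> t \<longrightarrow> conf_le (\<Phi> t z) (\<Phi> s z)))"
  proof (rule F.connecting_orbit)
    fix y t z assume y: "y \<in> K" "\<And>s. \<Phi> s y \<in> K" and t: "filterlim t at_bot sequentially"
      and lim: "(\<lambda>n. \<Phi> (t n) y) \<longlonglongrightarrow> z"
    have "z \<in> K" by (rule closed_sequentially[OF closed_K _ lim]) (rule y)
    moreover have "\<Phi> t z = z" for t
      using Psi_stationary[OF tame_K[OF \<open>z \<in> K\<close>]] alpha_limit_stationary[OF y(2) tame_K[OF y(1)] t lim] by blast
    ultimately show "z = p \<or> z = q" using fixed by blast
  qed (use pq K_segment in auto)
  then obtain z where "z \<in> K" "z 0 = (p 0 + q 0) / 2" "\<forall>t. \<Phi> t z \<in> K"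
    "(\<forall>s t. s \<le> t \<longrightarrow> conf_le (\<Phi> s z) (\<Phi> t z)) \<or> (\<forall>s t. s \<le> t \<longrightarrow> conf_le (\<Phi> t z) (\<Phi> s z))" by blast
  moreover from this(2) have "z \<noteq> p" "z \<noteq> q" using pq by auto
  ultimately show ?thesis by blast
qed

end

section \<open>Maximal invariant chains are ghost circles\<close>

locale maximal_chain = chain S r C w x G
  for S :: "'d::finite pot" and r C :: real and w :: "real ^ 'd" and x :: "'d conf" and G :: "'d conf set" +
  assumes maximal: "\<And>G'. invariant_chain w x G' \<Longrightarrow> G \<subseteq> G' \<Longrightarrow> G' = G"
begin

lemma closed_G: "closed G"
  using maximal[OF closure_invariant_chain closure_subset] closed_closure by metis

lemma no_gap: "\<not> is_gap p q"
proof
  assume g: "is_gap p q"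
  have pG: "p \<in> G" and qG: "q \<in> G" and le: "conf_le p q" and ne: "p \<noteq> q"
    and gp: "\<And>z. z \<in> G \<Longrightarrow> conf_le z p \<or> conf_le q z" using g by (auto simp: is_gap_def)
  have "p 0 < q 0" using strictly_ordered[OF pG qG] ne le unfolding conf_ll_def conf_le_def
    by (meson linorder_not_less)
  have "conf_le q (tau 0 1 p)"
  proof -
    have "\<not> conf_le (tau 0 1 p) p" by (auto simp: conf_le_def tau_def)
    then show ?thesis using gp tauG[OF pG] by blast
  qed
  then have q1: "q i \<le> p i + 1" for i by (simp add: conf_le_def tau_def)
  interpret g: gap S r C w p q
    by unfold_locales
      (use gap_stationary[OF g] slope_bound res pG qG le q1 gap_sum_le[OF g] in auto)
  obtain z where z: "z \<in> g.K" "z \<noteq> p" "z \<noteq> q" "\<And>t. \<Phi> t z \<in> g.K"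
    "(\<forall>s t. s \<le> t \<longrightarrow> conf_le (\<Phi> s z) (\<Phi> t z)) \<or> (\<forall>s t. s \<le> t \<longrightarrow> conf_le (\<Phi> t z) (\<Phi> s z))"
    using g.monotone_orbit_in_gap[OF \<open>p 0 < q 0\<close>] by blast
  have "resonant w z" using z(1) by (simp add: g.K_def)
  then have "invariant_chain w x (G \<union> {tau k l (\<Phi> t z) | k l t. True})"
    by (intro extend[OF g g.tame_K[OF z(1)]]) (use z(4,5) in \<open>auto simp: g.K_def\<close>)
  then have "G \<union> {tau k l (\<Phi> t z) | k l t. True} = G" by (rule maximal) blast
  moreover have "z = tau 0 0 (\<Phi> 0 z)" using Psi_0[OF g.tame_K[OF z(1)]] by simp
  ultimately have "z \<in> G" by blast
  then show False using gp[of z] z(1-3) conf_le_antisym by (auto simp: g.K_def)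
qed

text \<open>Closedness of G puts the supremum of the members at or below the level, and the infimum
  of those at or above it, into G. If neither attained the level at i, they would bound a
  gap.\<close>

lemma level_attained: "\<exists>a\<in>G. a i = \<xi>"
proof -
  define L U where "L = {a \<in> G. a i \<le> \<xi>}" and "U = {a \<in> G. \<xi> \<le> a i}"
  define lo hi where "lo = tau 0 (\<lfloor>\<xi> - x i\<rfloor> - 1) x" and "hi = tau 0 (\<lceil>\<xi> - x i\<rceil> + 1) x"
  have lo: "lo \<in> G" "lo i < \<xi>"
    unfolding lo_def by (rule tauG[OF xG], simp add: tau_def, linarith)
  have hi: "hi \<in> G" "\<xi> < hi i"
    unfolding hi_def by (rule tauG[OF xG], simp add: tau_def, linarith)
  have L0: "L \<noteq> {}" and U0: "U \<noteq> {}" using lo hi by (auto simp: L_def U_def intro: less_imp_le)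
  have bL: "bdd_above ((\<lambda>a. a j) ` L)" for j
  proof (rule bdd_aboveI2)
    fix a assume "a \<in> L"
    then have "conf_le a hi" using le_of_less_at[of a hi i] hi by (auto simp: L_def)
    then show "a j \<le> hi j" by (simp add: conf_le_def)
  qed
  have bU: "bdd_below ((\<lambda>a. a j) ` U)" for j
  proof (rule bdd_belowI2)
    fix a assume "a \<in> U"
    then have "conf_le lo a" using le_of_less_at[of lo a i] lo by (auto simp: U_def)
    then show "lo j \<le> a j" by (simp add: conf_le_def)
  qed
  define s t where "s = (\<lambda>j. SUP a\<in>L. a j)" and "t = (\<lambda>j. INF a\<in>U. a j)"
  obtain f where f: "\<And>n. f n \<in> L" "f \<longlonglongrightarrow> s"
    using chain_sup_seq[OF L0 _ bL] total unfolding s_def L_def by blast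
  obtain g where g: "\<And>n. g n \<in> U" "g \<longlonglongrightarrow> t"
    using chain_inf_seq[OF U0 _ bU] total unfolding t_def U_def by blast
  have sG: "s \<in> G" by (rule closed_sequentially[OF closed_G _ f(2)]) (use f(1) in \<open>simp add: L_def\<close>)
  have tG: "t \<in> G" by (rule closed_sequentially[OF closed_G _ g(2)]) (use g(1) in \<open>simp add: U_def\<close>)
  have s: "s i \<le> \<xi>" unfolding s_def by (rule cSUP_least[OF L0]) (simp add: L_def)
  have t: "\<xi> \<le> t i" unfolding t_def by (rule cINF_greatest[OF U0]) (simp add: U_def)
  have Ls: "conf_le a s" if "a \<in> L" for a unfolding conf_le_def s_def using cSUP_upper[OF that bL] by blast
  have tU: "conf_le t a" if "a \<in> U" for a unfolding conf_le_def t_def using cINF_lower[OF bU that] by blast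
  have "s i = \<xi> \<or> t i = \<xi>"
  proof (rule ccontr)
    assume "\<not> ?thesis"
    then have "s i < t i" using s t by linarith
    moreover have "conf_le z s \<or> conf_le t z" if "z \<in> G" for z
      using that Ls tU unfolding L_def U_def by (cases "z i \<le> \<xi>") auto
    ultimately have "is_gap s t" using sG tG le_of_less_at[OF sG tG] by (auto simp: is_gap_def)
    then show False using no_gap by blast
  qed
  then show ?thesis using sG tG by blast
qed

text \<open>The value at the origin determines a member, so it parametrizes G by the reals. Each
  coordinate is a monotone function of the parameter and is onto by \<open>level_attained\<close>; a
  monotone function onto the reals has no jumps.\<close>

lemma connected_G: "connected G"
proof -
  obtain \<sigma> where \<sigma>: "\<And>\<xi>. \<sigma> \<xi> \<in> G" "\<And>\<xi>. \<sigma> \<xi> 0 = \<xi>" using level_attained[of 0] by metis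
  have inv: "\<sigma> (a 0) = a" if "a \<in> G" for a
    by (rule eq_at_point[OF \<sigma>(1) that, of _ 0]) (rule \<sigma>(2))
  have "continuous_on UNIV (\<lambda>\<xi>. \<sigma> \<xi> i)" for i
  proof (rule continuous_onI_mono)
    have "\<eta> \<in> range (\<lambda>\<xi>. \<sigma> \<xi> i)" for \<eta>
    proof -
      obtain a where "a \<in> G" "a i = \<eta>" using level_attained by blast
      then show ?thesis using inv by (intro image_eqI[of _ _ "a 0"]) auto
    qed
    then have "range (\<lambda>\<xi>. \<sigma> \<xi> i) = UNIV" by blast
    then show "open (range (\<lambda>\<xi>. \<sigma> \<xi> i))" by simp
    show "\<sigma> \<xi> i \<le> \<sigma> \<eta> i" if "\<xi> \<le> \<eta>" for \<xi> \<eta>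
    proof (cases "\<xi> = \<eta>")
      case False
      then have "conf_le (\<sigma> \<xi>) (\<sigma> \<eta>)" using that by (intro le_of_less_at[of _ _ 0] \<sigma>(1)) (simp add: \<sigma>(2))
      then show ?thesis by (simp add: conf_le_def)
    qed simp
  qed
  then have "continuous_on UNIV \<sigma>" by (rule continuous_on_coordinatewise_then_product)
  then have "connected (range \<sigma>)" by (rule connected_continuous_image) simp
  moreover have "range \<sigma> = G" 
  proof
    show "G \<subseteq> range \<sigma>"
    proof
      fix a assume "a \<in> G"
      then have "a = \<sigma> (a 0)" by (rule inv[symmetric])
      then show "a \<in> range \<sigma>" by (rule range_eqI)
    qed
  qed (use \<sigma>(1) in blast)
  ultimately show ?thesis by simp
qed

lemma ghost_circle_G: "ghost_circle S r G"
proof -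
  have "tau k l ` G = G" for k l
  proof
    show "G \<subseteq> tau k l ` G"
    proof
      fix a assume "a \<in> G"
      then show "a \<in> tau k l ` G" using tauG by (intro image_eqI[of _ _ "tau (- k) (- l) a"]) auto
    qed
  qed (use tauG in auto)
  moreover have "\<Phi> t ` G = G" for t
  proof
    show "G \<subseteq> \<Phi> t ` G"
    proof
      fix a assume "a \<in> G"
      then show "a \<in> \<Phi> t ` G"
        using PsiG by (intro image_eqI[of _ _ "\<Phi> (- t) a"]) (auto simp: Psi_add Psi_0 tame)
    qed
  qed (use PsiG in auto)
  moreover have "inX a" if a: "a \<in> G" for a
    using tame[OF a] normX_bound(1) unfolding tame_def by blast
  ultimately show ?thesis
    unfolding ghost_circle_def using xG closed_G connected_G strictly_ordered by blast
qed

lemma AM_subset: "AM w x \<subseteq> G"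
proof -
  have "Mtilde x \<subseteq> G"
    unfolding Mtilde_def by (rule closure_minimal[OF _ closed_G]) (use tauG[OF xG] in auto)
  then show ?thesis unfolding AM_def by blast
qed

end

section \<open>Existence of a maximal chain and conclusion\<close>

context lattice_potential
begin

lemma orbit_invariant_chain:
  assumes slope: "\<And>i k. \<bar>x (i + k) - x i - ipair w k\<bar> \<le> 1" and "birkhoff x" "resonant w x"
    and stat: "\<And>i. gradW S r x i = 0"
  shows "invariant_chain w x {tau k l x | k l. True}"
proof -
  have "\<bar>x (i + k) - x i - ipair w k\<bar> \<le> 3" for i k using slope[of i k] by linarith
  then have "slope_bound w x" by (simp add: slope_bound_def)
  then have tame: "tame x" by (rule slope_bound_tame)
  have tot: "conf_le (tau k l x) (tau k' l' x) \<or> conf_le (tau k' l' x) (tau k l x)" for k l k' l'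
    unfolding tau_le_iff[of k l x] le_tau_iff[of _ k l x] tau_tau using assms(2) unfolding birkhoff_def by blast
  show ?thesis
    unfolding invariant_chain_def
  proof (intro conjI ballI allI)
    show "x \<in> {tau k l x | k l. True}" using tau_zero[of x] by (metis (mono_tags, lifting) mem_Collect_eq)
  next
    fix a assume "a \<in> {tau k l x | k l. True}"
    then obtain k l where a: "a = tau k l x" by blast
    show "resonant w a" using assms(3) unfolding a resonant_def by (metis add.commute tau_tau)
    show "tau k' l' a \<in> {tau k l x | k l. True}" for k' l' unfolding a tau_tau by blast
    show "\<Phi> t a \<in> {tau k l x | k l. True}" for t
      unfolding a by (simp add: Psi_tau[OF tame] Psi_stationary[OF tame stat]) blast
  next
    fix a b assume "a \<in> {tau k l x | k l. True}" "b \<in> {tau k l x | k l. True}"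
    then show "conf_le a b \<or> conf_le b a" using tot by blast
  qed
qed

text \<open>Each clause of \<open>invariant_chain\<close> concerns one or two members, so it passes
  to the union of a nested family.\<close>

lemma exists_maximal_chain:
  assumes "invariant_chain w x G0"
  shows "\<exists>G. invariant_chain w x G \<and> (\<forall>G'. invariant_chain w x G' \<longrightarrow> G \<subseteq> G' \<longrightarrow> G' = G)"
proof -
  have "\<exists>M\<in>{G. invariant_chain w x G}. \<forall>X\<in>{G. invariant_chain w x G}. M \<subseteq> X \<longrightarrow> X = M"
  proof (rule subset_Zorn_nonempty)
    fix \<C> assume ne: "\<C> \<noteq> {}" and "subset.chain {G. invariant_chain w x G} \<C>"
    then have ic: "\<And>X. X \<in> \<C> \<Longrightarrow> invariant_chain w x X" and ch: "\<And>X Y. X \<in> \<C> \<Longrightarrow> Y \<in> \<C> \<Longrightarrow> X \<subseteq> Y \<or> Y \<subseteq> X"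
      by (auto simp: subset_chain_def)
    have le: "conf_le a b \<or> conf_le b a" if "a \<in> X" "b \<in> Y" "X \<in> \<C>" "Y \<in> \<C>" for a b X Y
      using ch[OF that(3,4)] ic[OF that(3)] ic[OF that(4)] that(1,2) unfolding invariant_chain_def by blast
    show "\<Union>\<C> \<in> {G. invariant_chain w x G}"
      unfolding mem_Collect_eq invariant_chain_def
    proof (intro conjI ballI allI)
      show "x \<in> \<Union>\<C>" using ne ic unfolding invariant_chain_def by blast
    next
      fix a assume "a \<in> \<Union>\<C>"
      then obtain X where X: "X \<in> \<C>" "a \<in> X" by blast
      have "resonant w a" "\<And>k l. tau k l a \<in> X" "\<And>t. \<Phi> t a \<in> X"
        using ic[OF X(1)] X(2) unfolding invariant_chain_def by blast+
      then show "resonant w a" "\<And>k l. tau k l a \<in> \<Union>\<C>" "\<And>t. \<Phi> t a \<in> \<Union>\<C>"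
        using X(1) by blast+
    next
      fix a b assume "a \<in> \<Union>\<C>" "b \<in> \<Union>\<C>"
      then show "conf_le a b \<or> conf_le b a" using le by blast
    qed
  qed (use assms in blast)
  then show ?thesis by blast
qed

end

theorem mainTheorem18:
  fixes S :: "'d::finite pot" and r :: real and w :: "real ^ 'd"
  assumes "condA S r" and "condB S" and "condC S" and "condD S" and "condE S"
    and "\<not> (\<forall>m. w $ m \<in> \<rat>)"
  shows "\<exists>G. ghost_circle S r G \<and> G \<subseteq> Bbar w \<and>
           (\<exists>x\<in>G. global_min S r x \<and> AM w x \<subseteq> G)"
proof -
  obtain C where C: "\<And>i k j x. \<bar>pd i (pd k (S j)) x\<bar> \<le> C"
    using assms(5) unfolding condE_def by blast
  interpret lattice_potential S r C by unfold_locales (use assms C in auto)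
  obtain x where x: "global_min S r x" "\<And>i k. \<bar>x (i + k) - x i - ipair w k\<bar> \<le> 1" "birkhoff x" "resonant w x"
    using exists_resonant_minimizer by blast
  have "invariant_chain w x {tau k l x | k l. True}"
    by (rule orbit_invariant_chain) (use x global_min_stationary in auto)
  from exists_maximal_chain[OF this] obtain G where G: "invariant_chain w x G"
      "\<forall>G'. invariant_chain w x G' \<longrightarrow> G \<subseteq> G' \<longrightarrow> G' = G"
    by (elim exE conjE)
  interpret maximal_chain S r C w x G by unfold_locales (use x G in auto)
  show ?thesis using ghost_circle_G in_Bbar xG x(1) AM_subset by blast
qed

end
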